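(* Let $\mathcal{E}$ be a lextensive, cartesian closed category. Then $\mathcal{E}$ is well-pointed if and only if the $2$-category $\mathbf{Cat}(\mathcal{E})$ is $2$-well-pointed.
   Context: A category with pullbacks is extensive if it has finite coproducts and for all $A,B$ the functor $\mathcal{E}/A\times\mathcal{E}/B\to\mathcal{E}/(A+B)$ taking coproducts is an equivalence; it is lextensive if moreover it has a terminal object. $\mathbf{Cat}(\mathcal{E})$ is the $2$-category of categories, functors and natural transformations internal to $\mathcal{E}$. A category $\mathcal{E}$ is well-pointed if it has a terminal object $\mathbf{1}$ and $\mathcal{E}(\mathbf{1},-):\mathcal{E}\to\mathbf{Set}$ is faithful. A $2$-category $\mathcal{K}$ is $2$-well-pointed if it has a terminal object $\underline{\mathbf 1}$, the copower $\mathbf{2}\odot\underline{\mathbf 1}$ exists in $\mathcal{K}$ (where $\mathbf{2}=\{\bullet\to\bullet\}$ and $\mathcal{K}(\mathbf{2}\odot A,B)\cong\mathbf{Cat}(\mathbf{2},\mathcal{K}(A,B))$, $2$-naturally in $B$), and the $2$-functor $\mathcal{K}(\mathbf{2}\odot\underline{\mathbf 1},-):\mathcal{K}\to\mathbf{Cat}$ is faithful on $1$-cells and on $2$-cells. *)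

theory Defs
  imports "HOL-Library.FuncSet"
begin

section \<open>Categories, functors, natural transformations\<close>

record ('o, 'a) cat =
  Ob :: "'o set"
  Ar :: "'a set"
  Dom :: "'a \<Rightarrow> 'o"
  Cod :: "'a \<Rightarrow> 'o"
  Ide :: "'o \<Rightarrow> 'a"
  Comp :: "'a \<Rightarrow> 'a \<Rightarrow> 'a"  (infixl "\<cdot>\<index>" 70)

definition hom :: "('o, 'a) cat \<Rightarrow> 'o \<Rightarrow> 'o \<Rightarrow> 'a set" where
  "hom C x y = {f \<in> Ar C. Dom C f = x \<and> Cod C f = y}"

locale category =
  fixes C :: "('o, 'a) cat" (structure)
  assumes dom_ob: "f \<in> Ar C \<Longrightarrow> Dom C f \<in> Ob C"
    and cod_ob: "f \<in> Ar C \<Longrightarrow> Cod C f \<in> Ob C"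
    and id_hom: "x \<in> Ob C \<Longrightarrow> Ide C x \<in> hom C x x"
    and comp_hom: "f \<in> hom C x y \<Longrightarrow> g \<in> hom C y z \<Longrightarrow> g \<cdot> f \<in> hom C x z"
    and id_left: "f \<in> hom C x y \<Longrightarrow> Ide C y \<cdot> f = f"
    and id_right: "f \<in> hom C x y \<Longrightarrow> f \<cdot> Ide C x = f"
    and assoc: "f \<in> hom C w x \<Longrightarrow> g \<in> hom C x y \<Longrightarrow> h \<in> hom C y z \<Longrightarrow> (h \<cdot> g) \<cdot> f = h \<cdot> (g \<cdot> f)"

definition is_iso :: "('o, 'a) cat \<Rightarrow> 'a \<Rightarrow> bool" where
  "is_iso C f \<longleftrightarrow> f \<in> Ar C \<and>
     (\<exists>g \<in> hom C (Cod C f) (Dom C f).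
        g \<cdot>\<^bsub>C\<^esub> f = Ide C (Dom C f) \<and> f \<cdot>\<^bsub>C\<^esub> g = Ide C (Cod C f))"

text \<open>Functors and natural transformations consist of functions that are undefined outside
  their domain, so that HOL equality is equality of functors and of natural transformations.\<close>

record ('x, 'y, 'u, 'v) func =
  FO :: "'x \<Rightarrow> 'u"
  FA :: "'y \<Rightarrow> 'v"

definition is_functor :: "('x, 'y) cat \<Rightarrow> ('u, 'v) cat \<Rightarrow> ('x, 'y, 'u, 'v) func \<Rightarrow> bool" where
  "is_functor C D F \<longleftrightarrow>
     FO F \<in> Ob C \<rightarrow>\<^sub>E Ob D \<and> FA F \<in> Ar C \<rightarrow>\<^sub>E Ar D \<and>
     (\<forall>f \<in> Ar C. Dom D (FA F f) = FO F (Dom C f) \<and> Cod D (FA F f) = FO F (Cod C f)) \<and>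
     (\<forall>x \<in> Ob C. FA F (Ide C x) = Ide D (FO F x)) \<and>
     (\<forall>x y z. \<forall>f \<in> hom C x y. \<forall>g \<in> hom C y z. FA F (g \<cdot>\<^bsub>C\<^esub> f) = FA F g \<cdot>\<^bsub>D\<^esub> FA F f)"

definition func_id :: "('x, 'y) cat \<Rightarrow> ('x, 'y, 'x, 'y) func" where
  "func_id C = \<lparr>FO = (\<lambda>x \<in> Ob C. x), FA = (\<lambda>f \<in> Ar C. f)\<rparr>"

text \<open>The first argument of the composition and whiskering operations below is the source
  category of the composite; it is only needed to restrict the resulting functions.\<close>

definition func_comp :: "('x, 'y) cat \<Rightarrow> ('u, 'v, 's, 't) func \<Rightarrow> ('x, 'y, 'u, 'v) func
    \<Rightarrow> ('x, 'y, 's, 't) func" where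
  "func_comp C G F = \<lparr>FO = (\<lambda>x \<in> Ob C. FO G (FO F x)), FA = (\<lambda>f \<in> Ar C. FA G (FA F f))\<rparr>"

definition faithful :: "('x, 'y) cat \<Rightarrow> ('x, 'y, 'u, 'v) func \<Rightarrow> bool" where
  "faithful C F \<longleftrightarrow> (\<forall>x \<in> Ob C. \<forall>y \<in> Ob C. inj_on (FA F) (hom C x y))"

definition is_iso_functor :: "('x, 'y) cat \<Rightarrow> ('u, 'v) cat \<Rightarrow> ('x, 'y, 'u, 'v) func \<Rightarrow> bool" where
  "is_iso_functor C D F \<longleftrightarrow> is_functor C D F \<and>
     (\<exists>G. is_functor D C G \<and> func_comp C G F = func_id C \<and> func_comp D F G = func_id D)"

record ('x, 'y, 'u, 'v) ntrans =
  NSrc :: "('x, 'y, 'u, 'v) func"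
  NTgt :: "('x, 'y, 'u, 'v) func"
  NMap :: "'x \<Rightarrow> 'v"

definition is_ntrans :: "('x, 'y) cat \<Rightarrow> ('u, 'v) cat \<Rightarrow> ('x, 'y, 'u, 'v) ntrans \<Rightarrow> bool" where
  "is_ntrans C D \<alpha> \<longleftrightarrow>
     is_functor C D (NSrc \<alpha>) \<and> is_functor C D (NTgt \<alpha>) \<and>
     NMap \<alpha> \<in> extensional (Ob C) \<and>
     (\<forall>x \<in> Ob C. NMap \<alpha> x \<in> hom D (FO (NSrc \<alpha>) x) (FO (NTgt \<alpha>) x)) \<and>
     (\<forall>f \<in> Ar C. FA (NTgt \<alpha>) f \<cdot>\<^bsub>D\<^esub> NMap \<alpha> (Dom C f) = NMap \<alpha> (Cod C f) \<cdot>\<^bsub>D\<^esub> FA (NSrc \<alpha>) f)"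

definition ntid :: "('x, 'y) cat \<Rightarrow> ('u, 'v) cat \<Rightarrow> ('x, 'y, 'u, 'v) func \<Rightarrow> ('x, 'y, 'u, 'v) ntrans"
  where "ntid C D F = \<lparr>NSrc = F, NTgt = F, NMap = (\<lambda>x \<in> Ob C. Ide D (FO F x))\<rparr>"

definition vcomp :: "('x, 'y) cat \<Rightarrow> ('u, 'v) cat \<Rightarrow> ('x, 'y, 'u, 'v) ntrans
    \<Rightarrow> ('x, 'y, 'u, 'v) ntrans \<Rightarrow> ('x, 'y, 'u, 'v) ntrans" where
  "vcomp C D \<beta> \<alpha> = \<lparr>NSrc = NSrc \<alpha>, NTgt = NTgt \<beta>,
     NMap = (\<lambda>x \<in> Ob C. NMap \<beta> x \<cdot>\<^bsub>D\<^esub> NMap \<alpha> x)\<rparr>"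

definition hcomp :: "('x, 'y) cat \<Rightarrow> ('s, 't) cat \<Rightarrow> ('u, 'v, 's, 't) ntrans
    \<Rightarrow> ('x, 'y, 'u, 'v) ntrans \<Rightarrow> ('x, 'y, 's, 't) ntrans" where
  "hcomp C E \<beta> \<alpha> = \<lparr>NSrc = func_comp C (NSrc \<beta>) (NSrc \<alpha>), NTgt = func_comp C (NTgt \<beta>) (NTgt \<alpha>),
     NMap = (\<lambda>x \<in> Ob C. NMap \<beta> (FO (NTgt \<alpha>) x) \<cdot>\<^bsub>E\<^esub> FA (NSrc \<beta>) (NMap \<alpha> x))\<rparr>"

definition whisker_left :: "('x, 'y) cat \<Rightarrow> ('u, 'v, 's, 't) func
    \<Rightarrow> ('x, 'y, 'u, 'v) ntrans \<Rightarrow> ('x, 'y, 's, 't) ntrans" where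
  "whisker_left C H \<alpha> = \<lparr>NSrc = func_comp C H (NSrc \<alpha>), NTgt = func_comp C H (NTgt \<alpha>),
     NMap = (\<lambda>x \<in> Ob C. FA H (NMap \<alpha> x))\<rparr>"

definition whisker_right :: "('x, 'y) cat \<Rightarrow> ('u, 'v, 's, 't) ntrans
    \<Rightarrow> ('x, 'y, 'u, 'v) func \<Rightarrow> ('x, 'y, 's, 't) ntrans" where
  "whisker_right C \<beta> F = \<lparr>NSrc = func_comp C (NSrc \<beta>) F, NTgt = func_comp C (NTgt \<beta>) F,
     NMap = (\<lambda>x \<in> Ob C. NMap \<beta> (FO F x))\<rparr>"

definition naturally_isomorphic :: "('x, 'y) cat \<Rightarrow> ('u, 'v) cat \<Rightarrow> ('x, 'y, 'u, 'v) func
    \<Rightarrow> ('x, 'y, 'u, 'v) func \<Rightarrow> bool" where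
  "naturally_isomorphic C D F G \<longleftrightarrow>
     (\<exists>\<alpha>. is_ntrans C D \<alpha> \<and> NSrc \<alpha> = F \<and> NTgt \<alpha> = G \<and> (\<forall>x \<in> Ob C. is_iso D (NMap \<alpha> x)))"

definition is_equivalence :: "('x, 'y) cat \<Rightarrow> ('u, 'v) cat \<Rightarrow> ('x, 'y, 'u, 'v) func \<Rightarrow> bool" where
  "is_equivalence C D F \<longleftrightarrow> is_functor C D F \<and>
     (\<exists>G. is_functor D C G \<and> naturally_isomorphic C C (func_id C) (func_comp C G F) \<and>
          naturally_isomorphic D D (func_comp D F G) (func_id D))"

definition functor_cat :: "('x, 'y) cat \<Rightarrow> ('u, 'v) cat
    \<Rightarrow> (('x, 'y, 'u, 'v) func, ('x, 'y, 'u, 'v) ntrans) cat" where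
  "functor_cat C D = \<lparr>Ob = {F. is_functor C D F}, Ar = {\<alpha>. is_ntrans C D \<alpha>},
     Dom = NSrc, Cod = NTgt, Ide = ntid C D, Comp = vcomp C D\<rparr>"

definition prod_cat :: "('x, 'y) cat \<Rightarrow> ('u, 'v) cat \<Rightarrow> ('x \<times> 'u, 'y \<times> 'v) cat" where
  "prod_cat C D = \<lparr>Ob = Ob C \<times> Ob D, Ar = Ar C \<times> Ar D,
     Dom = (\<lambda>(f, g). (Dom C f, Dom D g)), Cod = (\<lambda>(f, g). (Cod C f, Cod D g)),
     Ide = (\<lambda>(x, y). (Ide C x, Ide D y)),
     Comp = (\<lambda>(f', g') (f, g). (f' \<cdot>\<^bsub>C\<^esub> f, g' \<cdot>\<^bsub>D\<^esub> g))\<rparr>"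

text \<open>An arrow of the slice over \<open>a\<close> from \<open>f\<close> to \<open>g\<close> is a triple \<open>(f, h, g)\<close> with \<open>g \<cdot> h = f\<close>.\<close>

definition slice_cat :: "('o, 'a) cat \<Rightarrow> 'o \<Rightarrow> ('a, 'a \<times> 'a \<times> 'a) cat" where
  "slice_cat C a = \<lparr>Ob = {f \<in> Ar C. Cod C f = a},
     Ar = {(f, h, g). f \<in> Ar C \<and> Cod C f = a \<and> g \<in> Ar C \<and> Cod C g = a \<and>
                      h \<in> hom C (Dom C f) (Dom C g) \<and> g \<cdot>\<^bsub>C\<^esub> h = f},
     Dom = (\<lambda>(f, h, g). f), Cod = (\<lambda>(f, h, g). g),
     Ide = (\<lambda>f. (f, Ide C (Dom C f), f)),
     Comp = (\<lambda>(f', h', g') (f, h, g). (f, h' \<cdot>\<^bsub>C\<^esub> h, g'))\<rparr>"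

text \<open>The category of sets whose elements have type \<open>'e\<close>; arrows carry their domain and codomain.\<close>

definition set_cat :: "('e set, 'e set \<times> ('e \<Rightarrow> 'e) \<times> 'e set) cat" where
  "set_cat = \<lparr>Ob = UNIV, Ar = {(X, f, Y). f \<in> X \<rightarrow>\<^sub>E Y},
     Dom = (\<lambda>(X, f, Y). X), Cod = (\<lambda>(X, f, Y). Y),
     Ide = (\<lambda>X. (X, (\<lambda>x \<in> X. x), X)),
     Comp = (\<lambda>(Y', g, Z) (X, f, Y). (X, compose X g f, Z))\<rparr>"

definition hom_functor :: "('o, 'a) cat \<Rightarrow> 'o
    \<Rightarrow> ('o, 'a, 'a set, 'a set \<times> ('a \<Rightarrow> 'a) \<times> 'a set) func" where
  "hom_functor C t = \<lparr>FO = (\<lambda>x \<in> Ob C. hom C t x),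
     FA = (\<lambda>f \<in> Ar C. (hom C t (Dom C f), (\<lambda>p \<in> hom C t (Dom C f). f \<cdot>\<^bsub>C\<^esub> p), hom C t (Cod C f)))\<rparr>"


section \<open>Limits, colimits and exponentials\<close>

definition is_terminal :: "('o, 'a) cat \<Rightarrow> 'o \<Rightarrow> bool" where
  "is_terminal C t \<longleftrightarrow> t \<in> Ob C \<and> (\<forall>x \<in> Ob C. \<exists>!f. f \<in> hom C x t)"

definition is_product :: "('o, 'a) cat \<Rightarrow> 'i set \<Rightarrow> ('i \<Rightarrow> 'o) \<Rightarrow> 'o \<Rightarrow> ('i \<Rightarrow> 'a) \<Rightarrow> bool" where
  "is_product C I A P \<pi> \<longleftrightarrow> P \<in> Ob C \<and> (\<forall>i \<in> I. \<pi> i \<in> hom C P (A i)) \<and>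
     (\<forall>X \<in> Ob C. \<forall>f. (\<forall>i \<in> I. f i \<in> hom C X (A i)) \<longrightarrow>
        (\<exists>!u. u \<in> hom C X P \<and> (\<forall>i \<in> I. \<pi> i \<cdot>\<^bsub>C\<^esub> u = f i)))"

definition is_coproduct :: "('o, 'a) cat \<Rightarrow> 'i set \<Rightarrow> ('i \<Rightarrow> 'o) \<Rightarrow> 'o \<Rightarrow> ('i \<Rightarrow> 'a) \<Rightarrow> bool" where
  "is_coproduct C I A P \<iota> \<longleftrightarrow> P \<in> Ob C \<and> (\<forall>i \<in> I. \<iota> i \<in> hom C (A i) P) \<and>
     (\<forall>X \<in> Ob C. \<forall>f. (\<forall>i \<in> I. f i \<in> hom C (A i) X) \<longrightarrow>
        (\<exists>!u. u \<in> hom C P X \<and> (\<forall>i \<in> I. u \<cdot>\<^bsub>C\<^esub> \<iota> i = f i)))"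

definition has_finite_products :: "('o, 'a) cat \<Rightarrow> bool" where
  "has_finite_products C \<longleftrightarrow>
     (\<forall>(n::nat) A. (\<forall>i<n. A i \<in> Ob C) \<longrightarrow> (\<exists>P \<pi>. is_product C {..<n} A P \<pi>))"

definition has_finite_coproducts :: "('o, 'a) cat \<Rightarrow> bool" where
  "has_finite_coproducts C \<longleftrightarrow>
     (\<forall>(n::nat) A. (\<forall>i<n. A i \<in> Ob C) \<longrightarrow> (\<exists>P \<iota>. is_coproduct C {..<n} A P \<iota>))"

definition is_binary_product :: "('o, 'a) cat \<Rightarrow> 'o \<Rightarrow> 'o \<Rightarrow> 'o \<Rightarrow> 'a \<Rightarrow> 'a \<Rightarrow> bool" where
  "is_binary_product C A B P p q \<longleftrightarrow> P \<in> Ob C \<and> p \<in> hom C P A \<and> q \<in> hom C P B \<and>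
     (\<forall>X \<in> Ob C. \<forall>f \<in> hom C X A. \<forall>g \<in> hom C X B.
        \<exists>!u. u \<in> hom C X P \<and> p \<cdot>\<^bsub>C\<^esub> u = f \<and> q \<cdot>\<^bsub>C\<^esub> u = g)"

definition is_binary_coproduct :: "('o, 'a) cat \<Rightarrow> 'o \<Rightarrow> 'o \<Rightarrow> 'o \<Rightarrow> 'a \<Rightarrow> 'a \<Rightarrow> bool" where
  "is_binary_coproduct C A B P i j \<longleftrightarrow> P \<in> Ob C \<and> i \<in> hom C A P \<and> j \<in> hom C B P \<and>
     (\<forall>X \<in> Ob C. \<forall>f \<in> hom C A X. \<forall>g \<in> hom C B X.
        \<exists>!u. u \<in> hom C P X \<and> u \<cdot>\<^bsub>C\<^esub> i = f \<and> u \<cdot>\<^bsub>C\<^esub> j = g)"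

definition is_pullback :: "('o, 'a) cat \<Rightarrow> 'a \<Rightarrow> 'a \<Rightarrow> 'o \<Rightarrow> 'a \<Rightarrow> 'a \<Rightarrow> bool" where
  "is_pullback C f g P p q \<longleftrightarrow>
     f \<in> Ar C \<and> g \<in> Ar C \<and> Cod C f = Cod C g \<and>
     P \<in> Ob C \<and> p \<in> hom C P (Dom C f) \<and> q \<in> hom C P (Dom C g) \<and> f \<cdot>\<^bsub>C\<^esub> p = g \<cdot>\<^bsub>C\<^esub> q \<and>
     (\<forall>X \<in> Ob C. \<forall>u \<in> hom C X (Dom C f). \<forall>v \<in> hom C X (Dom C g). f \<cdot>\<^bsub>C\<^esub> u = g \<cdot>\<^bsub>C\<^esub> v \<longrightarrow>
        (\<exists>!w. w \<in> hom C X P \<and> p \<cdot>\<^bsub>C\<^esub> w = u \<and> q \<cdot>\<^bsub>C\<^esub> w = v))"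

definition has_pullbacks :: "('o, 'a) cat \<Rightarrow> bool" where
  "has_pullbacks C \<longleftrightarrow>
     (\<forall>f \<in> Ar C. \<forall>g \<in> Ar C. Cod C f = Cod C g \<longrightarrow> (\<exists>P p q. is_pullback C f g P p q))"

text \<open>Chosen pullbacks, products and coproducts, with their comparison maps.\<close>

definition pb :: "('o, 'a) cat \<Rightarrow> 'a \<Rightarrow> 'a \<Rightarrow> 'o \<times> 'a \<times> 'a" where
  "pb C f g = (SOME (P, p, q). is_pullback C f g P p q)"

definition pb_ob :: "('o, 'a) cat \<Rightarrow> 'a \<Rightarrow> 'a \<Rightarrow> 'o" where
  "pb_ob C f g = fst (pb C f g)"

definition pb_p1 :: "('o, 'a) cat \<Rightarrow> 'a \<Rightarrow> 'a \<Rightarrow> 'a" where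
  "pb_p1 C f g = fst (snd (pb C f g))"

definition pb_p2 :: "('o, 'a) cat \<Rightarrow> 'a \<Rightarrow> 'a \<Rightarrow> 'a" where
  "pb_p2 C f g = snd (snd (pb C f g))"

definition pb_pair :: "('o, 'a) cat \<Rightarrow> 'a \<Rightarrow> 'a \<Rightarrow> 'a \<Rightarrow> 'a \<Rightarrow> 'a" where
  "pb_pair C f g u v = (THE w. w \<in> hom C (Dom C u) (pb_ob C f g) \<and>
     pb_p1 C f g \<cdot>\<^bsub>C\<^esub> w = u \<and> pb_p2 C f g \<cdot>\<^bsub>C\<^esub> w = v)"

definition bin_prod :: "('o, 'a) cat \<Rightarrow> 'o \<Rightarrow> 'o \<Rightarrow> 'o \<times> 'a \<times> 'a" where
  "bin_prod C A B = (SOME (P, p, q). is_binary_product C A B P p q)"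

definition prod_ob :: "('o, 'a) cat \<Rightarrow> 'o \<Rightarrow> 'o \<Rightarrow> 'o" where
  "prod_ob C A B = fst (bin_prod C A B)"

definition prod_p1 :: "('o, 'a) cat \<Rightarrow> 'o \<Rightarrow> 'o \<Rightarrow> 'a" where
  "prod_p1 C A B = fst (snd (bin_prod C A B))"

definition prod_p2 :: "('o, 'a) cat \<Rightarrow> 'o \<Rightarrow> 'o \<Rightarrow> 'a" where
  "prod_p2 C A B = snd (snd (bin_prod C A B))"

text \<open>\<open>f \<times> g\<close>\<close>

definition prod_map :: "('o, 'a) cat \<Rightarrow> 'a \<Rightarrow> 'a \<Rightarrow> 'a" where
  "prod_map C f g = (THE w.
     w \<in> hom C (prod_ob C (Dom C f) (Dom C g)) (prod_ob C (Cod C f) (Cod C g)) \<and>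
     prod_p1 C (Cod C f) (Cod C g) \<cdot>\<^bsub>C\<^esub> w = f \<cdot>\<^bsub>C\<^esub> prod_p1 C (Dom C f) (Dom C g) \<and>
     prod_p2 C (Cod C f) (Cod C g) \<cdot>\<^bsub>C\<^esub> w = g \<cdot>\<^bsub>C\<^esub> prod_p2 C (Dom C f) (Dom C g))"

definition bin_coprod :: "('o, 'a) cat \<Rightarrow> 'o \<Rightarrow> 'o \<Rightarrow> 'o \<times> 'a \<times> 'a" where
  "bin_coprod C A B = (SOME (P, i, j). is_binary_coproduct C A B P i j)"

definition coprod_ob :: "('o, 'a) cat \<Rightarrow> 'o \<Rightarrow> 'o \<Rightarrow> 'o" where
  "coprod_ob C A B = fst (bin_coprod C A B)"

definition coprod_i1 :: "('o, 'a) cat \<Rightarrow> 'o \<Rightarrow> 'o \<Rightarrow> 'a" where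
  "coprod_i1 C A B = fst (snd (bin_coprod C A B))"

definition coprod_i2 :: "('o, 'a) cat \<Rightarrow> 'o \<Rightarrow> 'o \<Rightarrow> 'a" where
  "coprod_i2 C A B = snd (snd (bin_coprod C A B))"

text \<open>\<open>f + g\<close>\<close>

definition coprod_map :: "('o, 'a) cat \<Rightarrow> 'a \<Rightarrow> 'a \<Rightarrow> 'a" where
  "coprod_map C f g = (THE w.
     w \<in> hom C (coprod_ob C (Dom C f) (Dom C g)) (coprod_ob C (Cod C f) (Cod C g)) \<and>
     w \<cdot>\<^bsub>C\<^esub> coprod_i1 C (Dom C f) (Dom C g) = coprod_i1 C (Cod C f) (Cod C g) \<cdot>\<^bsub>C\<^esub> f \<and>
     w \<cdot>\<^bsub>C\<^esub> coprod_i2 C (Dom C f) (Dom C g) = coprod_i2 C (Cod C f) (Cod C g) \<cdot>\<^bsub>C\<^esub> g)"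

text \<open>\<open>X\<close> with \<open>ev : X \<times> A \<rightarrow> B\<close> is an exponential \<open>B\<^sup>A\<close>.\<close>

definition is_exponential :: "('o, 'a) cat \<Rightarrow> 'o \<Rightarrow> 'o \<Rightarrow> 'o \<Rightarrow> 'a \<Rightarrow> bool" where
  "is_exponential C A B X ev \<longleftrightarrow> X \<in> Ob C \<and> ev \<in> hom C (prod_ob C X A) B \<and>
     (\<forall>Y \<in> Ob C. \<forall>f \<in> hom C (prod_ob C Y A) B.
        \<exists>!u. u \<in> hom C Y X \<and> ev \<cdot>\<^bsub>C\<^esub> prod_map C u (Ide C A) = f)"

definition cartesian_closed :: "('o, 'a) cat \<Rightarrow> bool" where
  "cartesian_closed C \<longleftrightarrow> category C \<and> has_finite_products C \<and>
     (\<forall>A \<in> Ob C. \<forall>B \<in> Ob C. \<exists>X ev. is_exponential C A B X ev)"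

definition well_pointed :: "('o, 'a) cat \<Rightarrow> bool" where
  "well_pointed C \<longleftrightarrow> category C \<and> (\<exists>t. is_terminal C t \<and> faithful C (hom_functor C t))"


section \<open>Extensive and lextensive categories\<close>

definition coprod_functor :: "('o, 'a) cat \<Rightarrow> 'o \<Rightarrow> 'o
    \<Rightarrow> ('a \<times> 'a, ('a \<times> 'a \<times> 'a) \<times> ('a \<times> 'a \<times> 'a), 'a, 'a \<times> 'a \<times> 'a) func" where
  "coprod_functor C A B =
     \<lparr>FO = restrict (\<lambda>(f, g). coprod_map C f g) (Ob (prod_cat (slice_cat C A) (slice_cat C B))),
      FA = restrict (\<lambda>((f, h, f'), (g, k, g')).
               (coprod_map C f g, coprod_map C h k, coprod_map C f' g'))
             (Ar (prod_cat (slice_cat C A) (slice_cat C B)))\<rparr>"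

definition extensive :: "('o, 'a) cat \<Rightarrow> bool" where
  "extensive C \<longleftrightarrow> category C \<and> has_pullbacks C \<and> has_finite_coproducts C \<and>
     (\<forall>A \<in> Ob C. \<forall>B \<in> Ob C.
        is_equivalence (prod_cat (slice_cat C A) (slice_cat C B)) (slice_cat C (coprod_ob C A B))
          (coprod_functor C A B))"

definition lextensive :: "('o, 'a) cat \<Rightarrow> bool" where
  "lextensive C \<longleftrightarrow> extensive C \<and> (\<exists>t. is_terminal C t)"


section \<open>2-categories and 2-functors\<close>

text \<open>A 2-category is presented as a category enriched in categories: \<open>Hom K A B\<close> is the
  category of 1-cells \<open>A \<rightarrow> B\<close> and 2-cells between them, and \<open>Hcomp K A B C\<close> is the composition
  functor from \<open>Hom K B C \<times> Hom K A B\<close> to \<open>Hom K A C\<close>.\<close>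

record ('o, 'f, 't) two_cat =
  Obj :: "'o set"
  Hom :: "'o \<Rightarrow> 'o \<Rightarrow> ('f, 't) cat"
  Id1 :: "'o \<Rightarrow> 'f"
  Hcomp :: "'o \<Rightarrow> 'o \<Rightarrow> 'o \<Rightarrow> ('f \<times> 'f, 't \<times> 't, 'f, 't) func"

definition Id2 :: "('o, 'f, 't) two_cat \<Rightarrow> 'o \<Rightarrow> 't" where
  "Id2 K A = Ide (Hom K A A) (Id1 K A)"

locale two_category =
  fixes K :: "('o, 'f, 't) two_cat"
  assumes Hom_category: "A \<in> Obj K \<Longrightarrow> B \<in> Obj K \<Longrightarrow> category (Hom K A B)"
    and Id1_Ob: "A \<in> Obj K \<Longrightarrow> Id1 K A \<in> Ob (Hom K A A)"
    and Hcomp_functor: "A \<in> Obj K \<Longrightarrow> B \<in> Obj K \<Longrightarrow> C \<in> Obj K \<Longrightarrow>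
      is_functor (prod_cat (Hom K B C) (Hom K A B)) (Hom K A C) (Hcomp K A B C)"
    and unit_left1: "A \<in> Obj K \<Longrightarrow> B \<in> Obj K \<Longrightarrow> f \<in> Ob (Hom K A B) \<Longrightarrow>
      FO (Hcomp K A B B) (Id1 K B, f) = f"
    and unit_left2: "A \<in> Obj K \<Longrightarrow> B \<in> Obj K \<Longrightarrow> \<alpha> \<in> Ar (Hom K A B) \<Longrightarrow>
      FA (Hcomp K A B B) (Id2 K B, \<alpha>) = \<alpha>"
    and unit_right1: "A \<in> Obj K \<Longrightarrow> B \<in> Obj K \<Longrightarrow> f \<in> Ob (Hom K A B) \<Longrightarrow>
      FO (Hcomp K A A B) (f, Id1 K A) = f"
    and unit_right2: "A \<in> Obj K \<Longrightarrow> B \<in> Obj K \<Longrightarrow> \<alpha> \<in> Ar (Hom K A B) \<Longrightarrow>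
      FA (Hcomp K A A B) (\<alpha>, Id2 K A) = \<alpha>"
    and assoc1: "A \<in> Obj K \<Longrightarrow> B \<in> Obj K \<Longrightarrow> C \<in> Obj K \<Longrightarrow> D \<in> Obj K \<Longrightarrow>
      f \<in> Ob (Hom K A B) \<Longrightarrow> g \<in> Ob (Hom K B C) \<Longrightarrow> h \<in> Ob (Hom K C D) \<Longrightarrow>
      FO (Hcomp K A B D) (FO (Hcomp K B C D) (h, g), f) =
      FO (Hcomp K A C D) (h, FO (Hcomp K A B C) (g, f))"
    and assoc2: "A \<in> Obj K \<Longrightarrow> B \<in> Obj K \<Longrightarrow> C \<in> Obj K \<Longrightarrow> D \<in> Obj K \<Longrightarrow>
      \<alpha> \<in> Ar (Hom K A B) \<Longrightarrow> \<beta> \<in> Ar (Hom K B C) \<Longrightarrow> \<gamma> \<in> Ar (Hom K C D) \<Longrightarrow>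
      FA (Hcomp K A B D) (FA (Hcomp K B C D) (\<gamma>, \<beta>), \<alpha>) =
      FA (Hcomp K A C D) (\<gamma>, FA (Hcomp K A B C) (\<beta>, \<alpha>))"

record ('o, 'f, 't, 'p, 'g, 's) two_func =
  TO :: "'o \<Rightarrow> 'p"
  THom :: "'o \<Rightarrow> 'o \<Rightarrow> ('f, 't, 'g, 's) func"

definition is_two_functor :: "('o, 'f, 't) two_cat \<Rightarrow> ('p, 'g, 's) two_cat
    \<Rightarrow> ('o, 'f, 't, 'p, 'g, 's) two_func \<Rightarrow> bool" where
  "is_two_functor K L F \<longleftrightarrow>
     (\<forall>A \<in> Obj K. TO F A \<in> Obj L) \<and>
     (\<forall>A \<in> Obj K. \<forall>B \<in> Obj K. is_functor (Hom K A B) (Hom L (TO F A) (TO F B)) (THom F A B)) \<and>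
     (\<forall>A \<in> Obj K. FO (THom F A A) (Id1 K A) = Id1 L (TO F A)) \<and>
     (\<forall>A \<in> Obj K. \<forall>B \<in> Obj K. \<forall>C \<in> Obj K. \<forall>g \<in> Ob (Hom K B C). \<forall>f \<in> Ob (Hom K A B).
        FO (THom F A C) (FO (Hcomp K A B C) (g, f)) =
        FO (Hcomp L (TO F A) (TO F B) (TO F C)) (FO (THom F B C) g, FO (THom F A B) f)) \<and>
     (\<forall>A \<in> Obj K. \<forall>B \<in> Obj K. \<forall>C \<in> Obj K. \<forall>\<beta> \<in> Ar (Hom K B C). \<forall>\<alpha> \<in> Ar (Hom K A B).
        FA (THom F A C) (FA (Hcomp K A B C) (\<beta>, \<alpha>)) =
        FA (Hcomp L (TO F A) (TO F B) (TO F C)) (FA (THom F B C) \<beta>, FA (THom F A B) \<alpha>))"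

definition faithful_on_1_cells :: "('o, 'f, 't) two_cat \<Rightarrow> ('o, 'f, 't, 'p, 'g, 's) two_func \<Rightarrow> bool"
  where "faithful_on_1_cells K F \<longleftrightarrow>
     (\<forall>A \<in> Obj K. \<forall>B \<in> Obj K. inj_on (FO (THom F A B)) (Ob (Hom K A B)))"

definition faithful_on_2_cells :: "('o, 'f, 't) two_cat \<Rightarrow> ('o, 'f, 't, 'p, 'g, 's) two_func \<Rightarrow> bool"
  where "faithful_on_2_cells K F \<longleftrightarrow>
     (\<forall>A \<in> Obj K. \<forall>B \<in> Obj K. faithful (Hom K A B) (THom F A B))"

text \<open>The 2-category of categories with objects of type \<open>'x\<close> and arrows of type \<open>'y\<close>.\<close>

definition Cat :: "(('x, 'y) cat, ('x, 'y, 'x, 'y) func, ('x, 'y, 'x, 'y) ntrans) two_cat" where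
  "Cat = \<lparr>Obj = {C. category C}, Hom = functor_cat, Id1 = func_id,
     Hcomp = (\<lambda>A B C.
       \<lparr>FO = restrict (\<lambda>(G, F). func_comp A G F) (Ob (prod_cat (functor_cat B C) (functor_cat A B))),
        FA = restrict (\<lambda>(\<beta>, \<alpha>). hcomp A C \<beta> \<alpha>) (Ar (prod_cat (functor_cat B C) (functor_cat A B)))\<rparr>)\<rparr>"

text \<open>The representable 2-functor \<open>K(P, -) : K \<rightarrow> Cat\<close>. The two auxiliary definitions are
  its values on a 1-cell \<open>b : B \<rightarrow> B'\<close> and on a 2-cell \<open>\<beta>\<close> between 1-cells \<open>B \<rightarrow> B'\<close>.\<close>

definition postcomp1 :: "('o, 'f, 't) two_cat \<Rightarrow> 'o \<Rightarrow> 'o \<Rightarrow> 'o \<Rightarrow> 'f \<Rightarrow> ('f, 't, 'f, 't) func" where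
  "postcomp1 K P B B' b =
     \<lparr>FO = (\<lambda>x \<in> Ob (Hom K P B). FO (Hcomp K P B B') (b, x)),
      FA = (\<lambda>\<xi> \<in> Ar (Hom K P B). FA (Hcomp K P B B') (Ide (Hom K B B') b, \<xi>))\<rparr>"

definition postcomp2 :: "('o, 'f, 't) two_cat \<Rightarrow> 'o \<Rightarrow> 'o \<Rightarrow> 'o \<Rightarrow> 't \<Rightarrow> ('f, 't, 'f, 't) ntrans" where
  "postcomp2 K P B B' \<beta> =
     \<lparr>NSrc = postcomp1 K P B B' (Dom (Hom K B B') \<beta>),
      NTgt = postcomp1 K P B B' (Cod (Hom K B B') \<beta>),
      NMap = (\<lambda>x \<in> Ob (Hom K P B). FA (Hcomp K P B B') (\<beta>, Ide (Hom K P B) x))\<rparr>"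

definition hom_two_functor :: "('o, 'f, 't) two_cat \<Rightarrow> 'o
    \<Rightarrow> ('o, 'f, 't, ('f, 't) cat, ('f, 't, 'f, 't) func, ('f, 't, 'f, 't) ntrans) two_func" where
  "hom_two_functor K P =
     \<lparr>TO = Hom K P,
      THom = (\<lambda>B B'. \<lparr>FO = (\<lambda>b \<in> Ob (Hom K B B'). postcomp1 K P B B' b),
                      FA = (\<lambda>\<beta> \<in> Ar (Hom K B B'). postcomp2 K P B B' \<beta>)\<rparr>)\<rparr>"

text \<open>The 2-functor \<open>Cat(J, -)\<close>. It is not an instance of the previous definition, since
  \<open>J\<close> may have objects and arrows of other types than the categories it is applied to.\<close>

definition exp_two_functor :: "('x, 'y) cat \<Rightarrow>
    (('u, 'v) cat, ('u, 'v, 'u, 'v) func, ('u, 'v, 'u, 'v) ntrans,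
     (('x, 'y, 'u, 'v) func, ('x, 'y, 'u, 'v) ntrans) cat,
     (('x, 'y, 'u, 'v) func, ('x, 'y, 'u, 'v) ntrans,
      ('x, 'y, 'u, 'v) func, ('x, 'y, 'u, 'v) ntrans) func,
     (('x, 'y, 'u, 'v) func, ('x, 'y, 'u, 'v) ntrans,
      ('x, 'y, 'u, 'v) func, ('x, 'y, 'u, 'v) ntrans) ntrans) two_func" where
  "exp_two_functor J =
     (let post = (\<lambda>C F. \<lparr>FO = (\<lambda>X \<in> Ob (functor_cat J C). func_comp J F X),
                         FA = (\<lambda>\<xi> \<in> Ar (functor_cat J C). whisker_left J F \<xi>)\<rparr>)
      in \<lparr>TO = functor_cat J,
          THom = (\<lambda>C D.
            \<lparr>FO = (\<lambda>F \<in> Ob (functor_cat C D). post C F),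
             FA = (\<lambda>\<alpha> \<in> Ar (functor_cat C D).
               \<lparr>NSrc = post C (NSrc \<alpha>), NTgt = post C (NTgt \<alpha>),
                NMap = (\<lambda>X \<in> Ob (functor_cat J C). whisker_right J \<alpha> X)\<rparr>)\<rparr>)\<rparr>)"

definition comp_two_functor :: "('o, 'f, 't) two_cat \<Rightarrow> ('p, 'g, 's, 'q, 'h, 'r) two_func
    \<Rightarrow> ('o, 'f, 't, 'p, 'g, 's) two_func \<Rightarrow> ('o, 'f, 't, 'q, 'h, 'r) two_func" where
  "comp_two_functor K G F = \<lparr>TO = (\<lambda>A. TO G (TO F A)),
     THom = (\<lambda>A B. func_comp (Hom K A B) (THom G (TO F A) (TO F B)) (THom F A B))\<rparr>"

text \<open>A 2-natural isomorphism between 2-functors \<open>S\<close> and \<open>T\<close> from \<open>K\<close> to categories. The values of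
  \<open>S\<close> and \<open>T\<close> may have objects and arrows of different types.\<close>

definition is_two_natural_iso :: "('o, 'f, 't) two_cat
    \<Rightarrow> ('o, 'f, 't, ('x, 'y) cat, ('x, 'y, 'x, 'y) func, ('x, 'y, 'x, 'y) ntrans) two_func
    \<Rightarrow> ('o, 'f, 't, ('u, 'v) cat, ('u, 'v, 'u, 'v) func, ('u, 'v, 'u, 'v) ntrans) two_func
    \<Rightarrow> ('o \<Rightarrow> ('x, 'y, 'u, 'v) func) \<Rightarrow> bool" where
  "is_two_natural_iso K S T \<Phi> \<longleftrightarrow>
     (\<forall>B \<in> Obj K. is_iso_functor (TO S B) (TO T B) (\<Phi> B)) \<and>
     (\<forall>B \<in> Obj K. \<forall>B' \<in> Obj K. \<forall>b \<in> Ob (Hom K B B').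
        func_comp (TO S B) (\<Phi> B') (FO (THom S B B') b) =
        func_comp (TO S B) (FO (THom T B B') b) (\<Phi> B)) \<and>
     (\<forall>B \<in> Obj K. \<forall>B' \<in> Obj K. \<forall>\<beta> \<in> Ar (Hom K B B').
        whisker_left (TO S B) (\<Phi> B') (FA (THom S B B') \<beta>) =
        whisker_right (TO S B) (FA (THom T B B') \<beta>) (\<Phi> B))"

definition is_copower :: "('o, 'f, 't) two_cat \<Rightarrow> ('x, 'y) cat \<Rightarrow> 'o \<Rightarrow> 'o \<Rightarrow> bool" where
  "is_copower K J A P \<longleftrightarrow> P \<in> Obj K \<and>
     (\<exists>\<Phi>. is_two_natural_iso K (hom_two_functor K P)
            (comp_two_functor K (exp_two_functor J) (hom_two_functor K A)) \<Phi>)"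

definition is_two_terminal :: "('o, 'f, 't) two_cat \<Rightarrow> 'o \<Rightarrow> bool" where
  "is_two_terminal K T \<longleftrightarrow> T \<in> Obj K \<and>
     (\<forall>A \<in> Obj K. (\<exists>!f. f \<in> Ob (Hom K A T)) \<and> (\<exists>!\<alpha>. \<alpha> \<in> Ar (Hom K A T)))"

text \<open>The category \<open>\<bullet> \<rightarrow> \<bullet>\<close>: the order \<open>False < True\<close> regarded as a category.\<close>

definition walking_arrow :: "(bool, bool \<times> bool) cat" where
  "walking_arrow = \<lparr>Ob = UNIV, Ar = {(x, y). x \<le> y}, Dom = fst, Cod = snd,
     Ide = (\<lambda>x. (x, x)), Comp = (\<lambda>g f. (fst f, snd g))\<rparr>"

definition two_well_pointed :: "('o, 'f, 't) two_cat \<Rightarrow> bool" where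
  "two_well_pointed K \<longleftrightarrow> two_category K \<and>
     (\<exists>T P. is_two_terminal K T \<and> is_copower K walking_arrow T P \<and>
        faithful_on_1_cells K (hom_two_functor K P) \<and>
        faithful_on_2_cells K (hom_two_functor K P))"


section \<open>Internal categories\<close>

text \<open>\<open>IComp A\<close> is defined on the chosen pullback of \<open>ISrc A\<close> along \<open>ITgt A\<close>, which consists of the
  pairs \<open>(g, f)\<close> with \<open>g \<circ> f\<close> defined; \<open>icomp E A g f\<close> is the composite of generalised elements
  \<open>g\<close> and \<open>f\<close> of \<open>IAr A\<close>.\<close>

record ('o, 'a) icat =
  IOb :: 'o
  IAr :: 'o
  ISrc :: 'a
  ITgt :: 'a
  IId :: 'a
  IComp :: 'a

definition icomp :: "('o, 'a) cat \<Rightarrow> ('o, 'a) icat \<Rightarrow> 'a \<Rightarrow> 'a \<Rightarrow> 'a" where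
  "icomp E A g f = IComp A \<cdot>\<^bsub>E\<^esub> pb_pair E (ISrc A) (ITgt A) g f"

text \<open>In the associativity law, \<open>r\<close> and \<open>s\<close> are the projections \<open>(h, g, f) \<mapsto> (h, g)\<close> and
  \<open>(h, g, f) \<mapsto> (g, f)\<close> from the object of composable triples.\<close>

definition is_icat :: "('o, 'a) cat \<Rightarrow> ('o, 'a) icat \<Rightarrow> bool" where
  "is_icat E A \<longleftrightarrow>
     (let p = pb_p1 E (ISrc A) (ITgt A); q = pb_p2 E (ISrc A) (ITgt A);
          r = pb_p1 E q p; s = pb_p2 E q p
      in IOb A \<in> Ob E \<and> IAr A \<in> Ob E \<and>
         ISrc A \<in> hom E (IAr A) (IOb A) \<and> ITgt A \<in> hom E (IAr A) (IOb A) \<and>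
         IId A \<in> hom E (IOb A) (IAr A) \<and>
         IComp A \<in> hom E (pb_ob E (ISrc A) (ITgt A)) (IAr A) \<and>
         ISrc A \<cdot>\<^bsub>E\<^esub> IId A = Ide E (IOb A) \<and> ITgt A \<cdot>\<^bsub>E\<^esub> IId A = Ide E (IOb A) \<and>
         ISrc A \<cdot>\<^bsub>E\<^esub> IComp A = ISrc A \<cdot>\<^bsub>E\<^esub> q \<and> ITgt A \<cdot>\<^bsub>E\<^esub> IComp A = ITgt A \<cdot>\<^bsub>E\<^esub> p \<and>
         icomp E A (IId A \<cdot>\<^bsub>E\<^esub> ITgt A) (Ide E (IAr A)) = Ide E (IAr A) \<and>
         icomp E A (Ide E (IAr A)) (IId A \<cdot>\<^bsub>E\<^esub> ISrc A) = Ide E (IAr A) \<and>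
         icomp E A (IComp A \<cdot>\<^bsub>E\<^esub> r) (q \<cdot>\<^bsub>E\<^esub> s) = icomp E A (p \<cdot>\<^bsub>E\<^esub> r) (IComp A \<cdot>\<^bsub>E\<^esub> s))"

record 'a ifunc =
  IFO :: 'a
  IFA :: 'a

definition is_ifunc :: "('o, 'a) cat \<Rightarrow> ('o, 'a) icat \<Rightarrow> ('o, 'a) icat \<Rightarrow> 'a ifunc \<Rightarrow> bool" where
  "is_ifunc E A B F \<longleftrightarrow>
     IFO F \<in> hom E (IOb A) (IOb B) \<and> IFA F \<in> hom E (IAr A) (IAr B) \<and>
     ISrc B \<cdot>\<^bsub>E\<^esub> IFA F = IFO F \<cdot>\<^bsub>E\<^esub> ISrc A \<and> ITgt B \<cdot>\<^bsub>E\<^esub> IFA F = IFO F \<cdot>\<^bsub>E\<^esub> ITgt A \<and>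
     IFA F \<cdot>\<^bsub>E\<^esub> IId A = IId B \<cdot>\<^bsub>E\<^esub> IFO F \<and>
     IFA F \<cdot>\<^bsub>E\<^esub> IComp A =
       icomp E B (IFA F \<cdot>\<^bsub>E\<^esub> pb_p1 E (ISrc A) (ITgt A)) (IFA F \<cdot>\<^bsub>E\<^esub> pb_p2 E (ISrc A) (ITgt A))"

record 'a intrans =
  INSrc :: "'a ifunc"
  INTgt :: "'a ifunc"
  INMap :: 'a

definition is_intrans :: "('o, 'a) cat \<Rightarrow> ('o, 'a) icat \<Rightarrow> ('o, 'a) icat \<Rightarrow> 'a intrans \<Rightarrow> bool" where
  "is_intrans E A B \<alpha> \<longleftrightarrow>
     is_ifunc E A B (INSrc \<alpha>) \<and> is_ifunc E A B (INTgt \<alpha>) \<and>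
     INMap \<alpha> \<in> hom E (IOb A) (IAr B) \<and>
     ISrc B \<cdot>\<^bsub>E\<^esub> INMap \<alpha> = IFO (INSrc \<alpha>) \<and> ITgt B \<cdot>\<^bsub>E\<^esub> INMap \<alpha> = IFO (INTgt \<alpha>) \<and>
     icomp E B (IFA (INTgt \<alpha>)) (INMap \<alpha> \<cdot>\<^bsub>E\<^esub> ISrc A) =
     icomp E B (INMap \<alpha> \<cdot>\<^bsub>E\<^esub> ITgt A) (IFA (INSrc \<alpha>))"

definition ifunc_cat :: "('o, 'a) cat \<Rightarrow> ('o, 'a) icat \<Rightarrow> ('o, 'a) icat
    \<Rightarrow> ('a ifunc, 'a intrans) cat" where
  "ifunc_cat E A B = \<lparr>Ob = {F. is_ifunc E A B F}, Ar = {\<alpha>. is_intrans E A B \<alpha>},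
     Dom = INSrc, Cod = INTgt,
     Ide = (\<lambda>F. \<lparr>INSrc = F, INTgt = F, INMap = IId B \<cdot>\<^bsub>E\<^esub> IFO F\<rparr>),
     Comp = (\<lambda>\<beta> \<alpha>. \<lparr>INSrc = INSrc \<alpha>, INTgt = INTgt \<beta>, INMap = icomp E B (INMap \<beta>) (INMap \<alpha>)\<rparr>)\<rparr>"

definition ifunc_comp :: "('o, 'a) cat \<Rightarrow> 'a ifunc \<Rightarrow> 'a ifunc \<Rightarrow> 'a ifunc" where
  "ifunc_comp E G F = \<lparr>IFO = IFO G \<cdot>\<^bsub>E\<^esub> IFO F, IFA = IFA G \<cdot>\<^bsub>E\<^esub> IFA F\<rparr>"

definition intrans_hcomp :: "('o, 'a) cat \<Rightarrow> ('o, 'a) icat \<Rightarrow> 'a intrans \<Rightarrow> 'a intrans \<Rightarrow> 'a intrans"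
  where "intrans_hcomp E C \<beta> \<alpha> =
     \<lparr>INSrc = ifunc_comp E (INSrc \<beta>) (INSrc \<alpha>), INTgt = ifunc_comp E (INTgt \<beta>) (INTgt \<alpha>),
      INMap = icomp E C (INMap \<beta> \<cdot>\<^bsub>E\<^esub> IFO (INTgt \<alpha>)) (IFA (INSrc \<beta>) \<cdot>\<^bsub>E\<^esub> INMap \<alpha>)\<rparr>"

definition Cat_internal :: "('o, 'a) cat \<Rightarrow> (('o, 'a) icat, 'a ifunc, 'a intrans) two_cat" where
  "Cat_internal E = \<lparr>Obj = {A. is_icat E A}, Hom = ifunc_cat E,
     Id1 = (\<lambda>A. \<lparr>IFO = Ide E (IOb A), IFA = Ide E (IAr A)\<rparr>),
     Hcomp = (\<lambda>A B C.
       \<lparr>FO = restrict (\<lambda>(G, F). ifunc_comp E G F) (Ob (prod_cat (ifunc_cat E B C) (ifunc_cat E A B))),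
        FA = restrict (\<lambda>(\<beta>, \<alpha>). intrans_hcomp E C \<beta> \<alpha>) (Ar (prod_cat (ifunc_cat E B C) (ifunc_cat E A B)))\<rparr>)\<rparr>"

section \<open>Well-formedness\<close>

text \<open>\<open>set_cat\<close> is a category and \<open>hom_functor\<close> a functor to it; \<open>Cat\<close> is a 2-category and
  \<open>hom_two_functor\<close> a 2-functor to it; \<open>Cat_internal E\<close> is a 2-category if \<open>E\<close> has pullbacks.\<close>


lemma hom_iff: "f \<in> hom C x y \<longleftrightarrow> f \<in> Ar C \<and> Dom C f = x \<and> Cod C f = y"
  by (simp add: hom_def)

context category begin
lemma comp_ar [simp]: "f \<in> Ar C \<Longrightarrow> g \<in> Ar C \<Longrightarrow> Dom C g = Cod C f \<Longrightarrow> g \<cdot> f \<in> Ar C"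
  and dom_comp [simp]: "f \<in> Ar C \<Longrightarrow> g \<in> Ar C \<Longrightarrow> Dom C g = Cod C f \<Longrightarrow> Dom C (g \<cdot> f) = Dom C f"
  and cod_comp [simp]: "f \<in> Ar C \<Longrightarrow> g \<in> Ar C \<Longrightarrow> Dom C g = Cod C f \<Longrightarrow> Cod C (g \<cdot> f) = Cod C g"
  using comp_hom[of f "Dom C f" "Cod C f" g "Cod C g"] by (auto simp: hom_iff)
lemma comp_assoc: "f \<in> Ar C \<Longrightarrow> g \<in> Ar C \<Longrightarrow> Dom C g = Cod C f \<Longrightarrow> h \<in> Ar C \<Longrightarrow> Dom C h = Cod C g
   \<Longrightarrow> (h \<cdot> g) \<cdot> f = h \<cdot> (g \<cdot> f)"
  using assoc[of f "Dom C f" "Cod C f" g "Cod C g" h "Cod C h"] by (auto simp: hom_iff)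
lemma id_ar [simp]: "x \<in> Ob C \<Longrightarrow> Ide C x \<in> Ar C" "x \<in> Ob C \<Longrightarrow> Dom C (Ide C x) = x"
   "x \<in> Ob C \<Longrightarrow> Cod C (Ide C x) = x"
  using id_hom by (auto simp: hom_iff)
lemma id_l: "f \<in> Ar C \<Longrightarrow> Cod C f = y \<Longrightarrow> Ide C y \<cdot> f = f"
 and id_r: "f \<in> Ar C \<Longrightarrow> Dom C f = y \<Longrightarrow> f \<cdot> Ide C y = f"
  using id_left id_right by (auto simp: hom_iff)
declare dom_ob [simp] cod_ob[simp]
end

lemma category_set_cat: "category set_cat"
proof (unfold_locales, goal_cases)
  case (7 f w x g y h z)
  then show ?case by (auto simp: set_cat_def hom_def compose_def fun_eq_iff)
qed (auto simp: set_cat_def hom_def compose_def PiE_iff extensional_def fun_eq_iff; metis)+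

lemma (in category) hom_functor_is_functor:
  assumes "t \<in> Ob C" shows "is_functor C set_cat (hom_functor C t)"
  unfolding is_functor_def
proof (intro conjI ballI allI)
  show "FO (hom_functor C t) \<in> Ob C \<rightarrow>\<^sub>E Ob set_cat" by (auto simp: hom_functor_def set_cat_def)
  show "FA (hom_functor C t) \<in> Ar C \<rightarrow>\<^sub>E Ar set_cat" 
    by (auto simp: hom_functor_def set_cat_def hom_iff)
  fix x assume "x \<in> Ob C" then show "FA (hom_functor C t) (Ide C x) = Ide set_cat (FO (hom_functor C t) x)"
    by (auto simp: hom_functor_def set_cat_def hom_iff id_l fun_eq_iff restrict_def)
next
  fix x y z f g assume "f \<in> hom C x y" "g \<in> hom C y z"
  then show "FA (hom_functor C t) (g \<cdot> f) = FA (hom_functor C t) g \<cdot>\<^bsub>set_cat\<^esub> FA (hom_functor C t) f"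
    by (auto simp: hom_functor_def set_cat_def hom_iff comp_assoc fun_eq_iff restrict_def compose_def)
qed (auto simp: hom_functor_def set_cat_def)

lemma category_walking_arrow: "category walking_arrow"
  by unfold_locales (auto simp: walking_arrow_def hom_def)

lemma category_prod_cat: assumes "category C" "category D" shows "category (prod_cat C D)"
proof -
  interpret C: category C by fact
  interpret D: category D by fact
  show ?thesis by unfold_locales (auto simp: prod_cat_def hom_def C.comp_assoc D.comp_assoc
    C.id_l D.id_l C.id_r D.id_r)
qed


lemma functorD:
  assumes "is_functor C D F"
  shows "x \<in> Ob C \<Longrightarrow> FO F x \<in> Ob D" "f \<in> Ar C \<Longrightarrow> FA F f \<in> Ar D"
    "f \<in> Ar C \<Longrightarrow> Dom D (FA F f) = FO F (Dom C f)" "f \<in> Ar C \<Longrightarrow> Cod D (FA F f) = FO F (Cod C f)"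
    "x \<in> Ob C \<Longrightarrow> FA F (Ide C x) = Ide D (FO F x)"
    "f \<in> Ar C \<Longrightarrow> g \<in> Ar C \<Longrightarrow> Dom C g = Cod C f \<Longrightarrow> FA F (g \<cdot>\<^bsub>C\<^esub> f) = FA F g \<cdot>\<^bsub>D\<^esub> FA F f"
    "FO F \<in> extensional (Ob C)" "FA F \<in> extensional (Ar C)"
  using assms unfolding is_functor_def by (auto simp: PiE_iff hom_iff)

lemma functorI:
  assumes 
    "\<And>x. x \<in> Ob C \<Longrightarrow> FO F x \<in> Ob D" "\<And>f. f \<in> Ar C \<Longrightarrow> FA F f \<in> Ar D"
    "\<And>f. f \<in> Ar C \<Longrightarrow> Dom D (FA F f) = FO F (Dom C f)" "\<And>f. f \<in> Ar C \<Longrightarrow> Cod D (FA F f) = FO F (Cod C f)"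
    "\<And>x. x \<in> Ob C \<Longrightarrow> FA F (Ide C x) = Ide D (FO F x)"
    "\<And>f g. f \<in> Ar C \<Longrightarrow> g \<in> Ar C \<Longrightarrow> Dom C g = Cod C f \<Longrightarrow> FA F (g \<cdot>\<^bsub>C\<^esub> f) = FA F g \<cdot>\<^bsub>D\<^esub> FA F f"
    "FO F \<in> extensional (Ob C)" "FA F \<in> extensional (Ar C)"
  shows "is_functor C D F"
  using assms unfolding is_functor_def by (auto simp: PiE_iff hom_iff)

lemma ntransD:
  assumes "is_ntrans C D a"
  shows "is_functor C D (NSrc a)" "is_functor C D (NTgt a)" "NMap a \<in> extensional (Ob C)"
    "x \<in> Ob C \<Longrightarrow> NMap a x \<in> Ar D" "x \<in> Ob C \<Longrightarrow> Dom D (NMap a x) = FO (NSrc a) x"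
    "x \<in> Ob C \<Longrightarrow> Cod D (NMap a x) = FO (NTgt a) x"
    "f \<in> Ar C \<Longrightarrow> FA (NTgt a) f \<cdot>\<^bsub>D\<^esub> NMap a (Dom C f) = NMap a (Cod C f) \<cdot>\<^bsub>D\<^esub> FA (NSrc a) f"
  using assms unfolding is_ntrans_def hom_iff by auto

lemma ntransI:
  assumes "is_functor C D (NSrc a)" "is_functor C D (NTgt a)" "NMap a \<in> extensional (Ob C)"
    "\<And>x. x \<in> Ob C \<Longrightarrow> NMap a x \<in> Ar D" "\<And>x. x \<in> Ob C \<Longrightarrow> Dom D (NMap a x) = FO (NSrc a) x"
    "\<And>x. x \<in> Ob C \<Longrightarrow> Cod D (NMap a x) = FO (NTgt a) x"
    "\<And>f. f \<in> Ar C \<Longrightarrow> FA (NTgt a) f \<cdot>\<^bsub>D\<^esub> NMap a (Dom C f) = NMap a (Cod C f) \<cdot>\<^bsub>D\<^esub> FA (NSrc a) f"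
  shows "is_ntrans C D a"
  using assms unfolding is_ntrans_def hom_iff by auto

lemma nt_eqI:
  assumes "NSrc a = NSrc b" "NTgt a = NTgt b" "NMap a \<in> extensional X" "NMap b \<in> extensional X" 
    "\<And>x. x \<in> X \<Longrightarrow> NMap a x = NMap b x"
  shows "a = (b :: ('x,'y,'u,'v) ntrans)"
  using assms by (cases a; cases b) (auto intro: extensionalityI)

lemma func_eqI:
  assumes "FO a \<in> extensional X" "FO b \<in> extensional X" "FA a \<in> extensional Y" "FA b \<in> extensional Y" 
    "\<And>x. x \<in> X \<Longrightarrow> FO a x = FO b x" "\<And>x. x \<in> Y \<Longrightarrow> FA a x = FA b x"
  shows "a = (b :: ('x,'y,'u,'v) func)"
  using assms by (cases a; cases b) (auto intro: extensionalityI)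

lemma func_comp_functor:
  assumes "category A" "is_functor A B F" "is_functor B C G"
  shows "is_functor A C (func_comp A G F)"
proof -
  interpret A: category A by fact
  show ?thesis
  using functorD[OF assms(2)] functorD[OF assms(3)]
  by (intro functorI) (auto simp: func_comp_def)
qed

lemma func_id_functor: assumes "category A" shows "is_functor A A (func_id A)"
proof -
  interpret A: category A by fact
  show ?thesis by (intro functorI) (auto simp: func_id_def)
qed

lemma vcomp_ntrans:
  assumes "category C" "category D" "is_ntrans C D a" "is_ntrans C D b" "NSrc b = NTgt a"
  shows "is_ntrans C D (vcomp C D b a)"
proof -
  interpret C: category C by fact
  interpret D: category D by fact
  note a = ntransD[OF assms(3)] note b = ntransD[OF assms(4)]
  note F = functorD[OF a(1)] and G = functorD[OF a(2)] and H = functorD[OF b(2)]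
  show ?thesis
  proof (rule ntransI)
    fix f assume f: "f \<in> Ar C"
    let ?x = "Dom C f" and ?y = "Cod C f"
    have [simp]: "?x \<in> Ob C" "?y \<in> Ob C" using f by auto
    have "FA (NTgt b) f \<cdot>\<^bsub>D\<^esub> (NMap b ?x \<cdot>\<^bsub>D\<^esub> NMap a ?x) = (FA (NTgt b) f \<cdot>\<^bsub>D\<^esub> NMap b ?x) \<cdot>\<^bsub>D\<^esub> NMap a ?x"
      using f a(1-6) b(1-6) F(1-5) G(1-5) H(1-5) assms(5) by (simp add: D.comp_assoc)
    also have "\<dots> = NMap b ?y \<cdot>\<^bsub>D\<^esub> (FA (NTgt a) f \<cdot>\<^bsub>D\<^esub> NMap a ?x)"
      unfolding b(7)[OF f] assms(5) using f a(1-6) b(1-6) F(1-5) G(1-5) H(1-5) assms(5) by (simp add: D.comp_assoc)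
    also have "\<dots> = NMap b ?y \<cdot>\<^bsub>D\<^esub> (NMap a ?y \<cdot>\<^bsub>D\<^esub> FA (NSrc a) f)"
      using a(7)[OF f] by simp
    also have "\<dots> = (NMap b ?y \<cdot>\<^bsub>D\<^esub> NMap a ?y) \<cdot>\<^bsub>D\<^esub> FA (NSrc a) f"
      using f a(1-6) b(1-6) F(1-5) G(1-5) H(1-5) assms(5) by (simp add: D.comp_assoc)
    finally show "FA (NTgt (vcomp C D b a)) f \<cdot>\<^bsub>D\<^esub> NMap (vcomp C D b a) ?x =
      NMap (vcomp C D b a) ?y \<cdot>\<^bsub>D\<^esub> FA (NSrc (vcomp C D b a)) f" by (simp add: vcomp_def)
  qed (use a(1-6) b(1-6) assms(5) in \<open>auto simp: vcomp_def\<close>)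
qed

lemma category_functor_cat:
  assumes "category C" "category D" shows "category (functor_cat C D)"
proof -
  interpret C: category C by fact
  interpret D: category D by fact
  show ?thesis
  proof (unfold_locales, goal_cases)
    case (1 f) then show ?case by (auto simp: functor_cat_def dest: ntransD)
  next
    case (2 f) then show ?case by (auto simp: functor_cat_def dest: ntransD)
  next
    case (3 F)
    then have F: "is_functor C D F" by (simp add: functor_cat_def)
    note F' = functorD[OF F]
    show ?case unfolding functor_cat_def hom_iff
      by (auto intro!: ntransI simp: ntid_def F F' D.id_l D.id_r)
  next
    case 4 then show ?case using vcomp_ntrans[OF assms]
      by (auto simp: functor_cat_def hom_iff) (auto simp: vcomp_def)
  next
    case (5 a F G)
    then have a: "is_ntrans C D a" and G: "G = NTgt a" by (auto simp: functor_cat_def hom_iff)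
    show ?case using ntransD[OF a] G
      by (auto simp: functor_cat_def intro!: nt_eqI[of _ a "Ob C"]) (auto simp: vcomp_def ntid_def D.id_l)
  next
    case (6 a F G)
    then have a: "is_ntrans C D a" and G: "F = NSrc a" by (auto simp: functor_cat_def hom_iff)
    show ?case using ntransD[OF a] G
      by (auto simp: functor_cat_def intro!: nt_eqI[of _ a "Ob C"]) (auto simp: vcomp_def ntid_def D.id_r)
  next
    case (7 a _ _ b _ c)
    then have a: "is_ntrans C D a" "is_ntrans C D b" "is_ntrans C D c" "NSrc b = NTgt a" "NSrc c = NTgt b" by (auto simp: functor_cat_def hom_iff)
    show ?case using ntransD[OF a(1)] ntransD[OF a(2)] ntransD[OF a(3)] a
      by (auto simp: functor_cat_def vcomp_def D.comp_assoc intro!: restrict_ext)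
  qed
qed

lemma hcomp_ntrans:
  assumes "category A" "category B" "category C" and a: "is_ntrans A B a" and b: "is_ntrans B C b"
  shows "is_ntrans A C (hcomp A C b a)"
proof -
  interpret A: category A by fact
  interpret B: category B by fact
  interpret C: category C by fact
  note a = ntransD[OF assms(4)] note b = ntransD[OF assms(5)]
  note F = functorD[OF a(1)] and G = functorD[OF a(2)] and H = functorD[OF b(1)] and K = functorD[OF b(2)]
  show ?thesis
  proof (rule ntransI)
    fix f assume f: "f \<in> Ar A"
    let ?x = "Dom A f" and ?y = "Cod A f"
    have [simp]: "?x \<in> Ob A" "?y \<in> Ob A" using f by auto
    have "FA (NTgt b) (FA (NTgt a) f) \<cdot>\<^bsub>C\<^esub> (NMap b (FO (NTgt a) ?x) \<cdot>\<^bsub>C\<^esub> FA (NSrc b) (NMap a ?x)) =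
       (FA (NTgt b) (FA (NTgt a) f) \<cdot>\<^bsub>C\<^esub> NMap b (FO (NTgt a) ?x)) \<cdot>\<^bsub>C\<^esub> FA (NSrc b) (NMap a ?x)"
      using f a(1-6) b(1-6) F(1-5) G(1-5) H(1-5) K(1-5) by (simp add: C.comp_assoc)
    also have "\<dots> = (NMap b (FO (NTgt a) ?y) \<cdot>\<^bsub>C\<^esub> FA (NSrc b) (FA (NTgt a) f)) \<cdot>\<^bsub>C\<^esub> FA (NSrc b) (NMap a ?x)"
      using b(7)[OF G(2)[OF f]] G f by simp
    also have "\<dots> = NMap b (FO (NTgt a) ?y) \<cdot>\<^bsub>C\<^esub> (FA (NSrc b) (FA (NTgt a) f \<cdot>\<^bsub>B\<^esub> NMap a ?x))"
      using f a(1-6) b(1-6) F(1-5) G(1-5) H(1-6) K(1-5) by (simp add: C.comp_assoc)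
    also have "\<dots> = NMap b (FO (NTgt a) ?y) \<cdot>\<^bsub>C\<^esub> (FA (NSrc b) (NMap a ?y \<cdot>\<^bsub>B\<^esub> FA (NSrc a) f))"
      using a(7) f by simp
    also have "\<dots> = (NMap b (FO (NTgt a) ?y) \<cdot>\<^bsub>C\<^esub> FA (NSrc b) (NMap a ?y)) \<cdot>\<^bsub>C\<^esub> FA (NSrc b) (FA (NSrc a) f)"
      using f a(1-6) b(1-6) F(1-5) G(1-5) H(1-6) K(1-5) by (simp add: C.comp_assoc)
    finally show "FA (NTgt (hcomp A C b a)) f \<cdot>\<^bsub>C\<^esub> NMap (hcomp A C b a) ?x =
      NMap (hcomp A C b a) ?y \<cdot>\<^bsub>C\<^esub> FA (NSrc (hcomp A C b a)) f" using f by (simp add: hcomp_def func_comp_def)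
  next
    show "is_functor A C (NSrc (hcomp A C b a))" "is_functor A C (NTgt (hcomp A C b a))"
      using a b assms by (auto simp: hcomp_def intro: func_comp_functor)
  next
    fix x assume x: "x \<in> Ob A"
    show "NMap (hcomp A C b a) x \<in> Ar C" "Dom C (NMap (hcomp A C b a) x) = FO (NSrc (hcomp A C b a)) x"
      "Cod C (NMap (hcomp A C b a) x) = FO (NTgt (hcomp A C b a)) x"
      using x a(1-6) b(1-6) F(1-5) G(1-5) H(1-5) K(1-5) by (auto simp: hcomp_def func_comp_def)
  qed (auto simp: hcomp_def)
qed

lemma interchange:
  assumes "category A" "category B" "category C" 
    "is_ntrans A B a" "is_ntrans B C b" "is_ntrans A B a'" "is_ntrans B C b'" "NSrc a' = NTgt a" "NSrc b' = NTgt b"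
  shows "hcomp A C (vcomp B C b' b) (vcomp A B a' a) = vcomp A C (hcomp A C b' a') (hcomp A C b a)"
proof -
  interpret A: category A by fact
  interpret B: category B by fact
  interpret C: category C by fact
  note a = ntransD[OF assms(4)] note b = ntransD[OF assms(5)]
  note a' = ntransD[OF assms(6)] note b' = ntransD[OF assms(7)]
  note F = functorD[OF a(1)] and G = functorD[OF a(2)] and H = functorD[OF b(1)] and K = functorD[OF b(2)]
   and G' = functorD[OF a'(2)] and K' = functorD[OF b'(2)]
  have "(NMap b' (FO (NTgt a') x) \<cdot>\<^bsub>C\<^esub> NMap b (FO (NTgt a') x)) \<cdot>\<^bsub>C\<^esub> FA (NSrc b) (NMap a' x \<cdot>\<^bsub>B\<^esub> NMap a x) =
      (NMap b' (FO (NTgt a') x) \<cdot>\<^bsub>C\<^esub> FA (NSrc b') (NMap a' x)) \<cdot>\<^bsub>C\<^esub> (NMap b (FO (NTgt a) x) \<cdot>\<^bsub>C\<^esub> FA (NSrc b) (NMap a x))" 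
    (is "?L = ?R") if x: "x \<in> Ob A" for x
  proof -
    have "?L = NMap b' (FO (NTgt a') x) \<cdot>\<^bsub>C\<^esub> ((NMap b (FO (NTgt a') x) \<cdot>\<^bsub>C\<^esub> FA (NSrc b) (NMap a' x)) \<cdot>\<^bsub>C\<^esub> FA (NSrc b) (NMap a x))"
      using x a(1-6) b(1-6) a'(1-6) b'(1-6) F(1-5) G(1-5) H(1-6) K(1-5) G'(1-5) K'(1-5) assms(8,9) by (simp add: C.comp_assoc)
    also have "NMap b (FO (NTgt a') x) \<cdot>\<^bsub>C\<^esub> FA (NSrc b) (NMap a' x) = FA (NTgt b) (NMap a' x) \<cdot>\<^bsub>C\<^esub> NMap b (FO (NTgt a) x)"
      using b(7)[of "NMap a' x"] a' x assms(8) by simp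
    finally show ?thesis 
      using x a(1-6) b(1-6) a'(1-6) b'(1-6) F(1-5) G(1-5) H(1-6) K(1-5) G'(1-5) K'(1-5) assms(8,9) by (simp add: C.comp_assoc)
  qed
  then show ?thesis using G'(1) by (auto simp: hcomp_def vcomp_def intro!: restrict_ext)
qed

lemma two_category_Cat: "two_category Cat"
proof (rule two_category.intro, goal_cases)
  case (1 A B) then show ?case by (auto simp: Cat_def category_functor_cat)
next
  case (2 A) then show ?case by (auto simp: Cat_def functor_cat_def func_id_functor)
next
  case (3 A B C)
  then have c: "category A" "category B" "category C" by (auto simp: Cat_def)
  then interpret A: category A + B: category B + C: category C by auto
  show ?case
  proof (rule functorI, goal_cases)
    case (1 x) then show ?case using c by (auto simp: Cat_def functor_cat_def prod_cat_def intro!: func_comp_functor)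
  next
    case (2 x) then show ?case using c by (auto simp: Cat_def functor_cat_def prod_cat_def intro!: hcomp_ntrans[OF c])
  next
    case (3 f) then show ?case by (auto simp: Cat_def functor_cat_def prod_cat_def hcomp_def ntransD)
  next
    case (4 f) then show ?case by (auto simp: Cat_def functor_cat_def prod_cat_def hcomp_def ntransD)
  next
    case (5 x) 
    then obtain G F where x: "x = (G,F)" "is_functor B C G" "is_functor A B F" by (auto simp: Cat_def functor_cat_def prod_cat_def)
    then have "is_ntrans B C (ntid B C G)" "is_ntrans A B (ntid A B F)" using category.id_hom[OF category_functor_cat[of B C], of G] 
       category.id_hom[OF category_functor_cat[of A B], of F] c by (auto simp: functor_cat_def hom_iff)
    moreover have "hcomp A C (ntid B C G) (ntid A B F) = ntid A C (func_comp A G F)"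
      using functorD[OF x(2)] functorD[OF x(3)] by (auto simp: hcomp_def ntid_def func_comp_def C.id_l intro!: restrict_ext)
    ultimately show ?case using x by (auto simp: Cat_def functor_cat_def prod_cat_def)
  next
    case (6 f g)
    then show ?case 
      by (auto simp: Cat_def functor_cat_def prod_cat_def vcomp_ntrans c interchange)
  qed (auto simp: Cat_def)
next
  case (4 A B f)
  then have f: "is_functor A B f" and c: "category A" "category B" by (auto simp: Cat_def functor_cat_def)
  have "func_comp A (func_id B) f = f" using functorD[OF f] by (intro func_eqI[of _ "Ob A" _ "Ar A"]) (auto simp: func_comp_def func_id_def)
  then show ?case using f c by (auto simp: Cat_def functor_cat_def prod_cat_def func_id_functor)
next
  case (5 A B a)
  then have f: "is_ntrans A B a" and c: "category A" "category B" by (auto simp: Cat_def functor_cat_def)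
  then interpret A: category A + B: category B by auto
  note a = ntransD[OF f] note b = functorD[OF a(1)] functorD[OF a(2)]
  have 1: "func_comp A (func_id B) (NSrc a) = NSrc a" "func_comp A (func_id B) (NTgt a) = NTgt a" using b by (auto intro!: func_eqI[of _ "Ob A" _ "Ar A"] simp: func_comp_def func_id_def)
  have "hcomp A B (ntid B B (func_id B)) a = a" apply (intro nt_eqI[of _ _ "Ob A"])
    using a b 1 by (auto simp: hcomp_def ntid_def) (auto simp: func_id_def B.id_l)
  moreover have "is_ntrans B B (ntid B B (func_id B))" using category.id_hom[OF category_functor_cat[of B B]] func_id_functor c  by (auto simp: functor_cat_def hom_iff)
  ultimately show ?case using f c by (auto simp: Id2_def Cat_def functor_cat_def prod_cat_def func_id_functor)
next
  case (6 A B f)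
  then have f: "is_functor A B f" and c: "category A" "category B" by (auto simp: Cat_def functor_cat_def)
  have "func_comp A f (func_id A) = f" using functorD[OF f] by (intro func_eqI[of _ "Ob A" _ "Ar A"]) (auto simp: func_comp_def func_id_def)
  then show ?case using f c by (auto simp: Cat_def functor_cat_def prod_cat_def func_id_functor)
next
  case (7 A B a)
  then have f: "is_ntrans A B a" and c: "category A" "category B" by (auto simp: Cat_def functor_cat_def)
  then interpret A: category A + B: category B by auto
  note a = ntransD[OF f] note b = functorD[OF a(1)] functorD[OF a(2)]
  have 1: "func_comp A (NSrc a) (func_id A) = NSrc a" "func_comp A (NTgt a) (func_id A) = NTgt a" using b by (auto intro!: func_eqI[of _ "Ob A" _ "Ar A"] simp: func_comp_def func_id_def)
  have "hcomp A B a (ntid A A (func_id A)) = a" apply (intro nt_eqI[of _ _ "Ob A"])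
    using a b 1 by (auto simp: hcomp_def ntid_def) (auto simp: func_id_def B.id_r)
  moreover have "is_ntrans A A (ntid A A (func_id A))" using category.id_hom[OF category_functor_cat[of A A]] func_id_functor c  by (auto simp: functor_cat_def hom_iff)
  ultimately show ?case using f c by (auto simp: Id2_def Cat_def functor_cat_def prod_cat_def func_id_functor)
next
  case (8 A B C D f g h)
  then have f: "is_functor A B f" "is_functor B C g" "is_functor C D h" and c: "category A" "category B" "category C" by (auto simp: Cat_def functor_cat_def)
  have "func_comp A (func_comp B h g) f = func_comp A h (func_comp A g f)" using functorD[OF f(1)] by (auto simp: func_comp_def intro!: restrict_ext)
  then show ?case using f c by (auto simp: Cat_def functor_cat_def prod_cat_def func_comp_functor)
next
  case (9 A B C D \<alpha> \<beta> \<gamma>)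
  then have f: "is_ntrans A B \<alpha>" "is_ntrans B C \<beta>" "is_ntrans C D \<gamma>" and c: "category A" "category B" "category C" "category D" by (auto simp: Cat_def functor_cat_def)
  then interpret D: category D by auto
  note a = ntransD[OF f(1)] and b = ntransD[OF f(2)] and d = ntransD[OF f(3)]
  note F = functorD[OF a(1)] and G = functorD[OF a(2)] and H = functorD[OF b(1)] and K = functorD[OF b(2)]
   and G' = functorD[OF d(1)] and K' = functorD[OF d(2)]
  have 1: "func_comp A (func_comp B h g) f = func_comp A h (func_comp A g f)" if "is_functor A B f" for f g and h :: "('a,'b,'a,'b) func" using functorD[OF that] by (auto simp: func_comp_def intro!: restrict_ext)
  have "hcomp A D (hcomp B D \<gamma> \<beta>) \<alpha> = hcomp A D \<gamma> (hcomp A C \<beta> \<alpha>)"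
    using a(1-6) b(1-6) d(1-6) F(1-5) G(1-5) H(1-5) K(1-5) G'(1-6) K'(1-5)
    by (auto simp: hcomp_def 1 intro!: restrict_ext) (auto simp: func_comp_def D.comp_assoc)
  then show ?case using f c by (auto simp: Cat_def functor_cat_def prod_cat_def hcomp_ntrans)
qed


lemma two_functor_hom:
  assumes "two_category K" "P \<in> Obj K"
  shows "is_two_functor K Cat (hom_two_functor K P)"
proof -
  interpret K: two_category K by fact
  note P = assms(2)
  define Obs where "Obs = Obj K"
  have cat: "category (Hom K A B)" if "A \<in> Obs" "B \<in> Obs" for A B using that K.Hom_category by (simp add: Obs_def)
  have hc: "is_functor (prod_cat (Hom K B C) (Hom K A B)) (Hom K A C) (Hcomp K A B C)" if "A \<in> Obs" "B \<in> Obs" "C \<in> Obs" for A B C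
    using that K.Hcomp_functor by (simp add: Obs_def)
  have ob [simp]: "FO (Hcomp K A B C) (g,f) \<in> Ob (Hom K A C)" 
    if "A \<in> Obs" "B \<in> Obs" "C \<in> Obs" "g \<in> Ob (Hom K B C)" "f \<in> Ob (Hom K A B)" for A B C f g
    using functorD(1)[OF hc[OF that(1-3)]] that by (auto simp: prod_cat_def)
  have ar [simp]: "FA (Hcomp K A B C) (g,f) \<in> Ar (Hom K A C)" 
    "Dom (Hom K A C) (FA (Hcomp K A B C) (g,f)) = FO (Hcomp K A B C) (Dom (Hom K B C) g, Dom (Hom K A B) f)"
    "Cod (Hom K A C) (FA (Hcomp K A B C) (g,f)) = FO (Hcomp K A B C) (Cod (Hom K B C) g, Cod (Hom K A B) f)"
    if "A \<in> Obs" "B \<in> Obs" "C \<in> Obs" "g \<in> Ar (Hom K B C)" "f \<in> Ar (Hom K A B)" for A B C f g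
    using functorD(2-4)[OF hc[OF that(1-3)], of "(g,f)"] that by (auto simp: prod_cat_def)
  have idd: "FA (Hcomp K A B C) (Ide (Hom K B C) g, Ide (Hom K A B) f) = Ide (Hom K A C) (FO (Hcomp K A B C) (g,f))"
    if "A \<in> Obs" "B \<in> Obs" "C \<in> Obs" "g \<in> Ob (Hom K B C)" "f \<in> Ob (Hom K A B)" for A B C f g
    using functorD(5)[OF hc[OF that(1-3)], of "(g,f)"] that by (auto simp: prod_cat_def)
  have ic: "FA (Hcomp K A B C) (g' \<cdot>\<^bsub>Hom K B C\<^esub> g, f' \<cdot>\<^bsub>Hom K A B\<^esub> f) = 
      FA (Hcomp K A B C) (g',f') \<cdot>\<^bsub>Hom K A C\<^esub> FA (Hcomp K A B C) (g,f)"
    if "A \<in> Obs" "B \<in> Obs" "C \<in> Obs" "g \<in> Ar (Hom K B C)" "f \<in> Ar (Hom K A B)" "g' \<in> Ar (Hom K B C)" "f' \<in> Ar (Hom K A B)"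
      "Dom (Hom K B C) g' = Cod (Hom K B C) g" "Dom (Hom K A B) f' = Cod (Hom K A B) f"for A B C f g f' g'
    using functorD(6)[OF hc[OF that(1-3)], of "(g,f)" "(g',f')"] that by (auto simp: prod_cat_def)
  note [simp] = category.dom_ob[OF cat] category.cod_ob[OF cat] category.id_ar[OF cat]
    category.comp_ar[OF cat] category.dom_comp[OF cat] category.cod_comp[OF cat]
  note idl = category.id_l[OF cat] category.id_r[OF cat]
  have PO[simp]: "P \<in> Obs" using P by (simp add: Obs_def)
  have p1: "is_functor (Hom K P B) (Hom K P B') (postcomp1 K P B B' b)" 
    if b: "B \<in> Obs" "B' \<in> Obs" "b \<in> Ob (Hom K B B')" for B B' b
    using b by (intro functorI) (auto simp: postcomp1_def idd ic[symmetric] idl)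
  have p2: "is_ntrans (Hom K P B) (Hom K P B') (postcomp2 K P B B' \<beta>)" 
    if b: "B \<in> Obs" "B' \<in> Obs" "\<beta> \<in> Ar (Hom K B B')" for B B' \<beta>
    using b by (intro ntransI) (auto simp: postcomp2_def p1, auto simp: postcomp1_def idd ic[symmetric] idl)
  have p3: "is_functor (Hom K A B) (functor_cat (Hom K P A) (Hom K P B)) (THom (hom_two_functor K P) A B)"
    if b: "A \<in> Obs" "B \<in> Obs" for A B 
    using b apply (intro functorI) 
        apply (auto simp: hom_two_functor_def functor_cat_def p1 p2)
       apply (auto simp: postcomp2_def ntid_def vcomp_def idd ic[symmetric] idl intro!: restrict_ext)
     apply (auto simp: postcomp1_def idd ic[symmetric] idl)
    done
  have nid: "is_ntrans (Hom K P B) (Hom K P B') (postcomp2 K P B B' \<beta>)" 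
    if b: "B \<in> Obs" "B' \<in> Obs" "\<beta> \<in> Ar (Hom K B B')" for B B' \<beta> using p2 that .
  note as = K.assoc1[folded Obs_def] K.assoc2[folded Obs_def]
  have c1: "postcomp1 K P A C (FO (Hcomp K A B C) (g, f)) = func_comp (Hom K P A) (postcomp1 K P B C g) (postcomp1 K P A B f)"
    if "A \<in> Obs" "B \<in> Obs" "C \<in> Obs" "g \<in> Ob (Hom K B C)" "f \<in> Ob (Hom K A B)" for A B C f g
    using that by (auto simp: postcomp1_def func_comp_def as idd[symmetric] intro!: restrict_ext)
  have c2: "postcomp2 K P A C (FA (Hcomp K A B C) (g, f)) = hcomp (Hom K P A) (Hom K P C) (postcomp2 K P B C g) (postcomp2 K P A B f)"
    if "A \<in> Obs" "B \<in> Obs" "C \<in> Obs" "g \<in> Ar (Hom K B C)" "f \<in> Ar (Hom K A B)" for A B C f g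
  proof -
    have "FA (Hcomp K P A C) (FA (Hcomp K A B C) (g, f), Ide (Hom K P A) x) =
     FA (Hcomp K P B C) (g, Ide (Hom K P B) (FO (Hcomp K P A B) (Cod (Hom K A B) f, x))) \<cdot>\<^bsub>Hom K P C\<^esub>
     FA (Hcomp K P B C) (Ide (Hom K B C) (Dom (Hom K B C) g), FA (Hcomp K P A B) (f, Ide (Hom K P A) x))" 
      if x: "x \<in> Ob (Hom K P A)" for x
      using that \<open>A \<in> Obs\<close> \<open>B \<in> Obs\<close> \<open>C \<in> Obs\<close> \<open>g \<in> _\<close> \<open>f \<in> _\<close> by (simp add: as ic[symmetric] idl)
    then show ?thesis using that by (auto simp: postcomp2_def hcomp_def c1 intro!: restrict_ext) (auto simp: postcomp1_def)
  qed
  have i1: "postcomp1 K P A A (Id1 K A) = func_id (Hom K P A)" if "A \<in> Obs" for A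
    using that K.unit_left1[of P A] K.unit_left2[of P A] P unfolding postcomp1_def func_id_def Obs_def Id2_def
    by (auto intro!: restrict_ext)
  have io: "Id1 K A \<in> Ob (Hom K A A)" if "A \<in> Obs" for A using K.Id1_Ob that by (simp add: Obs_def)
  have TOh: "TO (hom_two_functor K P) = Hom K P" by (simp add: hom_two_functor_def)
  show ?thesis unfolding is_two_functor_def Obs_def[symmetric]
    using p3 by (auto simp: Cat_def TOh simp del: ob ar) (auto simp: hom_two_functor_def c1 c2 i1 io cat prod_cat_def functor_cat_def p1 p2)
qed


locale pbcat = E: category E for E :: "('o,'a) cat" + assumes pbs: "has_pullbacks E"
begin

abbreviation cc (infixl "\<bullet>" 70) where "g \<bullet> f \<equiv> g \<cdot>\<^bsub>E\<^esub> f"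

lemma pb: assumes "f \<in> Ar E" "g \<in> Ar E" "Cod E f = Cod E g"
  shows "is_pullback E f g (pb_ob E f g) (pb_p1 E f g) (pb_p2 E f g)"
proof -
  obtain P p q where "is_pullback E f g P p q" using pbs assms unfolding has_pullbacks_def by blast
  then have "\<exists>x. case x of (P,p,q) \<Rightarrow> is_pullback E f g P p q" by auto
  from someI_ex[OF this] show ?thesis by (auto simp: Defs.pb_def pb_ob_def pb_p1_def pb_p2_def)
qed

definition "cmp f g u v \<longleftrightarrow> f \<in> Ar E \<and> g \<in> Ar E \<and> Cod E f = Cod E g \<and> u \<in> Ar E \<and> v \<in> Ar E \<and> Dom E u = Dom E v \<and> Cod E u = Dom E f \<and> Cod E v = Dom E g \<and> f \<bullet> u = g \<bullet> v"

lemma pr: assumes "f \<in> Ar E" "g \<in> Ar E" "Cod E f = Cod E g"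
  shows "pb_ob E f g \<in> Ob E" "pb_p1 E f g \<in> Ar E" "pb_p2 E f g \<in> Ar E" "Dom E (pb_p1 E f g) = pb_ob E f g" "Dom E (pb_p2 E f g) = pb_ob E f g"
     "Cod E (pb_p1 E f g) = Dom E f" "Cod E (pb_p2 E f g) = Dom E g" "f \<bullet> pb_p1 E f g = g \<bullet> pb_p2 E f g"
  using pb[OF assms] by (auto simp: is_pullback_def hom_iff)

lemma pair1: assumes "cmp f g u v"
  shows "\<exists>!w. w \<in> hom E (Dom E u) (pb_ob E f g) \<and> pb_p1 E f g \<bullet> w = u \<and> pb_p2 E f g \<bullet> w = v"
proof -
  have "is_pullback E f g (pb_ob E f g) (pb_p1 E f g) (pb_p2 E f g)" using pb assms by (auto simp: cmp_def)
  then have *: "\<And>X u v. X \<in> Ob E \<Longrightarrow> u \<in> hom E X (Dom E f) \<Longrightarrow> v \<in> hom E X (Dom E g) \<Longrightarrow> f \<bullet> u = g \<bullet> v \<Longrightarrow>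
    (\<exists>!w. w \<in> hom E X (pb_ob E f g) \<and> pb_p1 E f g \<bullet> w = u \<and> pb_p2 E f g \<bullet> w = v)" unfolding is_pullback_def by blast
  show ?thesis by (rule *) (use assms in \<open>auto simp: cmp_def hom_iff\<close>)
qed

lemma pair: assumes "cmp f g u v"
  shows "pb_pair E f g u v \<in> Ar E" "Dom E (pb_pair E f g u v) = Dom E u" "Cod E (pb_pair E f g u v) = pb_ob E f g"
   "pb_p1 E f g \<bullet> pb_pair E f g u v = u" "pb_p2 E f g \<bullet> pb_pair E f g u v = v"
  using theI'[OF pair1[OF assms]] unfolding pb_pair_def hom_iff by auto

lemma pair_eq: assumes "f \<in> Ar E" "g \<in> Ar E" "Cod E f = Cod E g" "w \<in> Ar E" "Cod E w = pb_ob E f g"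
  "pb_p1 E f g \<bullet> w = u" "pb_p2 E f g \<bullet> w = v"
  shows "pb_pair E f g u v = w"
proof -
  have "cmp f g u v" using assms pr[OF assms(1-3)] by (auto simp: cmp_def E.comp_assoc[symmetric])
  from the1_equality[OF pair1[OF this], of w] show ?thesis using assms pr[OF assms(1-3)] by (auto simp: pb_pair_def hom_iff)
qed

lemma pair_comp: assumes "cmp f g u v" "w \<in> Ar E" "Cod E w = Dom E u"
  shows "pb_pair E f g u v \<bullet> w = pb_pair E f g (u \<bullet> w) (v \<bullet> w)"
proof -
  have a: "f \<in> Ar E" "g \<in> Ar E" "Cod E f = Cod E g" using assms(1) by (auto simp: cmp_def)
  show ?thesis
  by (rule sym, rule pair_eq) (use assms pair[OF assms(1)] pr[OF a] a in \<open>auto simp: E.comp_assoc[symmetric]\<close>)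
qed

end

locale icat = pbcat E for E :: "('o,'a) cat" + fixes A :: "('o,'a) icat" assumes A: "is_icat E A"
begin
lemma A': "IOb A \<in> Ob E" "IAr A \<in> Ob E" "ISrc A \<in> Ar E" "Dom E (ISrc A) = IAr A" "Cod E (ISrc A) = IOb A"
 "ITgt A \<in> Ar E" "Dom E (ITgt A) = IAr A" "Cod E (ITgt A) = IOb A" "IId A \<in> Ar E" "Dom E (IId A) = IOb A" "Cod E (IId A) = IAr A"
 "IComp A \<in> Ar E" "Dom E (IComp A) = pb_ob E (ISrc A) (ITgt A)" "Cod E (IComp A) = IAr A"
  "ISrc A \<bullet> IId A = Ide E (IOb A)" "ITgt A \<bullet> IId A = Ide E (IOb A)"
  "ISrc A \<bullet> IComp A = ISrc A \<bullet> pb_p2 E (ISrc A) (ITgt A)" "ITgt A \<bullet> IComp A = ITgt A \<bullet> pb_p1 E (ISrc A) (ITgt A)"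
 "icomp E A (IId A \<bullet> ITgt A) (Ide E (IAr A)) = Ide E (IAr A)"
 "icomp E A (Ide E (IAr A)) (IId A \<bullet> ISrc A) = Ide E (IAr A)"
  using A unfolding is_icat_def Let_def hom_iff by blast+

definition "cp g f \<longleftrightarrow> g \<in> Ar E \<and> f \<in> Ar E \<and> Cod E g = IAr A \<and> Cod E f = IAr A \<and> Dom E g = Dom E f \<and> ISrc A \<bullet> g = ITgt A \<bullet> f"

lemma cp_cmp: "cp g f \<Longrightarrow> cmp (ISrc A) (ITgt A) g f" using A' by (auto simp: cp_def cmp_def)

abbreviation "p \<equiv> pb_p1 E (ISrc A) (ITgt A)"
abbreviation "q \<equiv> pb_p2 E (ISrc A) (ITgt A)"
abbreviation "m \<equiv> icomp E A"
lemma pq: "p \<in> Ar E" "q \<in> Ar E" "Dom E p = pb_ob E (ISrc A) (ITgt A)" "Dom E q = pb_ob E (ISrc A) (ITgt A)"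
  "Cod E p = IAr A" "Cod E q = IAr A" "ISrc A \<bullet> p = ITgt A \<bullet> q" 
  using pr[of "ISrc A" "ITgt A"] A' by auto
lemma cp_pq: "cp p q" using pq by (simp add: cp_def)

lemma m_ar: assumes "cp g f" shows "m g f \<in> Ar E" "Dom E (m g f) = Dom E f" "Cod E (m g f) = IAr A"
   "ISrc A \<bullet> m g f = ISrc A \<bullet> f" "ITgt A \<bullet> m g f = ITgt A \<bullet> g"
proof -
  note pp = pair[OF cp_cmp[OF assms]]
  have c: "g \<in> Ar E" "f \<in> Ar E" "Cod E g = IAr A" "Cod E f = IAr A" "Dom E g = Dom E f" using assms by (auto simp: cp_def)
  show "m g f \<in> Ar E" "Dom E (m g f) = Dom E f" "Cod E (m g f) = IAr A" using pp A' c by (auto simp: icomp_def)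
  show "ISrc A \<bullet> m g f = ISrc A \<bullet> f" "ITgt A \<bullet> m g f = ITgt A \<bullet> g" 
    using pp A' pq c by (simp_all add: icomp_def E.comp_assoc[symmetric]) (simp_all add: E.comp_assoc)
qed

lemma cp_comp: "cp g f \<Longrightarrow> w \<in> Ar E \<Longrightarrow> Cod E w = Dom E f \<Longrightarrow> cp (g \<bullet> w) (f \<bullet> w)"
  using A' by (auto simp: cp_def E.comp_assoc[symmetric])

lemma m_comp: assumes "cp g f" "w \<in> Ar E" "Cod E w = Dom E f" shows "m g f \<bullet> w = m (g \<bullet> w) (f \<bullet> w)"
  using assms pair_comp[OF cp_cmp[OF assms(1)] assms(2)] pair[OF cp_cmp[OF assms(1)]] A' 
  by (simp add: icomp_def E.comp_assoc cp_def)

lemma IComp_pair: "cp g f \<Longrightarrow> IComp A \<bullet> pb_pair E (ISrc A) (ITgt A) g f = m g f" by (simp add: icomp_def)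

lemma IComp_m: "IComp A = m p q" 
proof -
  have "pb_pair E (ISrc A) (ITgt A) p q = Ide E (pb_ob E (ISrc A) (ITgt A))"
    by (rule pair_eq) (use A' pq pr[of "ISrc A" "ITgt A"] E.id_r in auto)
  then show ?thesis using A' E.id_r by (simp add: icomp_def)
qed

lemma m_unit: assumes "f \<in> Ar E" "Cod E f = IAr A"
  shows "m (IId A \<bullet> (ITgt A \<bullet> f)) f = f" "m f (IId A \<bullet> (ISrc A \<bullet> f)) = f"
proof -
  have "cp (IId A \<bullet> ITgt A) (Ide E (IAr A))" "cp (Ide E (IAr A)) (IId A \<bullet> ISrc A)" using A' 
    by (auto simp: cp_def E.id_l E.id_r E.comp_assoc[symmetric])
  from this[THEN m_comp, of f] show "m (IId A \<bullet> (ITgt A \<bullet> f)) f = f" "m f (IId A \<bullet> (ISrc A \<bullet> f)) = f"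
    using A' assms by (auto simp: E.id_l E.comp_assoc)
qed

lemma m_assoc: assumes "cp h g" "cp g f" shows "m (m h g) f = m h (m g f)"
proof -
  define r s where "r = pb_p1 E q p" and "s = pb_p2 E q p"
  have law: "m (IComp A \<bullet> r) (q \<bullet> s) = m (p \<bullet> r) (IComp A \<bullet> s)"
    using A unfolding is_icat_def Let_def r_def s_def by blast
  let ?X = "pb_pair E (ISrc A) (ITgt A) h g" and ?Y = "pb_pair E (ISrc A) (ITgt A) g f"
  note X = pair[OF cp_cmp[OF assms(1)]] and Y = pair[OF cp_cmp[OF assms(2)]]
  have c: "g \<in> Ar E" "f \<in> Ar E" "Cod E g = IAr A" "Cod E f = IAr A" "Dom E g = Dom E f" "h \<in> Ar E" "Cod E h = IAr A" "Dom E h = Dom E g"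
    using assms by (auto simp: cp_def)
  have cm: "cmp q p ?X ?Y" using X Y pq c by (auto simp: cmp_def)
  let ?w = "pb_pair E q p ?X ?Y"
  note w = pair[OF cm]
  have rs: "r \<in> Ar E" "s \<in> Ar E" "Dom E r = pb_ob E q p" "Dom E s = pb_ob E q p" "Cod E r = pb_ob E (ISrc A) (ITgt A)" "Cod E s = pb_ob E (ISrc A) (ITgt A)"
    "q \<bullet> r = p \<bullet> s"
    using pr[of q p] pq by (auto simp: r_def s_def)
  have w': "r \<bullet> ?w = ?X" "s \<bullet> ?w = ?Y" using w by (auto simp: r_def s_def)
  have a: "cp (IComp A \<bullet> r) (q \<bullet> s)"
  proof -
    have "ISrc A \<bullet> (IComp A \<bullet> r) = ISrc A \<bullet> (q \<bullet> r)" using rs(1-6) pq A' by (simp add: E.comp_assoc[symmetric])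
    also have "\<dots> = (ISrc A \<bullet> p) \<bullet> s" unfolding rs(7) using rs(1-6) pq(1-6) A' by (simp add: E.comp_assoc)
    also have "\<dots> = ITgt A \<bullet> (q \<bullet> s)" unfolding pq(7) using rs(1-6) pq(1-6) A' by (simp add: E.comp_assoc)
    finally show ?thesis using rs pq A' by (simp add: cp_def)
  qed
  have b: "cp (p \<bullet> r) (IComp A \<bullet> s)"
  proof -
    have "ISrc A \<bullet> (p \<bullet> r) = (ISrc A \<bullet> p) \<bullet> r" using rs(1-6) pq(1-6) A' by (simp add: E.comp_assoc)
    also have "\<dots> = ITgt A \<bullet> (q \<bullet> r)" unfolding pq(7) using rs(1-6) pq(1-6) A' by (simp add: E.comp_assoc)
    also have "\<dots> = (ITgt A \<bullet> p) \<bullet> s" unfolding rs(7) using rs(1-6) pq(1-6) A' by (simp add: E.comp_assoc)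
    also have "\<dots> = ITgt A \<bullet> (IComp A \<bullet> s)" unfolding A'(18)[symmetric] using rs(1-6) pq(1-6) A'(1-14) by (simp add: E.comp_assoc)
    finally show ?thesis using rs pq A' by (simp add: cp_def)
  qed
  have "m (IComp A \<bullet> r) (q \<bullet> s) \<bullet> ?w = m (m h g) f"
    using m_comp[OF a, of ?w] w X Y w' rs pq A' IComp_pair[OF assms(1)] by (simp add: E.comp_assoc)
  moreover have "m (p \<bullet> r) (IComp A \<bullet> s) \<bullet> ?w = m h (m g f)"
    using m_comp[OF b, of ?w] w X Y w' rs pq A' IComp_pair[OF assms(2)] by (simp add: E.comp_assoc)
  ultimately show ?thesis using law by simp
qed
end

lemma (in pbcat) icat: "is_icat E A \<Longrightarrow> icat E A" by unfold_locales

lemma (in pbcat) ifuncD: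
  assumes "is_icat E A" "is_icat E B" "is_ifunc E A B F"
  shows "IFO F \<in> Ar E" "Dom E (IFO F) = IOb A" "Cod E (IFO F) = IOb B" "IFA F \<in> Ar E" "Dom E (IFA F) = IAr A" "Cod E (IFA F) = IAr B"
     "ISrc B \<bullet> IFA F = IFO F \<bullet> ISrc A" "ITgt B \<bullet> IFA F = IFO F \<bullet> ITgt A" "IFA F \<bullet> IId A = IId B \<bullet> IFO F"
     "icat.cp E A g f \<Longrightarrow> IFA F \<bullet> icomp E A g f = icomp E B (IFA F \<bullet> g) (IFA F \<bullet> f)"
     "icat.cp E A g f \<Longrightarrow> icat.cp E B (IFA F \<bullet> g) (IFA F \<bullet> f)"
proof -
  interpret A: icat E A by (rule icat) fact
  interpret B: icat E B by (rule icat) fact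
  show 1: "IFO F \<in> Ar E" "Dom E (IFO F) = IOb A" "Cod E (IFO F) = IOb B" "IFA F \<in> Ar E" "Dom E (IFA F) = IAr A" "Cod E (IFA F) = IAr B"
     "ISrc B \<bullet> IFA F = IFO F \<bullet> ISrc A" "ITgt B \<bullet> IFA F = IFO F \<bullet> ITgt A" "IFA F \<bullet> IId A = IId B \<bullet> IFO F"
    using assms(3) by (auto simp: is_ifunc_def hom_iff)
  have 2: "IFA F \<bullet> IComp A = icomp E B (IFA F \<bullet> A.p) (IFA F \<bullet> A.q)" using assms(3) by (auto simp: is_ifunc_def)
  have 3: "B.cp (IFA F \<bullet> g) (IFA F \<bullet> f)" if "A.cp g f" for g f
    using that 1 B.A' A.A' unfolding B.cp_def A.cp_def by (auto simp: E.comp_assoc[symmetric]) (simp add: E.comp_assoc)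
  then show "A.cp g f \<Longrightarrow> B.cp (IFA F \<bullet> g) (IFA F \<bullet> f)" .
  assume c: "A.cp g f"
  note X = pair[OF A.cp_cmp[OF c]]
  have d: "g \<in> Ar E" "f \<in> Ar E" "Cod E g = IAr A" "Cod E f = IAr A" "Dom E g = Dom E f" using c unfolding A.cp_def by auto
  show "IFA F \<bullet> icomp E A g f = icomp E B (IFA F \<bullet> g) (IFA F \<bullet> f)"
    using arg_cong[OF 2, of "\<lambda>z. z \<bullet> pb_pair E (ISrc A) (ITgt A) g f"] X 1 A.pq A.A' d
    by (simp add: icomp_def[of E A] E.comp_assoc B.m_comp[OF 3[OF A.cp_pq]])
qed

lemma (in pbcat) ifuncI:
  assumes "is_icat E A" "is_icat E B"
   "IFO F \<in> Ar E" "Dom E (IFO F) = IOb A" "Cod E (IFO F) = IOb B" "IFA F \<in> Ar E" "Dom E (IFA F) = IAr A" "Cod E (IFA F) = IAr B"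
     "ISrc B \<bullet> IFA F = IFO F \<bullet> ISrc A" "ITgt B \<bullet> IFA F = IFO F \<bullet> ITgt A" "IFA F \<bullet> IId A = IId B \<bullet> IFO F"
     "\<And>g f. icat.cp E A g f \<Longrightarrow> IFA F \<bullet> icomp E A g f = icomp E B (IFA F \<bullet> g) (IFA F \<bullet> f)"
  shows "is_ifunc E A B F"
proof -
  interpret A: icat E A by (rule icat) fact
  show ?thesis using assms A.IComp_m A.cp_pq unfolding is_ifunc_def hom_iff by metis
qed

lemma (in pbcat) ifunc_comp:
  assumes "is_icat E A" "is_icat E B" "is_icat E C" "is_ifunc E A B F" "is_ifunc E B C G"
  shows "is_ifunc E A C (ifunc_comp E G F)"
proof -
  interpret A: icat E A by (rule icat) fact
  interpret B: icat E B by (rule icat) fact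
  interpret C: icat E C by (rule icat) fact
  note F = ifuncD[OF assms(1,2,4)] and G = ifuncD[OF assms(2,3,5)]
  have t: "ISrc C \<bullet> (IFA G \<bullet> IFA F) = IFO G \<bullet> IFO F \<bullet> ISrc A" "ITgt C \<bullet> (IFA G \<bullet> IFA F) = IFO G \<bullet> IFO F \<bullet> ITgt A"
     "IFA G \<bullet> IFA F \<bullet> IId A = IId C \<bullet> (IFO G \<bullet> IFO F)"
    using F(1-9) G(1-9) A.A' B.A' C.A' by (metis E.comp_assoc)+
  have "IFA G \<bullet> IFA F \<bullet> A.m g f = C.m (IFA G \<bullet> IFA F \<bullet> g) (IFA G \<bullet> IFA F \<bullet> f)" if c: "A.cp g f" for g f
  proof -
    have d: "g \<in> Ar E" "f \<in> Ar E" "Cod E g = IAr A" "Cod E f = IAr A" using c unfolding A.cp_def by auto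
    show ?thesis using F(1-6) G(1-6) A.m_ar[OF c] d F(10)[OF c] G(10)[OF F(11)[OF c]] by (simp add: E.comp_assoc)
  qed
  with t show ?thesis by (intro ifuncI) (use F(1-6) G(1-6) assms in \<open>auto simp: ifunc_comp_def\<close>)
qed

lemma (in pbcat) intransD:
  assumes "is_icat E A" "is_icat E B" "is_intrans E A B a"
  shows "is_ifunc E A B (INSrc a)" "is_ifunc E A B (INTgt a)" "INMap a \<in> Ar E" "Dom E (INMap a) = IOb A" "Cod E (INMap a) = IAr B"
    "ISrc B \<bullet> INMap a = IFO (INSrc a)" "ITgt B \<bullet> INMap a = IFO (INTgt a)"
    "f \<in> Ar E \<Longrightarrow> Cod E f = IAr A \<Longrightarrow> icomp E B (IFA (INTgt a) \<bullet> f) (INMap a \<bullet> (ISrc A \<bullet> f)) = icomp E B (INMap a \<bullet> (ITgt A \<bullet> f)) (IFA (INSrc a) \<bullet> f)"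
    "f \<in> Ar E \<Longrightarrow> Cod E f = IAr A \<Longrightarrow> icat.cp E B (IFA (INTgt a) \<bullet> f) (INMap a \<bullet> (ISrc A \<bullet> f))"
    "f \<in> Ar E \<Longrightarrow> Cod E f = IAr A \<Longrightarrow> icat.cp E B (INMap a \<bullet> (ITgt A \<bullet> f)) (IFA (INSrc a) \<bullet> f)"
proof -
  interpret A: icat E A by (rule icat) fact
  interpret B: icat E B by (rule icat) fact
  show 1: "is_ifunc E A B (INSrc a)" "is_ifunc E A B (INTgt a)" "INMap a \<in> Ar E" "Dom E (INMap a) = IOb A" "Cod E (INMap a) = IAr B"
    "ISrc B \<bullet> INMap a = IFO (INSrc a)" "ITgt B \<bullet> INMap a = IFO (INTgt a)" using assms(3) by (auto simp: is_intrans_def hom_iff)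
  note F = ifuncD[OF assms(1,2) 1(1)] and G = ifuncD[OF assms(1,2) 1(2)]
  have nat: "B.m (IFA (INTgt a)) (INMap a \<bullet> ISrc A) = B.m (INMap a \<bullet> ITgt A) (IFA (INSrc a))" using assms(3) by (auto simp: is_intrans_def)
  have c: "B.cp (IFA (INTgt a)) (INMap a \<bullet> ISrc A)" "B.cp (INMap a \<bullet> ITgt A) (IFA (INSrc a))" 
    unfolding B.cp_def using 1(3-) F(1-9) G(1-9) A.A' B.A' by (auto simp: E.comp_assoc[symmetric])
  assume f: "f \<in> Ar E" "Cod E f = IAr A"
  show "B.m (IFA (INTgt a) \<bullet> f) (INMap a \<bullet> (ISrc A \<bullet> f)) = B.m (INMap a \<bullet> (ITgt A \<bullet> f)) (IFA (INSrc a) \<bullet> f)"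
    using arg_cong[OF nat, of "\<lambda>z. z \<bullet> f"] c[THEN B.m_comp, of f] f F(1-9) G(1-9) A.A' 1(3-) by (simp add: E.comp_assoc)
  show "B.cp (IFA (INTgt a) \<bullet> f) (INMap a \<bullet> (ISrc A \<bullet> f))" "B.cp (INMap a \<bullet> (ITgt A \<bullet> f)) (IFA (INSrc a) \<bullet> f)"
    using c[THEN B.cp_comp, of f] f F(1-9) G(1-9) A.A' 1(3-) by (simp_all add: E.comp_assoc)
qed

lemma (in pbcat) intransI:
  assumes "is_icat E A" "is_icat E B" 
    "is_ifunc E A B (INSrc a)" "is_ifunc E A B (INTgt a)" "INMap a \<in> Ar E" "Dom E (INMap a) = IOb A" "Cod E (INMap a) = IAr B"
    "ISrc B \<bullet> INMap a = IFO (INSrc a)" "ITgt B \<bullet> INMap a = IFO (INTgt a)"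
    "icomp E B (IFA (INTgt a)) (INMap a \<bullet> ISrc A) = icomp E B (INMap a \<bullet> ITgt A) (IFA (INSrc a))"
  shows "is_intrans E A B a"
  using assms by (auto simp: is_intrans_def hom_iff)

lemma (in pbcat) iid:
  assumes "is_icat E A" "is_icat E B" and F: "is_ifunc E A B F"
  shows "is_intrans E A B \<lparr>INSrc = F, INTgt = F, INMap = IId B \<bullet> IFO F\<rparr>"
proof -
  interpret A: icat E A by (rule icat) fact
  interpret B: icat E B by (rule icat) fact
  note F' = ifuncD[OF assms(1,2) F]
  have "B.m (IFA F) (IId B \<bullet> IFO F \<bullet> ISrc A) = B.m (IId B \<bullet> IFO F \<bullet> ITgt A) (IFA F)"
    using B.m_unit[OF F'(4,6)] F'(1-9) A.A' B.A' by (simp add: E.comp_assoc)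
  moreover have "ISrc B \<bullet> (IId B \<bullet> IFO F) = IFO F" "ITgt B \<bullet> (IId B \<bullet> IFO F) = IFO F"
    using F'(1-9) A.A' B.A' by (auto simp: E.comp_assoc[symmetric] E.id_l)
  ultimately show ?thesis by (intro intransI) (use assms F'(1-9) A.A' B.A' in auto)
qed

lemma (in pbcat) vc:
  assumes "is_icat E A" "is_icat E B" and a: "is_intrans E A B a" "is_intrans E A B b" "INSrc b = INTgt a"
  shows "is_intrans E A B \<lparr>INSrc = INSrc a, INTgt = INTgt b, INMap = icomp E B (INMap b) (INMap a)\<rparr>" (is ?t1) "icat.cp E B (INMap b) (INMap a)"
proof -
  interpret A: icat E A by (rule icat) fact
  interpret B: icat E B by (rule icat) fact
  note b = intransD[OF assms(1,2) a(2)] note a' = intransD[OF assms(1,2) a(1)]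
  note F = ifuncD[OF assms(1,2) a'(1)] note G = ifuncD[OF assms(1,2) a'(2)] note H = ifuncD[OF assms(1,2) b(2)]
  have c: "B.cp (INMap b) (INMap a)" using a' b a(3) unfolding B.cp_def by auto
  note mc = B.m_comp[OF c] B.m_ar[OF c] B.cp_comp[OF c]
  have [simp]: "IFA (INTgt b) \<in> Ar E" "Cod E (IFA (INTgt b)) = IAr B" using H by auto
  let ?s = "ISrc A" and ?t = "ITgt A"
  have X: "f \<bullet> Ide E (IAr A) = f" if "f \<in> Ar E" "Dom E f = IAr A" for f using that by (rule E.id_r)
  have n: "B.m (IFA (INTgt b)) (INMap b \<bullet> ?s) = B.m (INMap b \<bullet> ?t) (IFA (INTgt a))" "B.cp (IFA (INTgt b)) (INMap b \<bullet> ?s)" "B.cp (INMap b \<bullet> ?t) (IFA (INTgt a))"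
    "B.m (IFA (INTgt a)) (INMap a \<bullet> ?s) = B.m (INMap a \<bullet> ?t) (IFA (INSrc a))" "B.cp (IFA (INTgt a)) (INMap a \<bullet> ?s)" "B.cp (INMap a \<bullet> ?t) (IFA (INSrc a))"
    using b(8-10)[of "Ide E (IAr A)"] a'(8-10)[of "Ide E (IAr A)"] F(4-6) G(4-6) H(4-6) A.A' a(3) by (auto simp: X)
  have s: "B.m (INMap b) (INMap a) \<bullet> ?s = B.m (INMap b \<bullet> ?s) (INMap a \<bullet> ?s)" "B.m (INMap b) (INMap a) \<bullet> ?t = B.m (INMap b \<bullet> ?t) (INMap a \<bullet> ?t)"
    "B.cp (INMap b \<bullet> ?s) (INMap a \<bullet> ?s)" "B.cp (INMap b \<bullet> ?t) (INMap a \<bullet> ?t)" using mc(1,7) A.A' a'(1-7) by auto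
  have "B.m (IFA (INTgt b)) (B.m (INMap b) (INMap a) \<bullet> ?s) = B.m (B.m (INMap b) (INMap a) \<bullet> ?t) (IFA (INSrc a))"
    by (simp add: s B.m_assoc[OF n(2) s(3), symmetric] n(1)) (simp add: B.m_assoc n s)
  then show ?t1 by (intro intransI) (use a'(1-7) b(1-7) mc assms in auto)
  show "B.cp (INMap b) (INMap a)" by fact
qed

lemma (in pbcat) category_ifunc_cat:
  assumes "is_icat E A" "is_icat E B" shows "category (ifunc_cat E A B)"
proof -
  interpret A: icat E A by (rule icat) fact
  interpret B: icat E B by (rule icat) fact
  note D = intransD[OF assms]
  show ?thesis
  proof (rule category.intro, goal_cases)
    case (1 f) then show ?case using D by (auto simp: ifunc_cat_def)
  next
    case (2 f) then show ?case using D by (auto simp: ifunc_cat_def)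
  next
    case (3 f) then show ?case using iid[OF assms] by (auto simp: ifunc_cat_def hom_iff)
  next
    case (4 f) then show ?case using vc[OF assms] by (auto simp: ifunc_cat_def hom_iff)
  next
    case (5 f F G) then have f: "is_intrans E A B f" "G = INTgt f" by (auto simp: ifunc_cat_def hom_iff)
    show ?case using f B.m_unit(1)[of "INMap f"] D(1-7)[OF f(1)] by (cases f) (auto simp: ifunc_cat_def)
  next
    case (6 f F G) then have f: "is_intrans E A B f" "F = INSrc f" by (auto simp: ifunc_cat_def hom_iff)
    show ?case using f B.m_unit(2)[of "INMap f"] D(1-7)[OF f(1)] by (cases f) (auto simp: ifunc_cat_def)
  next
    case (7 f w x g y h z) then have f: "is_intrans E A B f" "is_intrans E A B g" "is_intrans E A B h" "INSrc g = INTgt f" "INSrc h = INTgt g" by (auto simp: ifunc_cat_def hom_iff)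
    show ?case using B.m_assoc[OF vc(2)[OF assms f(2,3,5)] vc(2)[OF assms f(1,2,4)]] by (auto simp: ifunc_cat_def hom_iff)
  qed
qed

lemma (in pbcat) hc:
  assumes cat: "is_icat E A" "is_icat E B" "is_icat E C" and a: "is_intrans E A B a" and b: "is_intrans E B C b"
  shows "is_intrans E A C (intrans_hcomp E C b a)" "icat.cp E C (INMap b \<bullet> IFO (INTgt a)) (IFA (INSrc b) \<bullet> INMap a)"
proof -
  interpret A: icat E A by (rule icat) fact
  interpret B: icat E B by (rule icat) fact
  interpret C: icat E C by (rule icat) fact
  note b' = intransD[OF cat(2,3) b] note a' = intransD[OF cat(1,2) a]
  note F = ifuncD[OF cat(1,2) a'(1)] note G = ifuncD[OF cat(1,2) a'(2)] note H = ifuncD[OF cat(2,3) b'(1)] note K = ifuncD[OF cat(2,3) b'(2)]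
  have c: "C.cp (INMap b \<bullet> IFO (INTgt a)) (IFA (INSrc b) \<bullet> INMap a)" 
    using a'(3,4,5) b'(10)[of "INMap a"] by (simp add: a'(7))
  let ?x = "INMap b \<bullet> IFO (INTgt a)" and ?y = "IFA (INSrc b) \<bullet> INMap a" let ?s = "ISrc A" and ?t = "ITgt A"
  note ar = a'(3-7) b'(3-7) F(1-9) G(1-9) H(1-9) K(1-9) A.A' B.A' C.A'
  have X: "f \<bullet> Ide E (IAr A) = f" if "f \<in> Ar E" "Dom E f = IAr A" for f using that by (rule E.id_r)
  have na: "B.m (IFA (INTgt a)) (INMap a \<bullet> ?s) = B.m (INMap a \<bullet> ?t) (IFA (INSrc a))" "B.cp (IFA (INTgt a)) (INMap a \<bullet> ?s)" "B.cp (INMap a \<bullet> ?t) (IFA (INSrc a))"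
    using a'(8-10)[of "Ide E (IAr A)"] F(4-6) G(4-6) A.A' by (auto simp: X)
  have nb: "C.m (IFA (INTgt b) \<bullet> IFA (INTgt a)) (INMap b \<bullet> (IFO (INTgt a) \<bullet> ?s)) = C.m (INMap b \<bullet> (IFO (INTgt a) \<bullet> ?t)) (IFA (INSrc b) \<bullet> IFA (INTgt a))"
    "C.cp (IFA (INTgt b) \<bullet> IFA (INTgt a)) (INMap b \<bullet> (IFO (INTgt a) \<bullet> ?s))"
    "C.cp (INMap b \<bullet> (IFO (INTgt a) \<bullet> ?t)) (IFA (INSrc b) \<bullet> IFA (INTgt a))"
    using b'(8-10)[of "IFA (INTgt a)"] G(4-8) by auto
  have hh: "C.m (IFA (INSrc b) \<bullet> IFA (INTgt a)) (IFA (INSrc b) \<bullet> INMap a \<bullet> ?s) = C.m (IFA (INSrc b) \<bullet> INMap a \<bullet> ?t) (IFA (INSrc b) \<bullet> IFA (INSrc a))"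
    "C.cp (IFA (INSrc b) \<bullet> IFA (INTgt a)) (IFA (INSrc b) \<bullet> INMap a \<bullet> ?s)" "C.cp (IFA (INSrc b) \<bullet> INMap a \<bullet> ?t) (IFA (INSrc b) \<bullet> IFA (INSrc a))"
    using arg_cong[OF na(1), of "\<lambda>z. IFA (INSrc b) \<bullet> z"] H(10,11)[OF na(2)] H(10,11)[OF na(3)] ar by (auto simp: E.comp_assoc)
  have xs: "C.m ?x ?y \<bullet> ?s = C.m (?x \<bullet> ?s) (?y \<bullet> ?s)" "C.m ?x ?y \<bullet> ?t = C.m (?x \<bullet> ?t) (?y \<bullet> ?t)" "C.cp (?x \<bullet> ?s) (?y \<bullet> ?s)" "C.cp (?x \<bullet> ?t) (?y \<bullet> ?t)"
    using C.m_comp[OF c] C.cp_comp[OF c] ar by auto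
  have e: "INMap b \<bullet> (IFO (INTgt a) \<bullet> ?s) = ?x \<bullet> ?s" "INMap b \<bullet> (IFO (INTgt a) \<bullet> ?t) = ?x \<bullet> ?t" using ar by (auto simp: E.comp_assoc)
  have nat: "C.m (IFA (INTgt b) \<bullet> IFA (INTgt a)) (C.m ?x ?y \<bullet> ?s) = C.m (C.m ?x ?y \<bullet> ?t) (IFA (INSrc b) \<bullet> IFA (INSrc a))"
    using nb hh xs unfolding e by (metis C.m_assoc)
  have st: "ISrc C \<bullet> ?y = IFO (INSrc b) \<bullet> IFO (INSrc a)" "ITgt C \<bullet> ?x = IFO (INTgt b) \<bullet> IFO (INTgt a)"
    using ar by (metis E.comp_assoc)+
  show "is_intrans E A C (intrans_hcomp E C b a)"
    by (intro intransI) (use C.m_ar[OF c] nat st ifunc_comp[OF cat a'(1) b'(1)] ifunc_comp[OF cat a'(2) b'(2)] cat ar in \<open>auto simp: intrans_hcomp_def ifunc_comp_def\<close>)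
  show "icat.cp E C (INMap b \<bullet> IFO (INTgt a)) (IFA (INSrc b) \<bullet> INMap a)" by fact
qed


lemma (in pbcat) ichange:
  assumes cat: "is_icat E A" "is_icat E B" "is_icat E C" and i: "is_intrans E A B a" "is_intrans E B C b"
     "is_intrans E A B a'" "is_intrans E B C b'" "INSrc a' = INTgt a" "INSrc b' = INTgt b"
  shows "icomp E C (icomp E C (INMap b') (INMap b) \<bullet> IFO (INTgt a')) (IFA (INSrc b) \<bullet> icomp E B (INMap a') (INMap a)) =
     icomp E C (icomp E C (INMap b' \<bullet> IFO (INTgt a')) (IFA (INSrc b') \<bullet> INMap a')) (icomp E C (INMap b \<bullet> IFO (INTgt a)) (IFA (INSrc b) \<bullet> INMap a))"
proof -
  interpret A: icat E A by (rule icat) fact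
  interpret B: icat E B by (rule icat) fact
  interpret C: icat E C by (rule icat) fact
  note b = intransD[OF cat(2,3) i(2)] note a = intransD[OF cat(1,2) i(1)]
  note b' = intransD[OF cat(2,3) i(4)] note a' = intransD[OF cat(1,2) i(3)]
  note H = ifuncD[OF cat(2,3) b(1)] note G' = ifuncD[OF cat(1,2) a'(2)] 
  note v = vc(2)[OF cat(1,2) i(1,3,5)] vc(2)[OF cat(2,3) i(2,4,6)]
  note h = hc(2)[OF cat i(1,2)] hc(2)[OF cat i(3,4)] hc(2)[OF cat i(3,2)]
  have 1: "C.m (INMap b') (INMap b) \<bullet> IFO (INTgt a') = C.m (INMap b' \<bullet> IFO (INTgt a')) (INMap b \<bullet> IFO (INTgt a'))"
    "C.cp (INMap b' \<bullet> IFO (INTgt a')) (INMap b \<bullet> IFO (INTgt a'))"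
    using C.m_comp[OF v(2)] C.cp_comp[OF v(2)] G'(1-3) b(3-5) by auto
  note 2 = H(10)[OF v(1)] H(11)[OF v(1)]
  have 3: "C.m (IFA (INSrc b') \<bullet> INMap a') (INMap b \<bullet> IFO (INTgt a)) = C.m (INMap b \<bullet> IFO (INTgt a')) (IFA (INSrc b) \<bullet> INMap a')"
    "C.cp (IFA (INSrc b') \<bullet> INMap a') (INMap b \<bullet> IFO (INTgt a))"
    using b(8,9)[of "INMap a'"] a'(3-7) i(5,6) by auto
  have cpm: "C.cp g (C.m f e)" if "C.cp g f" "C.cp f e" for g f e
    using that C.m_ar[OF that(2)] by (auto simp: C.cp_def)
  note as = C.m_assoc
  let ?x = "INMap b' \<bullet> IFO (INTgt a')" and ?y = "INMap b \<bullet> IFO (INTgt a')" and ?z = "IFA (INSrc b) \<bullet> INMap a'"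
    and ?u = "IFA (INSrc b) \<bullet> INMap a" and ?k = "IFA (INSrc b') \<bullet> INMap a'" and ?w = "INMap b \<bullet> IFO (INTgt a)"
  have "C.m (C.m ?x ?y) (C.m ?z ?u) = C.m ?x (C.m ?y (C.m ?z ?u))" by (rule as[OF 1(2) cpm[OF h(3) 2(2)]])
  also have "C.m ?y (C.m ?z ?u) = C.m (C.m ?y ?z) ?u" by (rule as[OF h(3) 2(2), symmetric])
  also have "\<dots> = C.m (C.m ?k ?w) ?u" unfolding 3(1) ..
  also have "\<dots> = C.m ?k (C.m ?w ?u)" by (rule as[OF 3(2) h(1)])
  also have "C.m ?x \<dots> = C.m (C.m ?x ?k) (C.m ?w ?u)" by (rule as[OF h(2) cpm[OF 3(2) h(1)], symmetric])
  finally show ?thesis unfolding 1(1) 2(1) .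
qed

lemma (in pbcat) ifc_id: assumes "is_icat E A" shows "is_ifunc E A A \<lparr>IFO = Ide E (IOb A), IFA = Ide E (IAr A)\<rparr>"
proof -
  interpret A: icat E A by (rule icat) fact
  show ?thesis by (intro ifuncI) (use assms A.A' A.m_ar in \<open>auto simp: E.id_l E.id_r A.cp_def\<close>)
qed

lemma (in pbcat) two_category_Cat_internal: "two_category (Cat_internal E)"
proof (rule two_category.intro, goal_cases)
  case (1 A B) then show ?case by (auto simp: Cat_internal_def category_ifunc_cat)
next
  case (2 A) then show ?case by (auto simp: Cat_internal_def ifunc_cat_def ifc_id)
next
  case (3 A B C)
  then have c: "is_icat E A" "is_icat E B" "is_icat E C" by (auto simp: Cat_internal_def)
  interpret C: icat E C by (rule icat) fact
  interpret B: icat E B by (rule icat) fact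
  show ?case
  proof (rule functorI, goal_cases)
    case (1 x) then show ?case using ifunc_comp[OF c] by (auto simp: Cat_internal_def ifunc_cat_def prod_cat_def)
  next
    case (2 f) then show ?case using hc(1)[OF c] by (auto simp: Cat_internal_def ifunc_cat_def prod_cat_def)
  next
    case (3 f) then show ?case by (auto simp: Cat_internal_def ifunc_cat_def prod_cat_def intrans_hcomp_def is_intrans_def)
  next
    case (4 f) then show ?case by (auto simp: Cat_internal_def ifunc_cat_def prod_cat_def intrans_hcomp_def is_intrans_def)
  next
    case (5 x)
    then obtain G F where x: "x = (G,F)" "is_ifunc E B C G" "is_ifunc E A B F" by (auto simp: Cat_internal_def ifunc_cat_def prod_cat_def)
    note G = ifuncD[OF c(2,3) x(2)] and F = ifuncD[OF c(1,2) x(3)]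
    have "IFA G \<bullet> (IId B \<bullet> IFO F) = IId C \<bullet> (IFO G \<bullet> IFO F)" using F(1-6) G(1-9) B.A' C.A' by (metis E.comp_assoc)
    moreover have "ITgt C \<bullet> (IId C \<bullet> (IFO G \<bullet> IFO F)) = IFO G \<bullet> IFO F" using F(1-6) G(1-6) C.A' by (simp add: E.comp_assoc[symmetric] E.id_l)
    ultimately have "C.m (IId C \<bullet> IFO G \<bullet> IFO F) (IFA G \<bullet> (IId B \<bullet> IFO F)) = IId C \<bullet> (IFO G \<bullet> IFO F)"
      using C.m_unit(1)[of "IId C \<bullet> (IFO G \<bullet> IFO F)"] F(1-6) G(1-6) C.A' by (simp add: E.comp_assoc)
    then show ?case using x iid[OF c(2,3) x(2)] iid[OF c(1,2) x(3)] by (auto simp: Cat_internal_def ifunc_cat_def prod_cat_def intrans_hcomp_def ifunc_comp_def)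
  next
    case (6 f g)
    then show ?case using ichange[OF c] vc(1)[OF c(1,2)] vc(1)[OF c(2,3)] by (auto simp: Cat_internal_def ifunc_cat_def prod_cat_def intrans_hcomp_def)
  qed (auto simp: Cat_internal_def)
next
  case (4 A B f)
  then have f: "is_ifunc E A B f" and c: "is_icat E A" "is_icat E B" by (auto simp: Cat_internal_def ifunc_cat_def)
  then show ?case using ifuncD(1-6)[OF c f] ifc_id[OF c(2)] by (cases f) (auto simp: Cat_internal_def ifunc_cat_def prod_cat_def ifunc_comp_def E.id_l)
next
  case (5 A B a)
  then have f: "is_intrans E A B a" and c: "is_icat E A" "is_icat E B" by (auto simp: Cat_internal_def ifunc_cat_def)
  interpret B: icat E B by (rule icat) fact
  note a = intransD[OF c f] note F = ifuncD(1-6)[OF c a(1)] note G = ifuncD(1-6)[OF c a(2)]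
  have "B.m (IId B \<bullet> IFO (INTgt a)) (INMap a) = INMap a" using B.m_unit(1)[of "INMap a"] a by simp
  then show ?case using f ifc_id[OF c(2)] iid[OF c(2,2) ifc_id[OF c(2)]] a(3-7) F G B.A'
    by (cases a; cases "INSrc a"; cases "INTgt a") (auto simp: Id2_def Cat_internal_def ifunc_cat_def prod_cat_def intrans_hcomp_def ifunc_comp_def E.id_l E.id_r)
next
  case (6 A B f)
  then have f: "is_ifunc E A B f" and c: "is_icat E A" "is_icat E B" by (auto simp: Cat_internal_def ifunc_cat_def)
  then show ?case using ifuncD(1-6)[OF c f] ifc_id[OF c(1)] by (cases f) (auto simp: Cat_internal_def ifunc_cat_def prod_cat_def ifunc_comp_def E.id_r)
next
  case (7 A B a)
  then have f: "is_intrans E A B a" and c: "is_icat E A" "is_icat E B" by (auto simp: Cat_internal_def ifunc_cat_def)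
  interpret B: icat E B by (rule icat) fact
  interpret A: icat E A by (rule icat) fact
  note a = intransD[OF c f] note F = ifuncD[OF c a(1)] note G = ifuncD(1-6)[OF c a(2)]
  have "B.m (INMap a) (IFA (INSrc a) \<bullet> IId A) = INMap a" using B.m_unit(2)[of "INMap a"] a F(9) by simp
  then show ?case using f ifc_id[OF c(1)] iid[OF c(1,1) ifc_id[OF c(1)]] a(3-7) F(1-6) G A.A'
    by (cases a; cases "INSrc a"; cases "INTgt a") (auto simp: Id2_def Cat_internal_def ifunc_cat_def prod_cat_def intrans_hcomp_def ifunc_comp_def E.id_l E.id_r)
next
  case (8 A B C D f g h)
  then have f: "is_ifunc E A B f" "is_ifunc E B C g" "is_ifunc E C D h" and c: "is_icat E A" "is_icat E B" "is_icat E C" "is_icat E D" by (auto simp: Cat_internal_def ifunc_cat_def)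
  show ?case using f ifuncD(1-6)[OF c(1,2) f(1)] ifuncD(1-6)[OF c(2,3) f(2)] ifuncD(1-6)[OF c(3,4) f(3)] ifunc_comp[OF c(1-3) f(1,2)] ifunc_comp[OF c(2-4) f(2,3)]
    by (auto simp: Cat_internal_def ifunc_cat_def prod_cat_def) (auto simp: ifunc_comp_def E.comp_assoc)
next
  case (9 A B C D a b d)
  then have f: "is_intrans E A B a" "is_intrans E B C b" "is_intrans E C D d" and c: "is_icat E A" "is_icat E B" "is_icat E C" "is_icat E D" by (auto simp: Cat_internal_def ifunc_cat_def)
  interpret D: icat E D by (rule icat) fact
  note a = intransD[OF c(1,2) f(1)] and b = intransD[OF c(2,3) f(2)] and d = intransD[OF c(3,4) f(3)]
  note F = ifuncD(1-6)[OF c(1,2) a(1)] ifuncD(1-6)[OF c(1,2) a(2)] ifuncD(1-6)[OF c(2,3) b(1)] ifuncD(1-6)[OF c(2,3) b(2)] ifuncD(1-6)[OF c(3,4) d(1)] ifuncD(1-6)[OF c(3,4) d(2)]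
  note h1 = hc[OF c(1,2,3) f(1,2)] and h2 = hc[OF c(2,3,4) f(2,3)] 
  note H = ifuncD(10,11)[OF c(3,4) d(1) h1(2)]
  have X: "D.m (INMap d \<bullet> IFO (INTgt b)) (IFA (INSrc d) \<bullet> INMap b) \<bullet> IFO (INTgt a) =
     D.m (INMap d \<bullet> IFO (INTgt b) \<bullet> IFO (INTgt a)) (IFA (INSrc d) \<bullet> INMap b \<bullet> IFO (INTgt a))" 
    "D.cp (INMap d \<bullet> IFO (INTgt b) \<bullet> IFO (INTgt a)) (IFA (INSrc d) \<bullet> INMap b \<bullet> IFO (INTgt a))" 
    using D.m_comp[OF h2(2)] D.cp_comp[OF h2(2)] F a(3-7) b(3-7) d(3-7) by auto
  have Y: "D.m (D.m (INMap d \<bullet> IFO (INTgt b) \<bullet> IFO (INTgt a)) (IFA (INSrc d) \<bullet> INMap b \<bullet> IFO (INTgt a))) (IFA (INSrc d) \<bullet> (IFA (INSrc b) \<bullet> INMap a)) =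
    D.m (INMap d \<bullet> IFO (INTgt b) \<bullet> IFO (INTgt a)) (D.m (IFA (INSrc d) \<bullet> INMap b \<bullet> IFO (INTgt a)) (IFA (INSrc d) \<bullet> (IFA (INSrc b) \<bullet> INMap a)))"
    by (rule D.m_assoc[OF X(2)]) (use H(2) F a(3-7) b(3-7) d(3-7) in \<open>simp add: E.comp_assoc\<close>)
  have "intrans_hcomp E D (intrans_hcomp E D d b) a = intrans_hcomp E D d (intrans_hcomp E C b a)"
    using X Y H F a(3-7) b(3-7) d(3-7) by (simp add: intrans_hcomp_def ifunc_comp_def E.comp_assoc)
  then show ?case using f h1 h2 by (auto simp: Cat_internal_def ifunc_cat_def prod_cat_def)
qed

end

(*
Let disc X be the discrete internal category on X.

If T is 2-terminal in Cat(E), maps X -> T_0 correspond to functors disc X -> T, so T_0 is terminal.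
If f, g : X -> Y agree on points T_0 -> X, then Cat(E)(T, -) identifies disc f and disc g; by the
natural isomorphism that defines the copower P, so does Cat(E)(P, -), hence disc f = disc g.

Conversely, extensivity makes the internal walking arrow, with 1 + 1 objects and 1 + (1 + 1) arrows,
an internal category: composites are defined by cases on the arrow applied first. A functor out of it
is an arrow 1 -> A_1, and a natural transformation between two such functors is a commutative
square, so it is the copower of the walking arrow and the terminal category. As every point of A_1
arises from a functor out of it, well-pointedness of E gives faithfulness on 1-cells and 2-cells.
*)

theory Submission
  imports Defs
begin

section \<open>Functors and equivalences\<close>

text \<open>Composable pairs of the walking arrow form a pullback that is not given as a coproduct,
  so composition cannot be written down as a copairing. Two consequences of the equivalence E/A x
  E/B -> E/(A+B) get around this. Essential surjectivity splits the domain of any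
  \<open>h : Z -> A + B\<close> into a part over \<open>A\<close> and a part over \<open>B\<close>,
  and fullness makes the two injections disjoint. Together they allow proof and definition by cases
  on \<open>h\<close> for generalised elements, and composition is defined by splitting the pullback
  along its second projection. One case distinction suffices: after the non-identity arrow only an
  identity can follow, so the composite is always one of the two factors. The copower isomorphism is
  obtained from a universal 2-cell, as in the Yoneda lemma; for the walking arrow this 2-cell is the
  generic arrow itself.\<close>

lemma (in category) iso_cancel_right:
  assumes "is_iso C e" "f \<in> Ar C" "g \<in> Ar C" "Dom C f = Cod C e" "Dom C g = Cod C e" "f \<cdot> e = g \<cdot> e"
  shows "f = g"
proof -
  obtain d where e: "e \<in> Ar C" and d: "d \<in> Ar C" "Dom C d = Cod C e" "Cod C d = Dom C e"
      "e \<cdot> d = Ide C (Cod C e)"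
    using assms(1) by (auto simp: is_iso_def hom_iff)
  have "f = f \<cdot> (e \<cdot> d)" using assms(2,4) e d by (simp add: id_r)
  also have "\<dots> = g \<cdot> (e \<cdot> d)" using assms e d by (metis comp_assoc)
  also have "\<dots> = g" using assms(3,5) e d by (simp add: id_r)
  finally show ?thesis .
qed

lemma is_iso_functorI:
  assumes "category C" "category D" and F: "is_functor C D F"
    and O: "bij_betw (FO F) (Ob C) (Ob D)" and A: "bij_betw (FA F) (Ar C) (Ar D)"
  shows "is_iso_functor C D F"
proof -
  interpret C: category C by fact
  interpret D: category D by fact
  note f = functorD[OF F]
  let ?o = "inv_into (Ob C) (FO F)" and ?a = "inv_into (Ar C) (FA F)"
  let ?G = "\<lparr>FO = restrict ?o (Ob D), FA = restrict ?a (Ar D)\<rparr>"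
  have o1: "?o y \<in> Ob C" "FO F (?o y) = y" if "y \<in> Ob D" for y
    using that O by (auto simp: bij_betw_def f_inv_into_f intro: inv_into_into)
  have o2: "?o (FO F x) = x" if "x \<in> Ob C" for x
    using that O by (auto simp: bij_betw_def)
  have a1: "?a y \<in> Ar C" "FA F (?a y) = y" if "y \<in> Ar D" for y
    using that A by (auto simp: bij_betw_def f_inv_into_f intro: inv_into_into)
  have a2: "?a (FA F x) = x" if "x \<in> Ar C" for x
    using that A by (auto simp: bij_betw_def)
  have da: "Dom C (?a g) = ?o (Dom D g)" "Cod C (?a g) = ?o (Cod D g)" if "g \<in> Ar D" for g
    using f(3,4)[of "?a g"] a1[OF that] o2[of "Dom C (?a g)"] o2[of "Cod C (?a g)"] by auto
  have "is_functor D C ?G"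
  proof (rule functorI, goal_cases)
    case (5 y)
    then have "FA F (Ide C (?o y)) = Ide D y" using f(5) o1 by simp
    with 5 show ?case using a2[of "Ide C (?o y)"] o1 by simp
  next
    case (6 g h)
    then have "FA F (?a h \<cdot>\<^bsub>C\<^esub> ?a g) = h \<cdot>\<^bsub>D\<^esub> g" using f(6) a1 da by simp
    with 6 show ?case using a2[of "?a h \<cdot>\<^bsub>C\<^esub> ?a g"] a1 da by simp
  qed (use o1 a1 da in auto)
  moreover have "func_comp C ?G F = func_id C" "func_comp D F ?G = func_id D"
    using o1 a1 o2 a2 f(1,2) by (auto simp: func_comp_def func_id_def intro!: restrict_ext)
  ultimately show ?thesis using F by (auto simp: is_iso_functor_def)
qed

text \<open>With \<alpha> the unit, \<beta> the counit and G the quasi-inverse, take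
  \<open>r\<close> to be the inverse of \<alpha> at \<open>y\<close>, after G s, after \<alpha> at
  \<open>x\<close>. Naturality of \<alpha> gives G (F r) = G s, and naturality of \<beta> then gives
  F r = s after composition with the invertible component of \<beta> at F x.\<close>

lemma equivalence_full:
  assumes "category C" "category D" and F: "is_equivalence C D F"
    and xy: "x \<in> Ob C" "y \<in> Ob C"
    and s: "s \<in> Ar D" "Dom D s = FO F x" "Cod D s = FO F y"
  shows "\<exists>r. r \<in> Ar C \<and> Dom C r = x \<and> Cod C r = y \<and> FA F r = s"
proof -
  interpret C: category C by fact
  interpret D: category D by fact
  obtain G \<alpha> \<beta> where F: "is_functor C D F" and G: "is_functor D C G"
    and a: "is_ntrans C C \<alpha>" "NSrc \<alpha> = func_id C" "NTgt \<alpha> = func_comp C G F" "\<And>x. x \<in> Ob C \<Longrightarrow> is_iso C (NMap \<alpha> x)"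
    and b: "is_ntrans D D \<beta>" "NSrc \<beta> = func_comp D F G" "NTgt \<beta> = func_id D" "\<And>x. x \<in> Ob D \<Longrightarrow> is_iso D (NMap \<beta> x)"
    using F unfolding is_equivalence_def naturally_isomorphic_def by blast
  note f = functorD[OF F] and g = functorD[OF G]
  have a': "NMap \<alpha> z \<in> Ar C" "Dom C (NMap \<alpha> z) = z" "Cod C (NMap \<alpha> z) = FO G (FO F z)" if "z \<in> Ob C" for z
    using ntransD(4-6)[OF a(1)] a that by (auto simp: func_id_def func_comp_def)
  have b': "NMap \<beta> z \<in> Ar D" "Dom D (NMap \<beta> z) = FO F (FO G z)" "Cod D (NMap \<beta> z) = z" if "z \<in> Ob D" for z
    using ntransD(4-6)[OF b(1)] b that by (auto simp: func_id_def func_comp_def)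
  have an: "FA G (FA F k) \<cdot>\<^bsub>C\<^esub> NMap \<alpha> (Dom C k) = NMap \<alpha> (Cod C k) \<cdot>\<^bsub>C\<^esub> k" if "k \<in> Ar C" for k
    using ntransD(7)[OF a(1) that] a that by (auto simp: func_id_def func_comp_def)
  have bn: "k \<cdot>\<^bsub>D\<^esub> NMap \<beta> (Dom D k) = NMap \<beta> (Cod D k) \<cdot>\<^bsub>D\<^esub> FA F (FA G k)" if "k \<in> Ar D" for k
    using ntransD(7)[OF b(1) that] b that by (auto simp: func_id_def func_comp_def)
  obtain d where d: "d \<in> Ar C" "Dom C d = FO G (FO F y)" "Cod C d = y" "NMap \<alpha> y \<cdot>\<^bsub>C\<^esub> d = Ide C (FO G (FO F y))"
    using a(4)[OF xy(2)] a'[OF xy(2)] by (auto simp: is_iso_def hom_iff)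
  define r where "r = d \<cdot>\<^bsub>C\<^esub> (FA G s \<cdot>\<^bsub>C\<^esub> NMap \<alpha> x)"
  have gs: "FA G s \<in> Ar C" "Dom C (FA G s) = FO G (FO F x)" "Cod C (FA G s) = FO G (FO F y)" using g(2-4)[OF s(1)] s by auto
  have r: "r \<in> Ar C" "Dom C r = x" "Cod C r = y" unfolding r_def using d(1-3) gs a'[OF xy(1)] by auto
  have "NMap \<alpha> y \<cdot>\<^bsub>C\<^esub> r = (NMap \<alpha> y \<cdot>\<^bsub>C\<^esub> d) \<cdot>\<^bsub>C\<^esub> (FA G s \<cdot>\<^bsub>C\<^esub> NMap \<alpha> x)"
    unfolding r_def by (rule C.comp_assoc[symmetric]) (use d(1-3) gs a'[OF xy(1)] a'[OF xy(2)] in auto)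
  also have "\<dots> = FA G s \<cdot>\<^bsub>C\<^esub> NMap \<alpha> x" unfolding d(4) by (rule C.id_l) (use gs a'[OF xy(1)] in auto)
  finally have *: "FA G (FA F r) \<cdot>\<^bsub>C\<^esub> NMap \<alpha> x = FA G s \<cdot>\<^bsub>C\<^esub> NMap \<alpha> x" using an[OF r(1)] r by simp
  have fr: "FA F r \<in> Ar D" "Dom D (FA F r) = FO F x" "Cod D (FA F r) = FO F y" using f(2-4)[OF r(1)] r by auto
  have "FA G (FA F r) = FA G s"
    by (rule C.iso_cancel_right[OF a(4)[OF xy(1)] _ _ _ _ *]) (use g(2-4)[OF fr(1)] fr gs a'[OF xy(1)] in auto)
  with bn[OF fr(1)] bn[OF s(1)] fr s
  have **: "FA F r \<cdot>\<^bsub>D\<^esub> NMap \<beta> (FO F x) = s \<cdot>\<^bsub>D\<^esub> NMap \<beta> (FO F x)" by simp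
  have x: "FO F x \<in> Ob D" using f xy by auto
  have "FA F r = s"
    by (rule D.iso_cancel_right[OF b(4)[OF x] _ _ _ _ **]) (use fr s b'[OF x] in auto)
  with r show ?thesis by blast
qed

lemma equivalence_ess_surj:
  assumes "is_equivalence C D F" "y \<in> Ob D"
  shows "\<exists>x e. x \<in> Ob C \<and> is_iso D e \<and> Dom D e = FO F x \<and> Cod D e = y"
proof -
  obtain G \<beta> where G: "is_functor D C G"
    and b: "is_ntrans D D \<beta>" "NSrc \<beta> = func_comp D F G" "NTgt \<beta> = func_id D" "\<And>x. x \<in> Ob D \<Longrightarrow> is_iso D (NMap \<beta> x)"
    using assms(1) unfolding is_equivalence_def naturally_isomorphic_def by blast
  show ?thesis
    using functorD(1)[OF G assms(2)] ntransD(5,6)[OF b(1) assms(2)] b(2-4) assms(2)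
    by (intro exI[of _ "FO G y"] exI[of _ "NMap \<beta> y"]) (auto simp: func_id_def func_comp_def)
qed

lemma (in category) category_slice: assumes "a \<in> Ob C" shows "category (slice_cat C a)"
proof -
  have ar: "(f, h, g) \<in> Ar (slice_cat C a) \<longleftrightarrow> f \<in> Ar C \<and> Cod C f = a \<and> g \<in> Ar C \<and> Cod C g = a \<and>
      h \<in> Ar C \<and> Dom C h = Dom C f \<and> Cod C h = Dom C g \<and> g \<cdot> h = f" for f h g
    by (auto simp: slice_cat_def hom_def)
  have op: "Dom (slice_cat C a) (f, h, g) = f" "Cod (slice_cat C a) (f, h, g) = g"
      "(f', h', g') \<cdot>\<^bsub>slice_cat C a\<^esub> (f, h, g) = (f, h' \<cdot> h, g')" "Ide (slice_cat C a) f = (f, Ide C (Dom C f), f)"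
      "f \<in> Ob (slice_cat C a) \<longleftrightarrow> f \<in> Ar C \<and> Cod C f = a" for f h g f' h' g'
    by (auto simp: slice_cat_def)
  have hm: "t \<in> hom (slice_cat C a) x y \<longleftrightarrow> (\<exists>h. t = (x, h, y) \<and> (x, h, y) \<in> Ar (slice_cat C a))" for t x y
    by (cases t) (auto simp: hom_def op)
  have cl: "(x, h, z) \<in> Ar (slice_cat C a)"
    if "(x, k, y) \<in> Ar (slice_cat C a)" "(y, l, z) \<in> Ar (slice_cat C a)" "h = l \<cdot> k" for x y z h k l
    using that unfolding ar by (metis comp_ar dom_comp cod_comp comp_assoc)
  show ?thesis
  proof (rule category.intro, goal_cases)
    case (1 f) then show ?case by (cases f) (simp add: ar op)
  next
    case (2 f) then show ?case by (cases f) (simp add: ar op)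
  next
    case (3 x) then show ?case by (simp add: hm ar op id_r)
  next
    case (4 f x y g z) then show ?case using cl unfolding hm by (force simp: op)
  next
    case (5 f x y) then show ?case unfolding hm op(4) by (elim exE conjE) (simp add: op ar id_l)
  next
    case (6 f x y) then show ?case unfolding hm op(4) by (elim exE conjE) (simp add: op ar id_r)
  next
    case (7 f w x g y h z) then show ?case unfolding hm by (elim exE conjE) (simp add: op ar comp_assoc)
  qed
qed

section \<open>Coproducts in extensive categories\<close>

context category
begin

lemma coproduct_eqI:
  assumes P: "is_binary_coproduct C A B P i j"
    and fg: "f \<in> Ar C" "g \<in> Ar C" "Dom C f = P" "Dom C g = P" "Cod C f = Cod C g"
    and e: "f \<cdot> i = g \<cdot> i" "f \<cdot> j = g \<cdot> j"
  shows "f = g"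
proof -
  have ij: "i \<in> Ar C" "Dom C i = A" "Cod C i = P" "j \<in> Ar C" "Dom C j = B" "Cod C j = P"
    using P by (auto simp: is_binary_coproduct_def hom_iff)
  have "\<exists>!u. u \<in> hom C P (Cod C f) \<and> u \<cdot> i = f \<cdot> i \<and> u \<cdot> j = f \<cdot> j"
    using P fg ij unfolding is_binary_coproduct_def by (auto simp: hom_iff)
  moreover have "f \<in> hom C P (Cod C f)" "g \<in> hom C P (Cod C f)" using fg by (auto simp: hom_iff)
  ultimately show ?thesis using e by metis
qed

lemma coproduct_copair:
  assumes P: "is_binary_coproduct C A B P i j"
    and "f \<in> Ar C" "Dom C f = A" "Cod C f = X" "g \<in> Ar C" "Dom C g = B" "Cod C g = X"
  obtains u where "u \<in> Ar C" "Dom C u = P" "Cod C u = X" "u \<cdot> i = f" "u \<cdot> j = g"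
proof -
  have "X \<in> Ob C" using assms by auto
  then have "\<exists>!u. u \<in> hom C P X \<and> u \<cdot> i = f \<and> u \<cdot> j = g"
    using assms unfolding is_binary_coproduct_def by (auto simp: hom_iff)
  then show ?thesis using that by (auto simp: hom_iff)
qed

lemma coproductD:
  assumes "is_binary_coproduct C A B P i j"
  shows "i \<in> Ar C" "Dom C i = A" "Cod C i = P" "j \<in> Ar C" "Dom C j = B" "Cod C j = P"
    "A \<in> Ob C" "B \<in> Ob C" "P \<in> Ob C"
proof -
  show *: "i \<in> Ar C" "Dom C i = A" "Cod C i = P" "j \<in> Ar C" "Dom C j = B" "Cod C j = P" "P \<in> Ob C"
    using assms by (auto simp: is_binary_coproduct_def hom_iff)
  show "A \<in> Ob C" "B \<in> Ob C" using *(1,2,4,5) by auto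
qed

lemma coproduct_chosen:
  assumes "has_finite_coproducts C" "A \<in> Ob C" "B \<in> Ob C"
  shows "is_binary_coproduct C A B (coprod_ob C A B) (coprod_i1 C A B) (coprod_i2 C A B)"
proof -
  let ?A = "\<lambda>n::nat. if n = 0 then A else B"
  have "\<forall>i<2. ?A i \<in> Ob C" using assms by simp
  then obtain P \<iota> where P: "is_coproduct C {..<2} ?A P \<iota>"
    using assms(1)[unfolded has_finite_coproducts_def, rule_format, of 2 ?A] by blast
  have two: "{..<2} = {0::nat, 1}" by auto
  have "is_binary_coproduct C A B P (\<iota> 0) (\<iota> 1)"
    unfolding is_binary_coproduct_def
  proof (intro conjI ballI)
    fix X f g assume X: "X \<in> Ob C" and fg: "f \<in> hom C A X" "g \<in> hom C B X"
    let ?h = "\<lambda>n::nat. if n = 0 then f else g"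
    have u: "\<forall>X \<in> Ob C. \<forall>f. (\<forall>i \<in> {0,1}. f i \<in> hom C (?A i) X) \<longrightarrow> (\<exists>!u. u \<in> hom C P X \<and> (\<forall>i \<in> {0,1}. u \<cdot> \<iota> i = f i))"
      using P unfolding is_coproduct_def two by blast
    have "\<exists>!u. u \<in> hom C P X \<and> (\<forall>i \<in> {0,1}. u \<cdot> \<iota> i = ?h i)"
      by (rule u[THEN bspec[OF _ X], THEN spec, of ?h, THEN mp]) (use fg in simp)
    then show "\<exists>!u. u \<in> hom C P X \<and> u \<cdot> \<iota> 0 = f \<and> u \<cdot> \<iota> 1 = g" by simp
  qed (use P in \<open>auto simp: is_coproduct_def two\<close>)
  then have "\<exists>x. case x of (P, i, j) \<Rightarrow> is_binary_coproduct C A B P i j" by auto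
  from someI_ex[OF this] show ?thesis
    by (auto simp: bin_coprod_def coprod_ob_def coprod_i1_def coprod_i2_def)
qed

lemma coprod_map:
  assumes "has_finite_coproducts C" "f \<in> Ar C" "g \<in> Ar C"
  shows "coprod_map C f g \<in> Ar C" "Dom C (coprod_map C f g) = coprod_ob C (Dom C f) (Dom C g)"
    "Cod C (coprod_map C f g) = coprod_ob C (Cod C f) (Cod C g)"
    "coprod_map C f g \<cdot> coprod_i1 C (Dom C f) (Dom C g) = coprod_i1 C (Cod C f) (Cod C g) \<cdot> f"
    "coprod_map C f g \<cdot> coprod_i2 C (Dom C f) (Dom C g) = coprod_i2 C (Cod C f) (Cod C g) \<cdot> g"
proof -
  let ?P = "\<lambda>w. w \<in> hom C (coprod_ob C (Dom C f) (Dom C g)) (coprod_ob C (Cod C f) (Cod C g)) \<and>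
     w \<cdot> coprod_i1 C (Dom C f) (Dom C g) = coprod_i1 C (Cod C f) (Cod C g) \<cdot> f \<and>
     w \<cdot> coprod_i2 C (Dom C f) (Dom C g) = coprod_i2 C (Cod C f) (Cod C g) \<cdot> g"
  note P = coproduct_chosen[OF assms(1), of "Dom C f" "Dom C g"]
  note Q = coproduct_chosen[OF assms(1), of "Cod C f" "Cod C g"]
  note q = coproductD[OF Q]
  have "\<exists>!w. ?P w"
    using P assms q unfolding is_binary_coproduct_def by (auto simp: hom_iff)
  from theI'[OF this] show "coprod_map C f g \<in> Ar C" "Dom C (coprod_map C f g) = coprod_ob C (Dom C f) (Dom C g)"
    "Cod C (coprod_map C f g) = coprod_ob C (Cod C f) (Cod C g)"
    "coprod_map C f g \<cdot> coprod_i1 C (Dom C f) (Dom C g) = coprod_i1 C (Cod C f) (Cod C g) \<cdot> f"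
    "coprod_map C f g \<cdot> coprod_i2 C (Dom C f) (Dom C g) = coprod_i2 C (Cod C f) (Cod C g) \<cdot> g"
    unfolding coprod_map_def by (auto simp: hom_iff)
qed

end

lemma (in category) coproduct_iso:
  assumes P: "is_binary_coproduct C A B P i j"
    and "k \<in> Ar C" "Dom C k = P" "Cod C k = Q" "l \<in> Ar C" "Dom C l = Q" "Cod C l = P"
    and lk: "l \<cdot> k = Ide C P" and kl: "k \<cdot> l = Ide C Q"
  shows "is_binary_coproduct C A B Q (k \<cdot> i) (k \<cdot> j)"
proof -
  note p = coproductD[OF P]
  have Q: "Q \<in> Ob C" using assms(2,4) by auto
  have "\<exists>!u. u \<in> hom C Q X \<and> u \<cdot> (k \<cdot> i) = f \<and> u \<cdot> (k \<cdot> j) = g"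
    if fg: "f \<in> hom C A X" "g \<in> hom C B X" for X f g
  proof -
    have fg: "f \<in> Ar C" "Dom C f = A" "Cod C f = X" "g \<in> Ar C" "Dom C g = B" "Cod C g = X"
      using that by (simp_all add: hom_iff)
    obtain u where u: "u \<in> Ar C" "Dom C u = P" "Cod C u = X" "u \<cdot> i = f" "u \<cdot> j = g"
      by (rule coproduct_copair[OF P fg])
    have v: "v \<cdot> k = u" if "v \<in> Ar C" "Dom C v = Q" "Cod C v = X" "v \<cdot> (k \<cdot> i) = f" "v \<cdot> (k \<cdot> j) = g" for v
      by (rule coproduct_eqI[OF P]) (use that u(1-3) p assms(2-4) u(4,5) in \<open>simp_all add: comp_assoc\<close>)
    have v': "v = (v \<cdot> k) \<cdot> l" if "v \<in> Ar C" "Dom C v = Q" for v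
      using that assms(2-7) kl by (simp add: comp_assoc id_r)
    have lk': "l \<cdot> (k \<cdot> i) = i" "l \<cdot> (k \<cdot> j) = j"
      using p(1-6) assms(2-7) by (simp_all add: comp_assoc[symmetric] lk id_l)
    show ?thesis
    proof (rule ex1I[of _ "u \<cdot> l"])
      show "u \<cdot> l \<in> hom C Q X \<and> u \<cdot> l \<cdot> (k \<cdot> i) = f \<and> u \<cdot> l \<cdot> (k \<cdot> j) = g"
        using u p(1-6) assms(2-7) lk' by (simp add: hom_iff comp_assoc)
      show "w = u \<cdot> l" if "w \<in> hom C Q X \<and> w \<cdot> (k \<cdot> i) = f \<and> w \<cdot> (k \<cdot> j) = g" for w
        using v[of w] v'[of w] that by (simp add: hom_iff)
    qed
  qed
  moreover have "k \<cdot> i \<in> hom C A Q" "k \<cdot> j \<in> hom C B Q" using p(1-6) assms(2-4) by (simp_all add: hom_iff)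
  ultimately show ?thesis using Q by (simp add: is_binary_coproduct_def)
qed

section \<open>Extensivity: disjoint summands and case distinction\<close>

locale extensive_category = pbcat E for E :: "('o, 'a) cat" +
  assumes extensive: "extensive E"
begin

abbreviation "inl \<equiv> coprod_i1 E"
abbreviation "inr \<equiv> coprod_i2 E"
abbreviation "coprod \<equiv> coprod_ob E"

lemma finite_coproducts: "has_finite_coproducts E"
  using extensive by (simp add: extensive_def)

lemmas coprod_is_coproduct = E.coproduct_chosen[OF finite_coproducts]
lemmas coprodD = E.coproductD[OF coprod_is_coproduct]
lemmas coprod_mapD = E.coprod_map[OF finite_coproducts]

lemma coprod_slice_equivalence:
  assumes "A \<in> Ob E" "B \<in> Ob E"
  shows "is_equivalence (prod_cat (slice_cat E A) (slice_cat E B)) (slice_cat E (coprod A B)) (coprod_functor E A B)"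
    "category (prod_cat (slice_cat E A) (slice_cat E B))" "category (slice_cat E (coprod A B))"
  using extensive assms coprodD[OF assms]
  by (simp_all add: extensive_def category_prod_cat E.category_slice)

text \<open>If \<open>inl u = inr v\<close>, the swap of \<open>Z + Z\<close> is an arrow over \<open>A + B\<close>, so by fullness it is a
  coproduct \<open>h + k\<close>; hence \<open>inr = inl h\<close>.\<close>

lemma inl_inr_disjoint:
  assumes A: "A \<in> Ob E" and B: "B \<in> Ob E" and u: "u \<in> Ar E" "Cod E u = A"
    and v: "v \<in> Ar E" "Cod E v = B" "Dom E v = Dom E u" and uv: "inl A B \<bullet> u = inr A B \<bullet> v"
    and fg: "f \<in> Ar E" "g \<in> Ar E" "Dom E f = Dom E u" "Dom E g = Dom E u" "Cod E f = Cod E g"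
  shows "f = g"
proof -
  let ?Z = "Dom E u"
  have Z: "?Z \<in> Ob E" using u by auto
  note z = coprodD[OF Z Z] and zz = coprod_is_coproduct[OF Z Z]
  obtain s where s: "s \<in> Ar E" "Dom E s = coprod ?Z ?Z" "Cod E s = coprod ?Z ?Z"
      "s \<bullet> inl ?Z ?Z = inr ?Z ?Z" "s \<bullet> inr ?Z ?Z = inl ?Z ?Z"
    by (rule E.coproduct_copair[OF zz z(4-6) z(1-3)])
  let ?w = "coprod_map E u v"
  have w: "?w \<in> Ar E" "Dom E ?w = coprod ?Z ?Z" "Cod E ?w = coprod A B"
    "?w \<bullet> inl ?Z ?Z = inl A B \<bullet> u" "?w \<bullet> inr ?Z ?Z = inr A B \<bullet> v"
    using coprod_mapD[OF u(1) v(1)] u v by simp_all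
  have ws: "?w \<bullet> s = ?w"
    by (rule E.coproduct_eqI[OF zz]) (use w s z uv in \<open>simp_all add: E.comp_assoc\<close>)
  let ?S = "prod_cat (slice_cat E A) (slice_cat E B)" and ?D = "slice_cat E (coprod A B)"
  note eq = coprod_slice_equivalence[OF A B]
  have x: "(u, v) \<in> Ob ?S" using u v by (simp add: prod_cat_def slice_cat_def)
  have Fx: "FO (coprod_functor E A B) (u, v) = ?w" using x by (simp add: coprod_functor_def)
  have sd: "(?w, s, ?w) \<in> Ar ?D" using w(1-3) s(1-3) ws by (simp add: slice_cat_def hom_iff)
  obtain r where r: "r \<in> Ar ?S" "Dom ?S r = (u, v)" "Cod ?S r = (u, v)"
      "FA (coprod_functor E A B) r = (?w, s, ?w)"
    using equivalence_full[OF eq(2,3,1) x x sd] by (auto simp: Fx slice_cat_def)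
  obtain p h p' q k q' where r': "r = ((p, h, p'), (q, k, q'))" by (metis surj_pair)
  have hk: "h \<in> Ar E" "Dom E h = ?Z" "Cod E h = ?Z" "k \<in> Ar E" "Dom E k = ?Z" "Cod E k = ?Z"
    using r(1-3) v(3) unfolding r' by (simp_all add: prod_cat_def slice_cat_def hom_iff)
  have "s = coprod_map E h k" using r(1,4) unfolding r' coprod_functor_def by simp
  then have sh: "inr ?Z ?Z = inl ?Z ?Z \<bullet> h" using coprod_mapD(4)[OF hk(1,4)] hk s(4) by simp
  \<comment> \<open>Copairing a parallel pair f', g' and using \<open>inr = inl h\<close> gives g' =
    f' h. The pairs (f, g) and (f, f) then yield g = f h = f, so Z has at most one arrow to any
    object.\<close>
  have *: "g' = f' \<bullet> h" if t: "f' \<in> Ar E" "g' \<in> Ar E" "Dom E f' = ?Z" "Dom E g' = ?Z" "Cod E f' = Cod E g'" for f' g'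
  proof -
    obtain c where c: "c \<in> Ar E" "Dom E c = coprod ?Z ?Z" "c \<bullet> inl ?Z ?Z = f'" "c \<bullet> inr ?Z ?Z = g'"
      by (rule E.coproduct_copair[OF zz t(1,3,5,2,4)]) simp
    have "g' = c \<bullet> (inl ?Z ?Z \<bullet> h)" using c(4) sh by simp
    then show ?thesis using c z hk by (simp add: E.comp_assoc[symmetric])
  qed
  show ?thesis using *[of f g] *[of f f] fg by metis
qed

text \<open>By essential surjectivity, \<open>h\<close> is isomorphic in the slice over
  \<open>A + B\<close> to some \<open>coprod_map E a b\<close>. The isomorphism of domains carries
  the injections of \<open>Dom a + Dom b\<close> to \<open>k\<close> and \<open>l\<close>.\<close>

lemma coprod_decompose:
  assumes A: "A \<in> Ob E" and B: "B \<in> Ob E" and h: "h \<in> Ar E" "Cod E h = coprod A B"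
  obtains k l a b where "is_binary_coproduct E (Dom E k) (Dom E l) (Dom E h) k l"
    "a \<in> Ar E" "Dom E a = Dom E k" "Cod E a = A" "h \<bullet> k = inl A B \<bullet> a"
    "b \<in> Ar E" "Dom E b = Dom E l" "Cod E b = B" "h \<bullet> l = inr A B \<bullet> b"
proof -
  let ?S = "prod_cat (slice_cat E A) (slice_cat E B)" and ?D = "slice_cat E (coprod A B)"
  note eq = coprod_slice_equivalence[OF A B]
  have hD: "h \<in> Ob ?D" using h by (simp add: slice_cat_def)
  obtain x e where x: "x \<in> Ob ?S" and e: "is_iso ?D e" "Dom ?D e = FO (coprod_functor E A B) x" "Cod ?D e = h"
    using equivalence_ess_surj[OF eq(1) hD] by blast
  obtain a b where ab: "x = (a, b)" "a \<in> Ar E" "Cod E a = A" "b \<in> Ar E" "Cod E b = B"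
    using x by (auto simp: prod_cat_def slice_cat_def)
  let ?w = "coprod_map E a b"
  have w: "?w \<in> Ar E" "Dom E ?w = coprod (Dom E a) (Dom E b)" "Cod E ?w = coprod A B"
    "?w \<bullet> inl (Dom E a) (Dom E b) = inl A B \<bullet> a" "?w \<bullet> inr (Dom E a) (Dom E b) = inr A B \<bullet> b"
    using coprod_mapD[OF ab(2,4)] ab by simp_all
  have Fx: "FO (coprod_functor E A B) x = ?w" using x ab(1) by (simp add: coprod_functor_def)
  obtain d where e': "e \<in> Ar ?D" and d: "d \<in> Ar ?D" "Dom ?D d = h" "Cod ?D d = ?w"
      "d \<cdot>\<^bsub>?D\<^esub> e = Ide ?D ?w" "e \<cdot>\<^bsub>?D\<^esub> d = Ide ?D h"
    using e unfolding is_iso_def Fx by (metis (no_types, lifting) hom_iff)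
  obtain i where i: "e = (?w, i, h)" "i \<in> Ar E" "Dom E i = Dom E ?w" "Cod E i = Dom E h" "h \<bullet> i = ?w"
    using e' e(2,3) unfolding Fx by (cases e) (simp add: slice_cat_def hom_iff)
  obtain j where j: "d = (h, j, ?w)" "j \<in> Ar E" "Dom E j = Dom E h" "Cod E j = Dom E ?w"
    using d(1-3) by (cases d) (simp add: slice_cat_def hom_iff)
  have ij: "j \<bullet> i = Ide E (Dom E ?w)" "i \<bullet> j = Ide E (Dom E h)"
    using d(4,5) unfolding i(1) j(1) by (simp_all add: slice_cat_def)
  have ob: "Dom E a \<in> Ob E" "Dom E b \<in> Ob E" using ab by auto
  note c = coprodD[OF ob]
  let ?k = "i \<bullet> inl (Dom E a) (Dom E b)" and ?l = "i \<bullet> inr (Dom E a) (Dom E b)"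
  have "is_binary_coproduct E (Dom E a) (Dom E b) (Dom E h) ?k ?l"
    by (rule E.coproduct_iso[OF coprod_is_coproduct[OF ob] i(2) _ i(4) j(2,3)])
      (use i(3) j(4) w(2) ij in simp_all)
  moreover have "Dom E ?k = Dom E a" "Dom E ?l = Dom E b" using c i w(2) by simp_all
  moreover have "h \<bullet> ?k = inl A B \<bullet> a" "h \<bullet> ?l = inr A B \<bullet> b"
    using c i(2-5) w h by (simp_all add: E.comp_assoc[symmetric])
  ultimately show ?thesis using that[of ?k ?l a b] ab(2-5) by simp
qed

text \<open>Equality may be tested on those generalised elements \<open>w\<close> at which
  \<open>h\<close> lands in a single summand: the two legs of a decomposition of \<open>h\<close>
  are such elements, and they are jointly epic.\<close>

lemma coprod_cases:
  assumes A: "A \<in> Ob E" and B: "B \<in> Ob E" and h: "h \<in> Ar E" "Cod E h = coprod A B"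
    and fg: "f \<in> Ar E" "g \<in> Ar E" "Dom E f = Dom E h" "Dom E g = Dom E h" "Cod E f = Cod E g"
    and l: "\<And>w u. w \<in> Ar E \<Longrightarrow> Cod E w = Dom E h \<Longrightarrow> u \<in> Ar E \<Longrightarrow> Dom E u = Dom E w \<Longrightarrow> Cod E u = A \<Longrightarrow>
      h \<bullet> w = inl A B \<bullet> u \<Longrightarrow> f \<bullet> w = g \<bullet> w"
    and r: "\<And>w u. w \<in> Ar E \<Longrightarrow> Cod E w = Dom E h \<Longrightarrow> u \<in> Ar E \<Longrightarrow> Dom E u = Dom E w \<Longrightarrow> Cod E u = B \<Longrightarrow>
      h \<bullet> w = inr A B \<bullet> u \<Longrightarrow> f \<bullet> w = g \<bullet> w"
  shows "f = g"
proof -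
  obtain k m a b where *: "is_binary_coproduct E (Dom E k) (Dom E m) (Dom E h) k m"
    "a \<in> Ar E" "Dom E a = Dom E k" "Cod E a = A" "h \<bullet> k = inl A B \<bullet> a"
    "b \<in> Ar E" "Dom E b = Dom E m" "Cod E b = B" "h \<bullet> m = inr A B \<bullet> b"
    by (rule coprod_decompose[OF A B h])
  note c = E.coproductD[OF *(1)]
  show ?thesis
    using E.coproduct_eqI[OF *(1) fg] l[OF c(1,3) *(2-5)] r[OF c(4,6) *(6-9)] by blast
qed

text \<open>Definition by cases on \<open>h : X \<rightarrow> A + B\<close>, in terms of generalised elements \<open>w\<close> of \<open>X\<close>.\<close>

lemma coprod_if:
  assumes A: "A \<in> Ob E" and B: "B \<in> Ob E" and h: "h \<in> Ar E" "Cod E h = coprod A B"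
    and f: "f \<in> Ar E" "Dom E f = Dom E h" "Cod E f = Y" and g: "g \<in> Ar E" "Dom E g = Dom E h" "Cod E g = Y"
  obtains c where "c \<in> Ar E" "Dom E c = Dom E h" "Cod E c = Y"
    "\<And>w u. w \<in> Ar E \<Longrightarrow> Cod E w = Dom E h \<Longrightarrow> u \<in> Ar E \<Longrightarrow> Dom E u = Dom E w \<Longrightarrow> Cod E u = A \<Longrightarrow>
      h \<bullet> w = inl A B \<bullet> u \<Longrightarrow> c \<bullet> w = f \<bullet> w"
    "\<And>w u. w \<in> Ar E \<Longrightarrow> Cod E w = Dom E h \<Longrightarrow> u \<in> Ar E \<Longrightarrow> Dom E u = Dom E w \<Longrightarrow> Cod E u = B \<Longrightarrow>
      h \<bullet> w = inr A B \<bullet> u \<Longrightarrow> c \<bullet> w = g \<bullet> w"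
proof -
  obtain k m a b where *: "is_binary_coproduct E (Dom E k) (Dom E m) (Dom E h) k m"
    "a \<in> Ar E" "Dom E a = Dom E k" "Cod E a = A" "h \<bullet> k = inl A B \<bullet> a"
    "b \<in> Ar E" "Dom E b = Dom E m" "Cod E b = B" "h \<bullet> m = inr A B \<bullet> b"
    by (rule coprod_decompose[OF A B h])
  note d = E.coproductD[OF *(1)]
  have fk: "f \<bullet> k \<in> Ar E" "Dom E (f \<bullet> k) = Dom E k" "Cod E (f \<bullet> k) = Y" using d f by simp_all
  have gm: "g \<bullet> m \<in> Ar E" "Dom E (g \<bullet> m) = Dom E m" "Cod E (g \<bullet> m) = Y" using d g by simp_all
  obtain c where c: "c \<in> Ar E" "Dom E c = Dom E h" "Cod E c = Y" "c \<bullet> k = f \<bullet> k" "c \<bullet> m = g \<bullet> m"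
    by (rule E.coproduct_copair[OF *(1) fk gm])
  note i = coprodD[OF A B]
  let ?K = "Dom E k" and ?M = "Dom E m"
  note x = coprodD[OF d(7,8)]
  \<comment> \<open>The arrow \<open>s\<close> compares the domain of \<open>h\<close> with the
    chosen coproduct of \<open>?K\<close> and \<open>?M\<close>, so that case distinction applies to
    \<open>s w\<close>. Since \<open>t s\<close> is an identity, a factorisation of
    \<open>s w n\<close> through an injection becomes one of \<open>w n\<close> through
    \<open>k\<close> or \<open>m\<close>.\<close>
  obtain s where s: "s \<in> Ar E" "Dom E s = Dom E h" "Cod E s = coprod ?K ?M" "s \<bullet> k = inl ?K ?M" "s \<bullet> m = inr ?K ?M"
    by (rule E.coproduct_copair[OF *(1) x(1-6)])
  obtain t where t: "t \<in> Ar E" "Dom E t = coprod ?K ?M" "Cod E t = Dom E h" "t \<bullet> inl ?K ?M = k" "t \<bullet> inr ?K ?M = m"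
    by (rule E.coproduct_copair[OF coprod_is_coproduct[OF d(7,8)] d(1-6)])
  have ts: "t \<bullet> s = Ide E (Dom E h)"
    by (rule E.coproduct_eqI[OF *(1)]) (use s t d in \<open>simp_all add: E.comp_assoc E.id_l\<close>)
  have through: "w \<bullet> n = t \<bullet> (i \<bullet> p)" if "w \<in> Ar E" "Cod E w = Dom E h" "n \<in> Ar E" "Cod E n = Dom E w"
      "(s \<bullet> w) \<bullet> n = i \<bullet> p" for w n i p
  proof -
    have "t \<bullet> ((s \<bullet> w) \<bullet> n) = (t \<bullet> s) \<bullet> (w \<bullet> n)" using that(1-4) s(1-3) t(1-3) by (simp add: E.comp_assoc)
    then show ?thesis using that ts by (simp add: E.id_l)
  qed
  \<comment> \<open>By cases on \<open>s w\<close>, it is enough to compare \<open>c\<close> with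
    \<open>e\<close> on the parts of \<open>w\<close> that factor through \<open>k\<close> or
    through \<open>m\<close>.\<close>
  have main: "c \<bullet> w = e \<bullet> w"
    if w: "w \<in> Ar E" "Cod E w = Dom E h" and e: "e \<in> Ar E" "Dom E e = Dom E h" "Cod E e = Y"
    and ek: "\<And>n p. n \<in> Ar E \<Longrightarrow> Cod E n = Dom E w \<Longrightarrow> p \<in> Ar E \<Longrightarrow> Dom E p = Dom E n \<Longrightarrow> Cod E p = ?K \<Longrightarrow>
      w \<bullet> n = k \<bullet> p \<Longrightarrow> c \<bullet> (w \<bullet> n) = e \<bullet> (w \<bullet> n)"
    and em: "\<And>n p. n \<in> Ar E \<Longrightarrow> Cod E n = Dom E w \<Longrightarrow> p \<in> Ar E \<Longrightarrow> Dom E p = Dom E n \<Longrightarrow> Cod E p = ?M \<Longrightarrow>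
      w \<bullet> n = m \<bullet> p \<Longrightarrow> c \<bullet> (w \<bullet> n) = e \<bullet> (w \<bullet> n)" for w e
  proof (rule coprod_cases[OF d(7,8), of "s \<bullet> w"])
    fix n p assume n: "n \<in> Ar E" "Cod E n = Dom E (s \<bullet> w)" and p: "p \<in> Ar E" "Dom E p = Dom E n"
    have n': "Cod E n = Dom E w" using n w s by simp
    {
      assume "Cod E p = ?K" "s \<bullet> w \<bullet> n = inl ?K ?M \<bullet> p"
      moreover from this have "w \<bullet> n = k \<bullet> p"
        using through[OF w n(1) n'] p x t by (metis E.comp_assoc)
      ultimately show "c \<bullet> w \<bullet> n = e \<bullet> w \<bullet> n" using ek[OF n(1) n' p] n n' w e c(1-3) by (simp add: E.comp_assoc)
    next
      assume "Cod E p = ?M" "s \<bullet> w \<bullet> n = inr ?K ?M \<bullet> p"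
      moreover from this have "w \<bullet> n = m \<bullet> p"
        using through[OF w n(1) n'] p x t by (metis E.comp_assoc)
      ultimately show "c \<bullet> w \<bullet> n = e \<bullet> w \<bullet> n" using em[OF n(1) n' p] n n' w e c(1-3) by (simp add: E.comp_assoc)
    }
  qed (use w s e c in simp_all)
  show ?thesis
  proof (rule that[OF c(1-3)])
    fix w u assume w: "w \<in> Ar E" "Cod E w = Dom E h" and u: "u \<in> Ar E" "Dom E u = Dom E w"
    {
      assume u': "Cod E u = A" "h \<bullet> w = inl A B \<bullet> u"
      show "c \<bullet> w = f \<bullet> w"
      proof (rule main[OF w f])
        fix n p assume n: "n \<in> Ar E" "Cod E n = Dom E w" "p \<in> Ar E" "Dom E p = Dom E n"
        {
          assume "Cod E p = ?K" "w \<bullet> n = k \<bullet> p"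
          then show "c \<bullet> (w \<bullet> n) = f \<bullet> (w \<bullet> n)" using c f n d by (simp add: E.comp_assoc[symmetric])
        next
          assume p: "Cod E p = ?M" "w \<bullet> n = m \<bullet> p"
          \<comment> \<open>The mixed case: \<open>w n\<close> lies over \<open>A\<close> because
            \<open>w\<close> does, and over \<open>B\<close> because it factors through
            \<open>m\<close>. Disjointness then identifies any two parallel arrows out of the domain
            of \<open>n\<close>.\<close>
          have "inl A B \<bullet> (u \<bullet> n) = h \<bullet> (w \<bullet> n)" using u u' i n w h by (simp add: E.comp_assoc[symmetric])
          also have "\<dots> = inr A B \<bullet> (b \<bullet> p)" unfolding p(2) using p(1) n d h i *(6-9) by (simp add: E.comp_assoc[symmetric])
          finally show "c \<bullet> (w \<bullet> n) = f \<bullet> (w \<bullet> n)"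
            by (rule inl_inr_disjoint[OF A B _ _ _ _ _, rotated 5]) (use u u' n p *(6-8) c d(1-6) f w in simp_all)
        }
      qed
    next
      assume u': "Cod E u = B" "h \<bullet> w = inr A B \<bullet> u"
      show "c \<bullet> w = g \<bullet> w"
      proof (rule main[OF w g])
        fix n p assume n: "n \<in> Ar E" "Cod E n = Dom E w" "p \<in> Ar E" "Dom E p = Dom E n"
        {
          assume "Cod E p = ?M" "w \<bullet> n = m \<bullet> p"
          then show "c \<bullet> (w \<bullet> n) = g \<bullet> (w \<bullet> n)" using c g n d by (simp add: E.comp_assoc[symmetric])
        next
          assume p: "Cod E p = ?K" "w \<bullet> n = k \<bullet> p"
          have "inl A B \<bullet> (a \<bullet> p) = h \<bullet> (w \<bullet> n)" unfolding p(2) using p(1) n d h i *(2-5) by (simp add: E.comp_assoc[symmetric])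
          also have "\<dots> = inr A B \<bullet> (u \<bullet> n)" using u u' i n w h by (simp add: E.comp_assoc[symmetric])
          finally show "c \<bullet> (w \<bullet> n) = g \<bullet> (w \<bullet> n)"
            by (rule inl_inr_disjoint[OF A B _ _ _ _ _, rotated 5]) (use u u' n p *(2-4) c d(1-6) g w in simp_all)
        }
      qed
    }
  qed
qed

end

section \<open>Copowers by the walking arrow\<close>

definition arrow_functor :: "('x, 'y) cat \<Rightarrow> 'y \<Rightarrow> (bool, bool \<times> bool, 'x, 'y) func" where
  "arrow_functor C a =
     \<lparr>FO = (\<lambda>i. if i then Cod C a else Dom C a),
      FA = (\<lambda>(i, j) \<in> Ar walking_arrow. if i then Ide C (Cod C a) else if j then a else Ide C (Dom C a))\<rparr>"

lemma walking_arrow_simps [simp]: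
  "Ob walking_arrow = UNIV" "(i, j) \<in> Ar walking_arrow \<longleftrightarrow> i \<le> j" "Dom walking_arrow = fst" "Cod walking_arrow = snd"
  "Ide walking_arrow i = (i, i)" "g \<cdot>\<^bsub>walking_arrow\<^esub> f = (fst f, snd g)"
  by (simp_all add: walking_arrow_def)

lemma arrow_functor_simps [simp]:
  "FO (arrow_functor C a) False = Dom C a" "FO (arrow_functor C a) True = Cod C a"
  "FA (arrow_functor C a) (False, True) = a" "FA (arrow_functor C a) (False, False) = Ide C (Dom C a)"
  "FA (arrow_functor C a) (True, True) = Ide C (Cod C a)"
  by (simp_all add: arrow_functor_def)

lemma walking_arrow_Ar_cases:
  assumes "f \<in> Ar walking_arrow"
  obtains "f = (False, False)" | "f = (False, True)" | "f = (True, True)"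
  using assms by (cases f) (auto simp: walking_arrow_def)

lemma arrow_functor_is_functor:
  assumes "category C" "a \<in> Ar C"
  shows "is_functor walking_arrow C (arrow_functor C a)"
proof -
  interpret category C by fact
  show ?thesis
  proof (rule functorI, goal_cases)
    case (1 i) then show ?case using assms(2) by (cases i) simp_all
  next
    case (2 f) then show ?case using assms(2) by (elim walking_arrow_Ar_cases) simp_all
  next
    case (3 f) then show ?case using assms(2) by (elim walking_arrow_Ar_cases) simp_all
  next
    case (4 f) then show ?case using assms(2) by (elim walking_arrow_Ar_cases) simp_all
  next
    case (5 i) then show ?case using assms(2) by (cases i) simp_all
  next
    case (6 f g)
    then show ?case using assms(2) by (elim walking_arrow_Ar_cases) (simp_all add: id_l id_r)
  qed (auto simp: arrow_functor_def)
qed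

lemma functor_eq_arrow_functor:
  assumes "is_functor walking_arrow C X"
  shows "X = arrow_functor C (FA X (False, True))" "FA X (False, True) \<in> Ar C"
proof -
  note x = functorD[OF assms]
  show "FA X (False, True) \<in> Ar C" using x(2) by simp
  have dc: "Dom C (FA X (False, True)) = FO X False" "Cod C (FA X (False, True)) = FO X True"
    using x(3,4)[of "(False, True)"] by simp_all
  show "X = arrow_functor C (FA X (False, True))"
  proof (rule func_eqI[OF x(7) _ x(8)])
    fix i show "FO X i = FO (arrow_functor C (FA X (False, True))) i"
      by (cases i) (simp_all add: dc)
  next
    fix f :: "bool \<times> bool" assume "f \<in> Ar walking_arrow"
    then show "FA X f = FA (arrow_functor C (FA X (False, True))) f"
      using x(5)[of False] x(5)[of True] by (elim walking_arrow_Ar_cases) (simp_all add: dc)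
  qed (simp_all add: arrow_functor_def)
qed

lemma func_comp_arrow_functor:
  assumes "is_functor C D F" "category C" "a \<in> Ar C"
  shows "func_comp walking_arrow F (arrow_functor C a) = arrow_functor D (FA F a)"
proof -
  interpret C: category C by fact
  note f = functorD[OF assms(1)]
  show ?thesis
  proof (rule func_eqI[of _ UNIV _ "Ar walking_arrow"])
    fix i show "FO (func_comp walking_arrow F (arrow_functor C a)) i = FO (arrow_functor D (FA F a)) i"
      using f(3,4) assms(3) by (cases i) (simp_all add: func_comp_def)
  next
    fix g :: "bool \<times> bool" assume "g \<in> Ar walking_arrow"
    then show "FA (func_comp walking_arrow F (arrow_functor C a)) g = FA (arrow_functor D (FA F a)) g"
      using f(3-5) assms(3) by (elim walking_arrow_Ar_cases) (simp_all add: func_comp_def)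
  qed (simp_all add: func_comp_def arrow_functor_def)
qed

definition square :: "('x, 'y) cat \<Rightarrow> 'y \<Rightarrow> 'y \<Rightarrow> 'y \<Rightarrow> 'y \<Rightarrow> (bool, bool \<times> bool, 'x, 'y) ntrans" where
  "square C a b p q = \<lparr>NSrc = arrow_functor C a, NTgt = arrow_functor C b, NMap = (\<lambda>i. if i then q else p)\<rparr>"

lemma square_is_ntrans:
  assumes "category C" "a \<in> Ar C" "b \<in> Ar C"
    "p \<in> Ar C" "Dom C p = Dom C a" "Cod C p = Dom C b" "q \<in> Ar C" "Dom C q = Cod C a" "Cod C q = Cod C b"
    "b \<cdot>\<^bsub>C\<^esub> p = q \<cdot>\<^bsub>C\<^esub> a"
  shows "is_ntrans walking_arrow C (square C a b p q)"
proof -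
  interpret category C by fact
  show ?thesis
  proof (rule ntransI, goal_cases)
    case (7 f)
    then show ?case using assms
      by (elim walking_arrow_Ar_cases) (simp_all add: square_def id_l id_r)
  qed (use assms arrow_functor_is_functor[OF assms(1)] in \<open>auto simp: square_def\<close>)
qed

lemma ntrans_eq_square:
  assumes "is_ntrans walking_arrow C \<tau>"
  defines "a \<equiv> FA (NSrc \<tau>) (False, True)" and "b \<equiv> FA (NTgt \<tau>) (False, True)"
    and "p \<equiv> NMap \<tau> False" and "q \<equiv> NMap \<tau> True"
  shows "\<tau> = square C a b p q" "a \<in> Ar C" "b \<in> Ar C"
    "p \<in> Ar C" "Dom C p = Dom C a" "Cod C p = Dom C b" "q \<in> Ar C" "Dom C q = Cod C a" "Cod C q = Cod C b"
    "b \<cdot>\<^bsub>C\<^esub> p = q \<cdot>\<^bsub>C\<^esub> a"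
proof -
  note t = ntransD[OF assms(1)]
  note s = functor_eq_arrow_functor[OF t(1), folded a_def]
    functor_eq_arrow_functor[OF t(2), folded b_def]
  show "\<tau> = square C a b p q"
    using s(1,3) by (cases \<tau>) (auto simp: square_def p_def q_def)
  show "a \<in> Ar C" "b \<in> Ar C" using s(2,4) .
  show "p \<in> Ar C" "q \<in> Ar C" using t(4) by (simp_all add: p_def q_def)
  show "Dom C p = Dom C a" "Cod C p = Dom C b" "Dom C q = Cod C a" "Cod C q = Cod C b"
    using t(5,6) s(1,3) by (simp_all add: p_def q_def)
  show "b \<cdot>\<^bsub>C\<^esub> p = q \<cdot>\<^bsub>C\<^esub> a"
    using t(7)[of "(False, True)"] by (simp add: a_def b_def p_def q_def)
qed

section \<open>Recognising copowers by the walking arrow in a 2-category\<close>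

context two_category
begin

abbreviation comp1 where "comp1 A B C g f \<equiv> FO (Hcomp K A B C) (g, f)"
abbreviation comp2 where "comp2 A B C g f \<equiv> FA (Hcomp K A B C) (g, f)"

lemma comp1_Ob:
  "A \<in> Obj K \<Longrightarrow> B \<in> Obj K \<Longrightarrow> C \<in> Obj K \<Longrightarrow> g \<in> Ob (Hom K B C) \<Longrightarrow> f \<in> Ob (Hom K A B) \<Longrightarrow>
    comp1 A B C g f \<in> Ob (Hom K A C)"
  using functorD(1)[OF Hcomp_functor] by (simp add: prod_cat_def)

lemma comp2_Ar:
  assumes "A \<in> Obj K" "B \<in> Obj K" "C \<in> Obj K" "\<beta> \<in> Ar (Hom K B C)" "\<alpha> \<in> Ar (Hom K A B)"
  shows "comp2 A B C \<beta> \<alpha> \<in> Ar (Hom K A C)"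
    "Dom (Hom K A C) (comp2 A B C \<beta> \<alpha>) = comp1 A B C (Dom (Hom K B C) \<beta>) (Dom (Hom K A B) \<alpha>)"
    "Cod (Hom K A C) (comp2 A B C \<beta> \<alpha>) = comp1 A B C (Cod (Hom K B C) \<beta>) (Cod (Hom K A B) \<alpha>)"
  using functorD(2-4)[OF Hcomp_functor[OF assms(1-3)], of "(\<beta>, \<alpha>)"] assms by (simp_all add: prod_cat_def)

lemma comp2_Ide:
  assumes "A \<in> Obj K" "B \<in> Obj K" "C \<in> Obj K" "g \<in> Ob (Hom K B C)" "f \<in> Ob (Hom K A B)"
  shows "comp2 A B C (Ide (Hom K B C) g) (Ide (Hom K A B) f) = Ide (Hom K A C) (comp1 A B C g f)"
  using functorD(5)[OF Hcomp_functor[OF assms(1-3)], of "(g, f)"] assms by (simp add: prod_cat_def)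

lemma comp2_interchange:
  assumes "A \<in> Obj K" "B \<in> Obj K" "C \<in> Obj K"
    "\<beta> \<in> Ar (Hom K B C)" "\<alpha> \<in> Ar (Hom K A B)" "\<beta>' \<in> Ar (Hom K B C)" "\<alpha>' \<in> Ar (Hom K A B)"
    "Dom (Hom K B C) \<beta>' = Cod (Hom K B C) \<beta>" "Dom (Hom K A B) \<alpha>' = Cod (Hom K A B) \<alpha>"
  shows "comp2 A B C (\<beta>' \<cdot>\<^bsub>Hom K B C\<^esub> \<beta>) (\<alpha>' \<cdot>\<^bsub>Hom K A B\<^esub> \<alpha>) =
    comp2 A B C \<beta>' \<alpha>' \<cdot>\<^bsub>Hom K A C\<^esub> comp2 A B C \<beta> \<alpha>"
  using functorD(6)[OF Hcomp_functor[OF assms(1-3)], of "(\<beta>, \<alpha>)" "(\<beta>', \<alpha>')"] assms by (simp add: prod_cat_def)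

lemma hom_two_functor_simps:
  "TO (hom_two_functor K P) = Hom K P"
  "b \<in> Ob (Hom K B B') \<Longrightarrow> FO (THom (hom_two_functor K P) B B') b = postcomp1 K P B B' b"
  "\<beta> \<in> Ar (Hom K B B') \<Longrightarrow> FA (THom (hom_two_functor K P) B B') \<beta> = postcomp2 K P B B' \<beta>"
  by (simp_all add: hom_two_functor_def)

lemma postcomp_functorial:
  assumes "P \<in> Obj K" "B \<in> Obj K" "B' \<in> Obj K"
  shows "b \<in> Ob (Hom K B B') \<Longrightarrow> is_functor (Hom K P B) (Hom K P B') (postcomp1 K P B B' b)"
    "\<beta> \<in> Ar (Hom K B B') \<Longrightarrow> is_ntrans (Hom K P B) (Hom K P B') (postcomp2 K P B B' \<beta>)"
proof -
  have *: "is_functor (Hom K B B') (functor_cat (Hom K P B) (Hom K P B')) (THom (hom_two_functor K P) B B')"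
    using two_functor_hom[OF two_category_axioms assms(1)] assms(2,3)
    by (auto simp: is_two_functor_def Cat_def hom_two_functor_simps)
  show "b \<in> Ob (Hom K B B') \<Longrightarrow> is_functor (Hom K P B) (Hom K P B') (postcomp1 K P B B' b)"
    using functorD(1)[OF *, of b] by (simp add: hom_two_functor_simps functor_cat_def)
  show "\<beta> \<in> Ar (Hom K B B') \<Longrightarrow> is_ntrans (Hom K P B) (Hom K P B') (postcomp2 K P B B' \<beta>)"
    using functorD(2)[OF *, of \<beta>] by (simp add: hom_two_functor_simps functor_cat_def)
qed

text \<open>The values of \<open>exp_two_functor\<close> are restricted to functors and natural
  transformations, so unfolding the composite requires that post-composition be functorial.\<close>

lemma exp_hom_two_functor_simps:
  fixes J :: "('x, 'y) cat" and T
  assumes "T \<in> Obj K" "B \<in> Obj K" "B' \<in> Obj K"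
  defines "S \<equiv> comp_two_functor K (exp_two_functor J) (hom_two_functor K T)"
  shows "TO S B = functor_cat J (Hom K T B)"
    "b \<in> Ob (Hom K B B') \<Longrightarrow> X \<in> Ob (functor_cat J (Hom K T B)) \<Longrightarrow>
      FO (FO (THom S B B') b) X = func_comp J (postcomp1 K T B B' b) X"
    "b \<in> Ob (Hom K B B') \<Longrightarrow> \<xi> \<in> Ar (functor_cat J (Hom K T B)) \<Longrightarrow>
      FA (FO (THom S B B') b) \<xi> = whisker_left J (postcomp1 K T B B' b) \<xi>"
    "\<beta> \<in> Ar (Hom K B B') \<Longrightarrow> X \<in> Ob (functor_cat J (Hom K T B)) \<Longrightarrow>
      NMap (FA (THom S B B') \<beta>) X = whisker_right J (postcomp2 K T B B' \<beta>) X"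
    "\<beta> \<in> Ar (Hom K B B') \<Longrightarrow> NSrc (FA (THom S B B') \<beta>) = FO (THom S B B') (Dom (Hom K B B') \<beta>)"
    "\<beta> \<in> Ar (Hom K B B') \<Longrightarrow> NTgt (FA (THom S B B') \<beta>) = FO (THom S B B') (Cod (Hom K B B') \<beta>)"
proof -
  interpret H: category "Hom K B B'" using assms by (simp add: Hom_category)
  note pf = postcomp_functorial[OF assms(1-3)]
  have 1: "b \<in> Ob (Hom K B B') \<Longrightarrow> postcomp1 K T B B' b \<in> Ob (functor_cat (Hom K T B) (Hom K T B'))" for b
    using pf by (simp add: functor_cat_def)
  have 2: "\<beta> \<in> Ar (Hom K B B') \<Longrightarrow> postcomp2 K T B B' \<beta> \<in> Ar (functor_cat (Hom K T B) (Hom K T B'))" for \<beta>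
    using pf by (simp add: functor_cat_def)
  have 3: "NSrc (postcomp2 K T B B' \<beta>) = postcomp1 K T B B' (Dom (Hom K B B') \<beta>)"
    "NTgt (postcomp2 K T B B' \<beta>) = postcomp1 K T B B' (Cod (Hom K B B') \<beta>)" for \<beta>
    by (simp_all add: postcomp2_def)
  show "TO S B = functor_cat J (Hom K T B)"
    by (simp add: S_def comp_two_functor_def exp_two_functor_def hom_two_functor_simps Let_def)
  show "b \<in> Ob (Hom K B B') \<Longrightarrow> X \<in> Ob (functor_cat J (Hom K T B)) \<Longrightarrow>
      FO (FO (THom S B B') b) X = func_comp J (postcomp1 K T B B' b) X"
    "b \<in> Ob (Hom K B B') \<Longrightarrow> \<xi> \<in> Ar (functor_cat J (Hom K T B)) \<Longrightarrow>
      FA (FO (THom S B B') b) \<xi> = whisker_left J (postcomp1 K T B B' b) \<xi>"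
    "\<beta> \<in> Ar (Hom K B B') \<Longrightarrow> X \<in> Ob (functor_cat J (Hom K T B)) \<Longrightarrow>
      NMap (FA (THom S B B') \<beta>) X = whisker_right J (postcomp2 K T B B' \<beta>) X"
    "\<beta> \<in> Ar (Hom K B B') \<Longrightarrow> NSrc (FA (THom S B B') \<beta>) = FO (THom S B B') (Dom (Hom K B B') \<beta>)"
    "\<beta> \<in> Ar (Hom K B B') \<Longrightarrow> NTgt (FA (THom S B B') \<beta>) = FO (THom S B B') (Cod (Hom K B B') \<beta>)"
    using 1 2 by (simp_all add: S_def comp_two_functor_def exp_two_functor_def hom_two_functor_simps Let_def func_comp_def 3)
qed

text \<open>The Yoneda argument: a 2-natural isomorphism from K(P, -) is determined by the image of
  the identity of \<open>P\<close>, here a 2-cell \<theta> from \<open>d0\<close> to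
  \<open>d1\<close> in K(T, P). The copower property becomes a universal property of \<theta>.
  Assumption \<open>one\<close> makes whiskering \<open>x\<close> with \<theta> a bijection onto the
  2-cells out of \<open>T\<close>; assumption \<open>two\<close> says that a 2-cell out of
  \<open>P\<close> is a commutative square formed by its restrictions along \<open>d0\<close> and
  \<open>d1\<close>.\<close>

lemma copower_walking_arrowI:
  assumes T: "T \<in> Obj K" and P: "P \<in> Obj K" and \<theta>: "\<theta> \<in> Ar (Hom K T P)"
  defines "d0 \<equiv> Dom (Hom K T P) \<theta>" and "d1 \<equiv> Cod (Hom K T P) \<theta>"
  assumes one: "\<And>B \<gamma>. B \<in> Obj K \<Longrightarrow> \<gamma> \<in> Ar (Hom K T B) \<Longrightarrow>
      \<exists>!x. x \<in> Ob (Hom K P B) \<and> comp2 T P B (Ide (Hom K P B) x) \<theta> = \<gamma>"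
    and two: "\<And>B x y p q. B \<in> Obj K \<Longrightarrow> x \<in> Ob (Hom K P B) \<Longrightarrow> y \<in> Ob (Hom K P B) \<Longrightarrow>
      p \<in> hom (Hom K T B) (comp1 T P B x d0) (comp1 T P B y d0) \<Longrightarrow>
      q \<in> hom (Hom K T B) (comp1 T P B x d1) (comp1 T P B y d1) \<Longrightarrow>
      comp2 T P B (Ide (Hom K P B) y) \<theta> \<cdot>\<^bsub>Hom K T B\<^esub> p = q \<cdot>\<^bsub>Hom K T B\<^esub> comp2 T P B (Ide (Hom K P B) x) \<theta> \<Longrightarrow>
      \<exists>!\<xi>. \<xi> \<in> hom (Hom K P B) x y \<and> comp2 T P B \<xi> (Ide (Hom K T P) d0) = p \<and>
        comp2 T P B \<xi> (Ide (Hom K T P) d1) = q"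
  shows "is_copower K walking_arrow T P"
proof -
  interpret TP: category "Hom K T P" using T P by (rule Hom_category)
  have d: "d0 \<in> Ob (Hom K T P)" "d1 \<in> Ob (Hom K T P)" using \<theta> by (simp_all add: d0_def d1_def)
  define \<eta> where "\<eta> B x = comp2 T P B (Ide (Hom K P B) x) \<theta>" for B x
  define sq where "sq B \<xi> = square (Hom K T B) (\<eta> B (Dom (Hom K P B) \<xi>)) (\<eta> B (Cod (Hom K P B) \<xi>))
      (comp2 T P B \<xi> (Ide (Hom K T P) d0)) (comp2 T P B \<xi> (Ide (Hom K T P) d1))" for B \<xi>
  define \<Phi> where "\<Phi> B = \<lparr>FO = (\<lambda>x \<in> Ob (Hom K P B). arrow_functor (Hom K T B) (\<eta> B x)),
      FA = (\<lambda>\<xi> \<in> Ar (Hom K P B). sq B \<xi>)\<rparr>" for B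
  have \<eta>: "\<eta> B x \<in> Ar (Hom K T B)" "Dom (Hom K T B) (\<eta> B x) = comp1 T P B x d0"
      "Cod (Hom K T B) (\<eta> B x) = comp1 T P B x d1" if B: "B \<in> Obj K" and x: "x \<in> Ob (Hom K P B)" for B x
  proof -
    interpret PB: category "Hom K P B" using P B by (rule Hom_category)
    show "\<eta> B x \<in> Ar (Hom K T B)" "Dom (Hom K T B) (\<eta> B x) = comp1 T P B x d0"
      "Cod (Hom K T B) (\<eta> B x) = comp1 T P B x d1"
      using comp2_Ar[OF T P B _ \<theta>] x by (simp_all add: \<eta>_def d0_def d1_def)
  qed
  have leg: "comp2 T P B \<xi> (Ide (Hom K T P) f) \<in> Ar (Hom K T B)"
      "Dom (Hom K T B) (comp2 T P B \<xi> (Ide (Hom K T P) f)) = comp1 T P B (Dom (Hom K P B) \<xi>) f"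
      "Cod (Hom K T B) (comp2 T P B \<xi> (Ide (Hom K T P) f)) = comp1 T P B (Cod (Hom K P B) \<xi>) f"
    if "B \<in> Obj K" "\<xi> \<in> Ar (Hom K P B)" "f \<in> Ob (Hom K T P)" for B \<xi> f
    using comp2_Ar[OF T P that(1,2)] that(3) by simp_all
  \<comment> \<open>By interchange both sides equal the horizontal composite of \<xi> and
    \<theta>.\<close>
  have comm: "\<eta> B (Cod (Hom K P B) \<xi>) \<cdot>\<^bsub>Hom K T B\<^esub> comp2 T P B \<xi> (Ide (Hom K T P) d0) =
      comp2 T P B \<xi> (Ide (Hom K T P) d1) \<cdot>\<^bsub>Hom K T B\<^esub> \<eta> B (Dom (Hom K P B) \<xi>)"
    if B: "B \<in> Obj K" and \<xi>: "\<xi> \<in> Ar (Hom K P B)" for B \<xi>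
  proof -
    interpret PB: category "Hom K P B" using P B by (rule Hom_category)
    show ?thesis unfolding \<eta>_def
      using \<xi> \<theta> d T P B
      by (simp add: comp2_interchange[symmetric] PB.id_l PB.id_r TP.id_l TP.id_r d0_def d1_def)
  qed
  have sq: "is_ntrans walking_arrow (Hom K T B) (sq B \<xi>)" if B: "B \<in> Obj K" and \<xi>: "\<xi> \<in> Ar (Hom K P B)" for B \<xi>
  proof -
    interpret PB: category "Hom K P B" using P B by (rule Hom_category)
    show ?thesis unfolding sq_def
      by (rule square_is_ntrans) (use comm[OF B \<xi>] Hom_category[OF T B] \<xi> leg[OF B \<xi>] d \<eta>[OF B] in simp_all)
  qed
  have iso: "is_iso_functor (Hom K P B) (functor_cat walking_arrow (Hom K T B)) (\<Phi> B)" if B: "B \<in> Obj K" for B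
  proof -
    interpret PB: category "Hom K P B" using P B by (rule Hom_category)
    interpret TB: category "Hom K T B" using T B by (rule Hom_category)
    note cTB = TB.category_axioms
    \<comment> \<open>The source and target functors of the square determine the source and target
      of \<xi> by uniqueness in \<open>one\<close>; its two components then determine \<xi> by
      uniqueness in \<open>two\<close>.\<close>
    have sq_inj: "\<xi> = \<zeta>" if "\<xi> \<in> Ar (Hom K P B)" "\<zeta> \<in> Ar (Hom K P B)" "sq B \<xi> = sq B \<zeta>" for \<xi> \<zeta>
    proof -
      have af: "arrow_functor (Hom K T B) (\<eta> B (Dom (Hom K P B) \<xi>)) = arrow_functor (Hom K T B) (\<eta> B (Dom (Hom K P B) \<zeta>))"
        "arrow_functor (Hom K T B) (\<eta> B (Cod (Hom K P B) \<xi>)) = arrow_functor (Hom K T B) (\<eta> B (Cod (Hom K P B) \<zeta>))"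
        and legs: "(\<lambda>i. if i then comp2 T P B \<xi> (Ide (Hom K T P) d1) else comp2 T P B \<xi> (Ide (Hom K T P) d0)) =
          (\<lambda>i. if i then comp2 T P B \<zeta> (Ide (Hom K T P) d1) else comp2 T P B \<zeta> (Ide (Hom K T P) d0))"
        using that(3) unfolding sq_def square_def by simp_all
      have e: "\<eta> B (Dom (Hom K P B) \<xi>) = \<eta> B (Dom (Hom K P B) \<zeta>)" "\<eta> B (Cod (Hom K P B) \<xi>) = \<eta> B (Cod (Hom K P B) \<zeta>)"
        using af by (metis arrow_functor_simps(3))+
      have dc: "Dom (Hom K P B) \<xi> = Dom (Hom K P B) \<zeta>" "Cod (Hom K P B) \<xi> = Cod (Hom K P B) \<zeta>"
        using one[OF B] e \<eta>(1)[OF B] that(1,2) unfolding \<eta>_def by (metis PB.dom_ob PB.cod_ob)+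
      note legs' = fun_cong[OF legs, of True, simplified] fun_cong[OF legs, of False, simplified]
      have "\<exists>!\<chi>. \<chi> \<in> hom (Hom K P B) (Dom (Hom K P B) \<xi>) (Cod (Hom K P B) \<xi>) \<and>
          comp2 T P B \<chi> (Ide (Hom K T P) d0) = comp2 T P B \<xi> (Ide (Hom K T P) d0) \<and>
          comp2 T P B \<chi> (Ide (Hom K T P) d1) = comp2 T P B \<xi> (Ide (Hom K T P) d1)"
        by (rule two[OF B]) (use that(1) leg[OF B that(1)] d comm[OF B that(1)] in \<open>simp_all add: hom_iff \<eta>_def\<close>)
      moreover have "\<xi> \<in> hom (Hom K P B) (Dom (Hom K P B) \<xi>) (Cod (Hom K P B) \<xi>)"
        "\<zeta> \<in> hom (Hom K P B) (Dom (Hom K P B) \<xi>) (Cod (Hom K P B) \<xi>)" using that dc by (simp_all add: hom_iff)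
      ultimately show ?thesis using legs' by metis
    qed
    show ?thesis
    proof (rule is_iso_functorI[OF PB.category_axioms category_functor_cat[OF category_walking_arrow cTB]])
      show "is_functor (Hom K P B) (functor_cat walking_arrow (Hom K T B)) (\<Phi> B)"
      proof (rule functorI, goal_cases)
        case (1 x) then show ?case using arrow_functor_is_functor[OF cTB] \<eta>[OF B] by (simp add: \<Phi>_def functor_cat_def)
      next
        case (2 f) then show ?case using sq[OF B] by (simp add: \<Phi>_def functor_cat_def)
      next
        case (3 f) then show ?case by (simp add: \<Phi>_def functor_cat_def sq_def square_def)
      next
        case (4 f) then show ?case by (simp add: \<Phi>_def functor_cat_def sq_def square_def)
      next
        case (5 x) then show ?case using comp2_Ide[OF T P B _ d(1)] comp2_Ide[OF T P B _ d(2)] \<eta>[OF B]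
          by (simp add: \<Phi>_def functor_cat_def sq_def square_def ntid_def fun_eq_iff)
      next
        case (6 f g)
        have "comp2 T P B (g \<cdot>\<^bsub>Hom K P B\<^esub> f) (Ide (Hom K T P) e) =
          comp2 T P B g (Ide (Hom K T P) e) \<cdot>\<^bsub>Hom K T B\<^esub> comp2 T P B f (Ide (Hom K T P) e)"
          if "e \<in> Ob (Hom K T P)" for e
          using comp2_interchange[OF T P B 6(1) _ 6(2), of "Ide (Hom K T P) e" "Ide (Hom K T P) e"] 6 that
          by (simp add: TP.id_l)
        with 6 d show ?case by (simp add: \<Phi>_def functor_cat_def sq_def square_def vcomp_def fun_eq_iff)
      qed (simp_all add: \<Phi>_def)
      show "bij_betw (FO (\<Phi> B)) (Ob (Hom K P B)) (Ob (functor_cat walking_arrow (Hom K T B)))"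
      proof (rule bij_betwI')
        fix x y assume "x \<in> Ob (Hom K P B)" "y \<in> Ob (Hom K P B)"
        then show "(FO (\<Phi> B) x = FO (\<Phi> B) y) = (x = y)"
          using one[OF B] \<eta>(1)[OF B] unfolding \<Phi>_def \<eta>_def
          by simp (metis arrow_functor_simps(3))
      next
        fix x assume "x \<in> Ob (Hom K P B)"
        then show "FO (\<Phi> B) x \<in> Ob (functor_cat walking_arrow (Hom K T B))"
          using arrow_functor_is_functor[OF cTB] \<eta>[OF B] by (simp add: \<Phi>_def functor_cat_def)
      next
        fix X assume "X \<in> Ob (functor_cat walking_arrow (Hom K T B))"
        then have X: "is_functor walking_arrow (Hom K T B) X" by (simp add: functor_cat_def)
        note X' = functor_eq_arrow_functor[OF X]
        obtain x where "x \<in> Ob (Hom K P B)" "\<eta> B x = FA X (False, True)"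
          using one[OF B X'(2)] unfolding \<eta>_def by blast
        then have "FO (\<Phi> B) x = X" using X'(1)[symmetric] by (simp add: \<Phi>_def)
        with \<open>x \<in> _\<close> show "\<exists>x \<in> Ob (Hom K P B). X = FO (\<Phi> B) x" by blast
      qed
      show "bij_betw (FA (\<Phi> B)) (Ar (Hom K P B)) (Ar (functor_cat walking_arrow (Hom K T B)))"
      proof (rule bij_betwI')
        fix x y assume "x \<in> Ar (Hom K P B)" "y \<in> Ar (Hom K P B)"
        then show "(FA (\<Phi> B) x = FA (\<Phi> B) y) = (x = y)"
          using sq_inj by (auto simp: \<Phi>_def)
      next
        fix x assume "x \<in> Ar (Hom K P B)"
        then show "FA (\<Phi> B) x \<in> Ar (functor_cat walking_arrow (Hom K T B))"
          using sq[OF B] by (simp add: \<Phi>_def functor_cat_def)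
      next
        fix \<tau> assume "\<tau> \<in> Ar (functor_cat walking_arrow (Hom K T B))"
        then have \<tau>: "is_ntrans walking_arrow (Hom K T B) \<tau>" by (simp add: functor_cat_def)
        let ?a = "FA (NSrc \<tau>) (False, True)" and ?b = "FA (NTgt \<tau>) (False, True)"
        note t = ntrans_eq_square[OF \<tau>]
        obtain x where x: "x \<in> Ob (Hom K P B)" "\<eta> B x = ?a" using one[OF B t(2)] unfolding \<eta>_def by blast
        obtain y where y: "y \<in> Ob (Hom K P B)" "\<eta> B y = ?b" using one[OF B t(3)] unfolding \<eta>_def by blast
        have "\<exists>!\<xi>. \<xi> \<in> hom (Hom K P B) x y \<and> comp2 T P B \<xi> (Ide (Hom K T P) d0) = NMap \<tau> False \<and>
          comp2 T P B \<xi> (Ide (Hom K T P) d1) = NMap \<tau> True"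
          by (rule two[OF B x(1) y(1), folded \<eta>_def])
            (use t(4-10) x(2) y(2) \<eta>[OF B x(1)] \<eta>[OF B y(1)] in \<open>simp_all add: hom_iff\<close>)
        then obtain \<xi> where "\<xi> \<in> Ar (Hom K P B)" "Dom (Hom K P B) \<xi> = x" "Cod (Hom K P B) \<xi> = y"
          "comp2 T P B \<xi> (Ide (Hom K T P) d0) = NMap \<tau> False" "comp2 T P B \<xi> (Ide (Hom K T P) d1) = NMap \<tau> True"
          by (auto simp: hom_iff)
        then show "\<exists>\<xi> \<in> Ar (Hom K P B). \<tau> = FA (\<Phi> B) \<xi>"
          using t(1) x(2) y(2) by (intro bexI[of _ \<xi>]) (simp_all add: \<Phi>_def sq_def)
      qed
    qed
  qed
  \<comment> \<open>Associativity, b (\<xi> \<zeta>) = (b \<xi>) \<zeta>. Naturality in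
    \<open>B\<close> follows by taking \<theta> and the identities of \<open>d0\<close> and
    \<open>d1\<close> for \<zeta>.\<close>
  have post: "FA (postcomp1 K T B B' b) (comp2 T P B \<xi> \<zeta>) = comp2 T P B' (comp2 P B B' (Ide (Hom K B B') b) \<xi>) \<zeta>"
    if "B \<in> Obj K" "B' \<in> Obj K" "b \<in> Ob (Hom K B B')" "\<xi> \<in> Ar (Hom K P B)" "\<zeta> \<in> Ar (Hom K T P)" for B B' b \<xi> \<zeta>
    using that assoc2[OF T P that(1,2), of \<zeta> \<xi> "Ide (Hom K B B') b"] comp2_Ar(1)[OF T P that(1,4,5)]
      category.id_ar(1)[OF Hom_category[OF that(1,2)] that(3)]
    by (simp add: postcomp1_def)
  have nat\<eta>: "FA (postcomp1 K T B B' b) (\<eta> B x) = \<eta> B' (comp1 P B B' b x)"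
    if "B \<in> Obj K" "B' \<in> Obj K" "b \<in> Ob (Hom K B B')" "x \<in> Ob (Hom K P B)" for B B' b x
    using post[OF that(1-3) _ \<theta>, of "Ide (Hom K P B) x"] comp2_Ide[OF P that]
      category.id_ar(1)[OF Hom_category[OF P that(1)] that(4)] by (simp add: \<eta>_def)
  let ?S = "comp_two_functor K (exp_two_functor walking_arrow) (hom_two_functor K T)"
  have nat1: "func_comp (Hom K P B) (\<Phi> B') (postcomp1 K P B B' b) = func_comp (Hom K P B) (FO (THom ?S B B') b) (\<Phi> B)"
    if B: "B \<in> Obj K" "B' \<in> Obj K" and b: "b \<in> Ob (Hom K B B')" for B B' b
  proof -
    interpret PB: category "Hom K P B" using P B(1) by (rule Hom_category)
    interpret BB: category "Hom K B B'" using B by (rule Hom_category)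
    have cTB: "category (Hom K T B)" using T B(1) by (rule Hom_category)
    note \<Phi>f = iso[OF B(1), unfolded is_iso_functor_def, THEN conjunct1]
    note pf = postcomp_functorial(1)[OF T B b] and pfP = postcomp_functorial(1)[OF P B b]
    note S = exp_hom_two_functor_simps[OF T B, where J = walking_arrow]
    have "FO (\<Phi> B') (FO (postcomp1 K P B B' b) x) = FO (FO (THom ?S B B') b) (FO (\<Phi> B) x)" if x: "x \<in> Ob (Hom K P B)" for x
    proof -
      have "FO (\<Phi> B') (FO (postcomp1 K P B B' b) x) = arrow_functor (Hom K T B') (\<eta> B' (comp1 P B B' b x))"
        using functorD(1)[OF pfP x] x by (simp add: \<Phi>_def postcomp1_def)
      also have "\<dots> = func_comp walking_arrow (postcomp1 K T B B' b) (FO (\<Phi> B) x)"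
        using func_comp_arrow_functor[OF pf cTB \<eta>(1)[OF B(1) x]] nat\<eta>[OF B b x] x by (simp add: \<Phi>_def)
      also have "\<dots> = FO (FO (THom ?S B B') b) (FO (\<Phi> B) x)" by (rule S(2)[OF b functorD(1)[OF \<Phi>f x], symmetric])
      finally show ?thesis .
    qed
    moreover have "FA (\<Phi> B') (FA (postcomp1 K P B B' b) \<xi>) = FA (FO (THom ?S B B') b) (FA (\<Phi> B) \<xi>)" if x: "\<xi> \<in> Ar (Hom K P B)" for \<xi>
    proof -
      note l = leg(1)[OF B(1) x d(1)] leg(1)[OF B(1) x d(2)]
      have dc: "Dom (Hom K P B) \<xi> \<in> Ob (Hom K P B)" "Cod (Hom K P B) \<xi> \<in> Ob (Hom K P B)" using x by simp_all
      note fd = functorD(2-4)[OF pfP x]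
      have p: "FA (postcomp1 K P B B' b) \<xi> = comp2 P B B' (Ide (Hom K B B') b) \<xi>" using x by (simp add: postcomp1_def)
      have "FA (\<Phi> B') (FA (postcomp1 K P B B' b) \<xi>) = sq B' (FA (postcomp1 K P B B' b) \<xi>)"
        using fd by (simp add: \<Phi>_def)
      also have "\<dots> = whisker_left walking_arrow (postcomp1 K T B B' b) (sq B \<xi>)"
        unfolding sq_def square_def whisker_left_def fd(2,3)
        using func_comp_arrow_functor[OF pf cTB \<eta>(1)[OF B(1) dc(1)]] func_comp_arrow_functor[OF pf cTB \<eta>(1)[OF B(1) dc(2)]]
          post[OF B b x] d dc nat\<eta>[OF B b dc(1)] nat\<eta>[OF B b dc(2)]
        by (simp add: p fun_eq_iff) (simp add: postcomp1_def)
      also have "\<dots> = FA (FO (THom ?S B B') b) (FA (\<Phi> B) \<xi>)"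
        using S(3)[OF b functorD(2)[OF \<Phi>f x]] x by (simp add: \<Phi>_def)
      finally show ?thesis .
    qed
    ultimately show ?thesis unfolding func_comp_def by (auto intro!: restrict_ext)
  qed
  have nat2: "whisker_left (Hom K P B) (\<Phi> B') (postcomp2 K P B B' \<beta>) = whisker_right (Hom K P B) (FA (THom ?S B B') \<beta>) (\<Phi> B)"
    if B: "B \<in> Obj K" "B' \<in> Obj K" and \<beta>: "\<beta> \<in> Ar (Hom K B B')" for B B' \<beta>
  proof -
    interpret PB: category "Hom K P B" using P B(1) by (rule Hom_category)
    interpret BB: category "Hom K B B'" using B by (rule Hom_category)
    have cTB: "category (Hom K T B)" using T B(1) by (rule Hom_category)
    note S = exp_hom_two_functor_simps[OF T B, where J = walking_arrow]
    note \<Phi>f = iso[OF B(1), unfolded is_iso_functor_def, THEN conjunct1]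
    have dc: "Dom (Hom K B B') \<beta> \<in> Ob (Hom K B B')" "Cod (Hom K B B') \<beta> \<in> Ob (Hom K B B')" using \<beta> by simp_all
    note pf = postcomp_functorial(1)[OF T B]
    have "FA (\<Phi> B') (NMap (postcomp2 K P B B' \<beta>) x) = NMap (FA (THom ?S B B') \<beta>) (FO (\<Phi> B) x)" if x: "x \<in> Ob (Hom K P B)" for x
    proof -
      let ?\<beta>x = "comp2 P B B' \<beta> (Ide (Hom K P B) x)"
      have ix: "Ide (Hom K P B) x \<in> Ar (Hom K P B)" using x by simp
      note bx = comp2_Ar[OF P B \<beta> ix]
      have as: "comp2 T P B' ?\<beta>x (Ide (Hom K T P) f) = comp2 T B B' \<beta> (Ide (Hom K T B) (comp1 T P B x f))"
        if "f \<in> Ob (Hom K T P)" for f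
        using assoc2[OF T P B TP.id_ar(1)[OF that] ix \<beta>] comp2_Ide[OF T P B(1) x that] by simp
      have "FA (\<Phi> B') (NMap (postcomp2 K P B B' \<beta>) x) = sq B' ?\<beta>x"
        using bx(1) x by (simp add: \<Phi>_def postcomp2_def)
      also have "\<dots> = whisker_right walking_arrow (postcomp2 K T B B' \<beta>) (FO (\<Phi> B) x)"
        unfolding sq_def square_def whisker_right_def bx(2,3)
        using func_comp_arrow_functor[OF pf cTB \<eta>(1)[OF B(1) x]] as[OF d(1)] as[OF d(2)] dc x \<eta>[OF B(1) x]
          nat\<eta>[OF B _ x] comp1_Ob[OF T P B(1) x d(1)] comp1_Ob[OF T P B(1) x d(2)]
        by (simp add: \<Phi>_def fun_eq_iff) (simp add: postcomp2_def)
      also have "\<dots> = NMap (FA (THom ?S B B') \<beta>) (FO (\<Phi> B) x)"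
        by (rule S(4)[OF \<beta> functorD(1)[OF \<Phi>f x], symmetric])
      finally show ?thesis .
    qed
    \<comment> \<open>The components agree; the sources and targets recorded in the two
      transformations agree by \<open>nat1\<close> at the source and the target of \<beta>.\<close>
    then show ?thesis
      using nat1[OF B dc(1)] nat1[OF B dc(2)] S(5,6)[OF \<beta>]
      by (simp add: whisker_left_def whisker_right_def cong: restrict_cong) (simp add: postcomp2_def)
  qed
  have "is_two_natural_iso K (hom_two_functor K P) ?S \<Phi>"
    unfolding is_two_natural_iso_def
    using iso nat1 nat2 exp_hom_two_functor_simps(1)[OF T _ P, where J = walking_arrow]
    by (simp add: hom_two_functor_simps)
  then show ?thesis using P by (auto simp: is_copower_def)
qed

end

text \<open>The naturality of the copower isomorphism at \<open>b\<close> shows that \<open>K(P, b)\<close> is determined by \<open>K(T, b)\<close>.\<close>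

lemma (in two_category) copower_postcomp1_eq:
  assumes T: "T \<in> Obj K" and cop: "is_copower K J T P" and B: "B \<in> Obj K" "B' \<in> Obj K"
    and b: "b \<in> Ob (Hom K B B')" "b' \<in> Ob (Hom K B B')"
    and eq: "postcomp1 K T B B' b = postcomp1 K T B B' b'"
  shows "postcomp1 K P B B' b = postcomp1 K P B B' b'"
proof -
  let ?S = "comp_two_functor K (exp_two_functor J) (hom_two_functor K T)"
  obtain \<Phi> where P: "P \<in> Obj K" and \<Phi>: "is_two_natural_iso K (hom_two_functor K P) ?S \<Phi>"
    using cop by (auto simp: is_copower_def)
  interpret PB: category "Hom K P B" using P B(1) by (rule Hom_category)
  note S = exp_hom_two_functor_simps[OF T B, where J = J]
  have nat: "func_comp (Hom K P B) (\<Phi> B') (postcomp1 K P B B' c) = func_comp (Hom K P B) (FO (THom ?S B B') c) (\<Phi> B)"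
    if "c \<in> Ob (Hom K B B')" for c
    using \<Phi> B that by (simp add: is_two_natural_iso_def hom_two_functor_simps)
  have iso: "is_iso_functor (Hom K P D) (TO ?S D) (\<Phi> D)" if "D \<in> Obj K" for D
    using \<Phi> that by (simp add: is_two_natural_iso_def hom_two_functor_simps)
  have F: "is_functor (Hom K P B) (functor_cat J (Hom K T B)) (\<Phi> B)"
    using iso[OF B(1)] S(1) by (simp add: is_iso_functor_def)
  obtain \<Psi> where inv: "func_comp (Hom K P B') \<Psi> (\<Phi> B') = func_id (Hom K P B')"
    using iso[OF B(2)] by (auto simp: is_iso_functor_def)
  \<comment> \<open>On functors and transformations from \<open>J\<close> to K(T, B), the value of
    the exponential 2-functor at \<open>b\<close> depends on \<open>b\<close> only through
    \<open>postcomp1 K T B B' b\<close>, and \<Phi> takes its values there.\<close>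
  have "func_comp (Hom K P B) (FO (THom ?S B B') b) (\<Phi> B) = func_comp (Hom K P B) (FO (THom ?S B B') b') (\<Phi> B)"
    using S(2,3)[OF b(1)] S(2,3)[OF b(2)] functorD(1,2)[OF F] eq
    by (auto simp: func_comp_def intro!: restrict_ext)
  then have e: "func_comp (Hom K P B) (\<Phi> B') (postcomp1 K P B B' b) = func_comp (Hom K P B) (\<Phi> B') (postcomp1 K P B B' b')"
    using nat b by simp
  have cancel: "func_comp (Hom K P B) \<Psi> (func_comp (Hom K P B) (\<Phi> B') F) = F"
    if "is_functor (Hom K P B) (Hom K P B') F" for F
  proof (rule func_eqI[of _ "Ob (Hom K P B)" _ "Ar (Hom K P B)"])
    note f = functorD[OF that]
    have o: "FO \<Psi> (FO (\<Phi> B') y) = y" if "y \<in> Ob (Hom K P B')" for y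
      using arg_cong[OF inv, of "\<lambda>G. FO G y"] that by (simp add: func_comp_def func_id_def)
    have a: "FA \<Psi> (FA (\<Phi> B') y) = y" if "y \<in> Ar (Hom K P B')" for y
      using arg_cong[OF inv, of "\<lambda>G. FA G y"] that by (simp add: func_comp_def func_id_def)
    show "FO F \<in> extensional (Ob (Hom K P B))" "FA F \<in> extensional (Ar (Hom K P B))" using f by simp_all
    show "FO (func_comp (Hom K P B) \<Psi> (func_comp (Hom K P B) (\<Phi> B') F)) x = FO F x" if "x \<in> Ob (Hom K P B)" for x
      using that f(1) o by (simp add: func_comp_def)
    show "FA (func_comp (Hom K P B) \<Psi> (func_comp (Hom K P B) (\<Phi> B') F)) x = FA F x" if "x \<in> Ar (Hom K P B)" for x
      using that f(2) a by (simp add: func_comp_def)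
  qed (simp_all add: func_comp_def)
  show ?thesis
    using cancel[OF postcomp_functorial(1)[OF P B b(1)]] cancel[OF postcomp_functorial(1)[OF P B b(2)]] e by metis
qed

section \<open>Internal categories\<close>

context pbcat
begin

text \<open>The same relation as \<open>icat.cp\<close>, whose defining equation is available only
  once \<open>A\<close> is known to be an internal category. This version can be used while
  \<open>is_icat\<close> is being proved.\<close>

definition composable :: "('o, 'a) icat \<Rightarrow> 'a \<Rightarrow> 'a \<Rightarrow> bool" where
  "composable A g f \<longleftrightarrow> g \<in> Ar E \<and> f \<in> Ar E \<and> Cod E g = IAr A \<and> Cod E f = IAr A \<and> Dom E g = Dom E f \<and>
     ISrc A \<bullet> g = ITgt A \<bullet> f"

lemma cp_iff_composable: "is_icat E A \<Longrightarrow> icat.cp E A g f \<longleftrightarrow> composable A g f"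
  by (simp add: icat.cp_def[OF icat] composable_def)

text \<open>\<open>is_icat\<close> states the unit and associativity laws at universal elements: the
  identity of the object of arrows and the projections from the pullbacks. They are instances of the
  laws for all generalised elements, and in that form the laws can be proved by cases.\<close>

lemma icatI:
  assumes ar: "ISrc A \<in> Ar E" "Dom E (ISrc A) = IAr A" "Cod E (ISrc A) = IOb A"
    "ITgt A \<in> Ar E" "Dom E (ITgt A) = IAr A" "Cod E (ITgt A) = IOb A"
    "IId A \<in> Ar E" "Dom E (IId A) = IOb A" "Cod E (IId A) = IAr A"
    "IComp A \<in> Ar E" "Dom E (IComp A) = pb_ob E (ISrc A) (ITgt A)" "Cod E (IComp A) = IAr A"
    "ISrc A \<bullet> IId A = Ide E (IOb A)" "ITgt A \<bullet> IId A = Ide E (IOb A)"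
    and src: "\<And>g f. composable A g f \<Longrightarrow> ISrc A \<bullet> icomp E A g f = ISrc A \<bullet> f"
    and tgt: "\<And>g f. composable A g f \<Longrightarrow> ITgt A \<bullet> icomp E A g f = ITgt A \<bullet> g"
    and unit_l: "\<And>f. f \<in> Ar E \<Longrightarrow> Cod E f = IAr A \<Longrightarrow> icomp E A (IId A \<bullet> (ITgt A \<bullet> f)) f = f"
    and unit_r: "\<And>f. f \<in> Ar E \<Longrightarrow> Cod E f = IAr A \<Longrightarrow> icomp E A f (IId A \<bullet> (ISrc A \<bullet> f)) = f"
    and assoc: "\<And>h g f. composable A h g \<Longrightarrow> composable A g f \<Longrightarrow>
      icomp E A (icomp E A h g) f = icomp E A h (icomp E A g f)"
  shows "is_icat E A"
proof -
  let ?p = "pb_p1 E (ISrc A) (ITgt A)" and ?q = "pb_p2 E (ISrc A) (ITgt A)"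
  have ob: "IOb A \<in> Ob E" "IAr A \<in> Ob E" using ar(1-3) by (metis E.dom_ob E.cod_ob)+
  have cod: "Cod E (ISrc A) = Cod E (ITgt A)" using ar by simp
  note pq = pr[OF ar(1,4) cod]
  have pq_comp: "composable A ?p ?q" using pq ar by (simp add: composable_def)
  have pw: "IComp A \<bullet> w = icomp E A (?p \<bullet> w) (?q \<bullet> w)" if "w \<in> Ar E" "Cod E w = pb_ob E (ISrc A) (ITgt A)" for w
    using pair_eq[OF ar(1,4) cod that refl refl] by (simp add: icomp_def)
  have IC: "IComp A = icomp E A ?p ?q"
    using pw[of "Ide E (pb_ob E (ISrc A) (ITgt A))"] pq ar(10,11) by (simp add: E.id_r)
  have qp: "?q \<in> Ar E" "?p \<in> Ar E" "Cod E ?q = Cod E ?p" using pq ar by simp_all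
  note rs = pr[OF qp]
  let ?r = "pb_p1 E ?q ?p" and ?s = "pb_p2 E ?q ?p"
  have r: "composable A (?p \<bullet> ?r) (?q \<bullet> ?r)" "composable A (?q \<bullet> ?r) (?q \<bullet> ?s)"
    using pq rs ar by (simp_all add: composable_def E.comp_assoc[symmetric], simp add: E.comp_assoc)
  have "icomp E A (IComp A \<bullet> ?r) (?q \<bullet> ?s) = icomp E A (?p \<bullet> ?r) (IComp A \<bullet> ?s)"
    using assoc[OF r] pw[of ?r] pw[of ?s] rs pq by simp
  moreover have "icomp E A (IId A \<bullet> ITgt A) (Ide E (IAr A)) = Ide E (IAr A)"
    "icomp E A (Ide E (IAr A)) (IId A \<bullet> ISrc A) = Ide E (IAr A)"
    using unit_l[of "Ide E (IAr A)"] unit_r[of "Ide E (IAr A)"] ob ar by (simp_all add: E.id_r)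
  ultimately show ?thesis
    using ob ar src[OF pq_comp] tgt[OF pq_comp] unfolding is_icat_def Let_def hom_iff IC[symmetric] by blast
qed

text \<open>Composition is stable under a change \<open>w\<close> of the domain. Only the domains
  and codomains of the structure maps enter, so the law is at hand before the category axioms are
  established.\<close>

lemma icomp_comp:
  assumes "ISrc A \<in> Ar E" "Dom E (ISrc A) = IAr A" "Cod E (ISrc A) = IOb A"
    "ITgt A \<in> Ar E" "Dom E (ITgt A) = IAr A" "Cod E (ITgt A) = IOb A"
    "IComp A \<in> Ar E" "Dom E (IComp A) = pb_ob E (ISrc A) (ITgt A)" "Cod E (IComp A) = IAr A"
    and gf: "composable A g f"
  shows "icomp E A g f \<in> Ar E" "Dom E (icomp E A g f) = Dom E f" "Cod E (icomp E A g f) = IAr A"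
    "w \<in> Ar E \<Longrightarrow> Cod E w = Dom E f \<Longrightarrow> icomp E A g f \<bullet> w = icomp E A (g \<bullet> w) (f \<bullet> w)"
    "w \<in> Ar E \<Longrightarrow> Cod E w = Dom E f \<Longrightarrow> composable A (g \<bullet> w) (f \<bullet> w)"
proof -
  have c: "cmp (ISrc A) (ITgt A) g f" using assms by (simp add: composable_def cmp_def)
  note p = pair[OF c] and gf' = gf[unfolded composable_def]
  show "icomp E A g f \<in> Ar E" "Dom E (icomp E A g f) = Dom E f" "Cod E (icomp E A g f) = IAr A"
    using p assms(7-9) gf' by (simp_all add: icomp_def)
  show "w \<in> Ar E \<Longrightarrow> Cod E w = Dom E f \<Longrightarrow> icomp E A g f \<bullet> w = icomp E A (g \<bullet> w) (f \<bullet> w)"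
    using p assms(7-9) gf' pair_comp[OF c, of w] by (simp add: icomp_def E.comp_assoc)
  show "w \<in> Ar E \<Longrightarrow> Cod E w = Dom E f \<Longrightarrow> composable A (g \<bullet> w) (f \<bullet> w)"
    using assms(1-6) gf' by (simp add: composable_def E.comp_assoc[symmetric])
qed

subsection \<open>Discrete internal categories\<close>

text \<open>Composable pairs in a discrete category are pairs of equal elements, so a projection
  from the pullback serves as composition.\<close>

definition disc_icat :: "'o \<Rightarrow> ('o, 'a) icat" where
  "disc_icat X = \<lparr>IOb = X, IAr = X, ISrc = Ide E X, ITgt = Ide E X, IId = Ide E X,
     IComp = pb_p1 E (Ide E X) (Ide E X)\<rparr>"

lemma disc_icat_simps [simp]:
  "IOb (disc_icat X) = X" "IAr (disc_icat X) = X" "ISrc (disc_icat X) = Ide E X" "ITgt (disc_icat X) = Ide E X"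
  "IId (disc_icat X) = Ide E X" "IComp (disc_icat X) = pb_p1 E (Ide E X) (Ide E X)"
  by (simp_all add: disc_icat_def)

lemma disc_composable:
  assumes "X \<in> Ob E" "composable (disc_icat X) g f"
  shows "g = f" "icomp E (disc_icat X) g f = f"
proof -
  have c: "cmp (Ide E X) (Ide E X) g f" using assms by (simp add: composable_def cmp_def)
  show "g = f" using assms unfolding composable_def by (metis E.id_l disc_icat_simps(2,3,4))
  then show "icomp E (disc_icat X) g f = f" using pair[OF c] by (simp add: icomp_def)
qed

lemma disc_composable_refl:
  assumes "X \<in> Ob E" "f \<in> Ar E" "Cod E f = X"
  shows "composable (disc_icat X) f f"
  using assms by (simp add: composable_def)

lemma is_icat_disc: assumes "X \<in> Ob E" shows "is_icat E (disc_icat X)"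
proof (rule icatI, goal_cases)
  case (15 g f) then show ?case using disc_composable[OF assms] by simp
next
  case (16 g f) then show ?case using disc_composable[OF assms 16] by simp
next
  case (17 f) then show ?case using disc_composable[OF assms disc_composable_refl[OF assms]] assms by (simp add: E.id_l)
next
  case (18 f) then show ?case using disc_composable[OF assms disc_composable_refl[OF assms]] assms by (simp add: E.id_l)
next
  case (19 h g f) then show ?case using disc_composable[OF assms 19(1)] disc_composable[OF assms 19(2)] by simp
qed (use assms pr[of "Ide E X" "Ide E X"] in \<open>simp_all add: E.id_l\<close>)

text \<open>For \<open>x : X -> IOb B\<close>, this is the functor from \<open>disc_icat X\<close>
  to \<open>B\<close> with object part \<open>x\<close>. Since every arrow of a discrete category is
  an identity, the arrow part is forced.\<close>

definition point_ifunc :: "('o, 'a) icat \<Rightarrow> 'a \<Rightarrow> 'a ifunc" where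
  "point_ifunc B x = \<lparr>IFO = x, IFA = IId B \<bullet> x\<rparr>"

lemma point_ifunc_simps [simp]: "IFO (point_ifunc B x) = x" "IFA (point_ifunc B x) = IId B \<bullet> x"
  by (simp_all add: point_ifunc_def)

lemma is_ifunc_point:
  assumes B: "is_icat E B" and x: "x \<in> Ar E" "Dom E x = X" "Cod E x = IOb B"
  shows "is_ifunc E (disc_icat X) B (point_ifunc B x)"
proof -
  interpret B: icat E B by (rule icat) fact
  have X: "X \<in> Ob E" using x by auto
  have st: "ISrc B \<bullet> (IId B \<bullet> y) = y" "ITgt B \<bullet> (IId B \<bullet> y) = y" if "y \<in> Ar E" "Cod E y = IOb B" for y
    using that B.A' by (simp_all add: E.comp_assoc[symmetric] E.id_l)
  show ?thesis
  proof (rule ifuncI[OF is_icat_disc[OF X] B])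
    fix g f assume "icat.cp E (disc_icat X) g f"
    then have gf: "composable (disc_icat X) g f" using cp_iff_composable[OF is_icat_disc[OF X]] by simp
    have f: "f \<in> Ar E" "Cod E f = X" using gf by (simp_all add: composable_def)
    have "B.m (IId B \<bullet> (x \<bullet> f)) (IId B \<bullet> (x \<bullet> f)) = IId B \<bullet> (x \<bullet> f)"
      using B.m_unit(1)[of "IId B \<bullet> (x \<bullet> f)"] x f B.A' st by simp
    then show "IFA (point_ifunc B x) \<bullet> icomp E (disc_icat X) g f = B.m (IFA (point_ifunc B x) \<bullet> g) (IFA (point_ifunc B x) \<bullet> f)"
      using disc_composable[OF X gf] x f B.A' by (simp add: E.comp_assoc)
  qed (use x X B.A' st in \<open>simp_all add: E.id_r E.comp_assoc\<close>)
qed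

lemma ifunc_disc_eq_point:
  assumes B: "is_icat E B" and X: "X \<in> Ob E" and F: "is_ifunc E (disc_icat X) B F"
  shows "F = point_ifunc B (IFO F)"
  using ifuncD(4,5,9)[OF is_icat_disc[OF X] B F] by (cases F) (simp add: point_ifunc_def E.id_r)

text \<open>Both functors send every arrow to an identity, so naturality reduces to the two unit
  laws of \<open>B\<close> at \<open>a\<close>.\<close>

lemma is_intrans_point:
  assumes B: "is_icat E B" and a: "a \<in> Ar E" "Dom E a = X" "Cod E a = IAr B"
  shows "is_intrans E (disc_icat X) B
    \<lparr>INSrc = point_ifunc B (ISrc B \<bullet> a), INTgt = point_ifunc B (ITgt B \<bullet> a), INMap = a\<rparr>"
proof -
  interpret B: icat E B by (rule icat) fact
  have X: "X \<in> Ob E" using a by auto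
  show ?thesis
    by (rule intransI[OF is_icat_disc[OF X] B])
      (use is_ifunc_point[OF B] a B.A' B.m_unit[OF a(1,3)] in \<open>simp_all add: E.id_r\<close>)
qed

lemma is_ifunc_disc:
  assumes f: "f \<in> Ar E" "Dom E f = X" "Cod E f = Y"
  shows "is_ifunc E (disc_icat X) (disc_icat Y) \<lparr>IFO = f, IFA = f\<rparr>"
proof -
  have Y: "Y \<in> Ob E" using f by auto
  have "point_ifunc (disc_icat Y) f = \<lparr>IFO = f, IFA = f\<rparr>" using f by (simp add: point_ifunc_def E.id_l)
  then show ?thesis using is_ifunc_point[OF is_icat_disc[OF Y], of f X] f by simp
qed

subsection \<open>The 2-category of internal categories\<close>

lemma ifunc_cat_simps [simp]:
  "Ob (ifunc_cat E A B) = {F. is_ifunc E A B F}" "Ar (ifunc_cat E A B) = {\<alpha>. is_intrans E A B \<alpha>}"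
  "Dom (ifunc_cat E A B) = INSrc" "Cod (ifunc_cat E A B) = INTgt"
  "Ide (ifunc_cat E A B) F = \<lparr>INSrc = F, INTgt = F, INMap = IId B \<bullet> IFO F\<rparr>"
  "\<beta> \<cdot>\<^bsub>ifunc_cat E A B\<^esub> \<alpha> = \<lparr>INSrc = INSrc \<alpha>, INTgt = INTgt \<beta>, INMap = icomp E B (INMap \<beta>) (INMap \<alpha>)\<rparr>"
  by (simp_all add: ifunc_cat_def)

lemma Cat_internal_simps [simp]:
  "Obj (Cat_internal E) = {A. is_icat E A}" "Hom (Cat_internal E) = ifunc_cat E"
  by (simp_all add: Cat_internal_def)

lemma Hcomp_Cat_internal:
  "is_ifunc E B C G \<Longrightarrow> is_ifunc E A B F \<Longrightarrow> FO (Hcomp (Cat_internal E) A B C) (G, F) = ifunc_comp E G F"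
  "is_intrans E B C \<beta> \<Longrightarrow> is_intrans E A B \<alpha> \<Longrightarrow> FA (Hcomp (Cat_internal E) A B C) (\<beta>, \<alpha>) = intrans_hcomp E C \<beta> \<alpha>"
  by (simp_all add: Cat_internal_def prod_cat_def)

text \<open>In the composite that defines \<open>intrans_hcomp\<close>, the factor contributed by
  the identity 2-cell is an identity arrow of \<open>C\<close>, and the unit law removes it.\<close>

lemma hcomp_Ide_left:
  assumes "is_icat E A" "is_icat E B" "is_icat E C" "is_ifunc E B C F" "is_intrans E A B \<alpha>"
  shows "FA (Hcomp (Cat_internal E) A B C) (\<lparr>INSrc = F, INTgt = F, INMap = IId C \<bullet> IFO F\<rparr>, \<alpha>) =
    \<lparr>INSrc = ifunc_comp E F (INSrc \<alpha>), INTgt = ifunc_comp E F (INTgt \<alpha>), INMap = IFA F \<bullet> INMap \<alpha>\<rparr>"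
proof -
  interpret C: icat E C by (rule icat) fact
  interpret B: icat E B by (rule icat) fact
  note F = ifuncD[OF assms(2,3,4)] and a = intransD[OF assms(1,2,5)]
  have "ITgt C \<bullet> (IFA F \<bullet> INMap \<alpha>) = (ITgt C \<bullet> IFA F) \<bullet> INMap \<alpha>"
    using F(1-6) a(3-5) C.A' by (simp add: E.comp_assoc)
  also have "\<dots> = IFO F \<bullet> IFO (INTgt \<alpha>)"
    unfolding F(8) using F(1-6) a(3-7) B.A' by (simp add: E.comp_assoc)
  finally have t: "ITgt C \<bullet> (IFA F \<bullet> INMap \<alpha>) = IFO F \<bullet> IFO (INTgt \<alpha>)" .
  note G = ifuncD(1-3)[OF assms(1,2) a(2)]
  have "C.m (IId C \<bullet> IFO F \<bullet> IFO (INTgt \<alpha>)) (IFA F \<bullet> INMap \<alpha>) = IFA F \<bullet> INMap \<alpha>"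
    using C.m_unit(1)[of "IFA F \<bullet> INMap \<alpha>"] F(1-6) G a(3-5) C.A' t by (simp add: E.comp_assoc)
  then show ?thesis
    using Hcomp_Cat_internal(2)[OF iid[OF assms(2,3,4)] assms(5)] by (simp add: intrans_hcomp_def)
qed

lemma hcomp_Ide_right:
  assumes "is_icat E A" "is_icat E B" "is_icat E C" "is_ifunc E A B F" "is_intrans E B C \<beta>"
  shows "FA (Hcomp (Cat_internal E) A B C) (\<beta>, \<lparr>INSrc = F, INTgt = F, INMap = IId B \<bullet> IFO F\<rparr>) =
    \<lparr>INSrc = ifunc_comp E (INSrc \<beta>) F, INTgt = ifunc_comp E (INTgt \<beta>) F, INMap = INMap \<beta> \<bullet> IFO F\<rparr>"
proof -
  interpret C: icat E C by (rule icat) fact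
  interpret B: icat E B by (rule icat) fact
  note F = ifuncD[OF assms(1,2,4)] and b = intransD[OF assms(2,3,5)]
  note G = ifuncD[OF assms(2,3) b(1)]
  have "ISrc C \<bullet> (INMap \<beta> \<bullet> IFO F) = IFO (INSrc \<beta>) \<bullet> IFO F"
    using F(1-6) b(3-7) C.A' by (simp add: E.comp_assoc[symmetric])
  moreover have "IFA (INSrc \<beta>) \<bullet> (IId B \<bullet> IFO F) = IId C \<bullet> (IFO (INSrc \<beta>) \<bullet> IFO F)"
    using F(1-6) G(1-6,9) B.A' C.A' by (metis E.comp_assoc)
  ultimately have "C.m (INMap \<beta> \<bullet> IFO F) (IFA (INSrc \<beta>) \<bullet> (IId B \<bullet> IFO F)) = INMap \<beta> \<bullet> IFO F"
    using C.m_unit(2)[of "INMap \<beta> \<bullet> IFO F"] F(1-6) b(3-5) by simp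
  then show ?thesis
    using Hcomp_Cat_internal(2)[OF assms(5) iid[OF assms(1,2,4)]] by (simp add: intrans_hcomp_def)
qed

end

section \<open>The internal walking arrow\<close>

context extensive_category
begin

definition copair :: "'o \<Rightarrow> 'o \<Rightarrow> 'a \<Rightarrow> 'a \<Rightarrow> 'a" where
  "copair A B f g = (THE u. u \<in> Ar E \<and> Dom E u = coprod A B \<and> Cod E u = Cod E f \<and>
     u \<bullet> inl A B = f \<and> u \<bullet> inr A B = g)"

lemma copair:
  assumes f: "f \<in> Ar E" "Dom E f = A" and g: "g \<in> Ar E" "Dom E g = B" "Cod E g = Cod E f"
  shows "copair A B f g \<in> Ar E" "Dom E (copair A B f g) = coprod A B" "Cod E (copair A B f g) = Cod E f"
    "copair A B f g \<bullet> inl A B = f" "copair A B f g \<bullet> inr A B = g"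
proof -
  have ob: "A \<in> Ob E" "B \<in> Ob E" using f g by auto
  note c = coprod_is_coproduct[OF ob]
  obtain u where u: "u \<in> Ar E" "Dom E u = coprod A B" "Cod E u = Cod E f" "u \<bullet> inl A B = f" "u \<bullet> inr A B = g"
    by (rule E.coproduct_copair[OF c f refl g])
  have "copair A B f g = u"
    unfolding copair_def
    by (rule the_equality) (use u E.coproduct_eqI[OF c _ u(1) _ u(2)] in \<open>blast, metis\<close>)
  then show "copair A B f g \<in> Ar E" "Dom E (copair A B f g) = coprod A B" "Cod E (copair A B f g) = Cod E f"
    "copair A B f g \<bullet> inl A B = f" "copair A B f g \<bullet> inr A B = g" using u by simp_all
qed

lemma copair_eqI:
  assumes "A \<in> Ob E" "B \<in> Ob E" "u \<in> Ar E" "v \<in> Ar E" "Dom E u = coprod A B" "Dom E v = coprod A B" "Cod E u = Cod E v"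
    "u \<bullet> inl A B = v \<bullet> inl A B" "u \<bullet> inr A B = v \<bullet> inr A B"
  shows "u = v"
  by (rule E.coproduct_eqI[OF coprod_is_coproduct[OF assms(1,2)] assms(3-)])

text \<open>The product of the walking arrow with the discrete category on \<open>X\<close>. The two summands of the
  object of arrows consist of the non-identity arrows and of the identities.\<close>

definition arrow_icat :: "'o \<Rightarrow> ('o, 'a) icat" where
  "arrow_icat X = (let O2 = coprod X X; A = coprod X O2; s = copair X O2 (inl X X) (Ide E O2);
       t = copair X O2 (inr X X) (Ide E O2); p = pb_p1 E s t; q = pb_p2 E s t
     in \<lparr>IOb = O2, IAr = A, ISrc = s, ITgt = t, IId = inr X O2,
         IComp = (SOME c. c \<in> Ar E \<and> Dom E c = Dom E q \<and> Cod E c = A \<and>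
           (\<forall>w u. w \<in> Ar E \<and> Cod E w = Dom E q \<and> u \<in> Ar E \<and> Dom E u = Dom E w \<and> Cod E u = X \<and>
              q \<bullet> w = inl X O2 \<bullet> u \<longrightarrow> c \<bullet> w = q \<bullet> w) \<and>
           (\<forall>w u. w \<in> Ar E \<and> Cod E w = Dom E q \<and> u \<in> Ar E \<and> Dom E u = Dom E w \<and> Cod E u = O2 \<and>
              q \<bullet> w = inr X O2 \<bullet> u \<longrightarrow> c \<bullet> w = p \<bullet> w))\<rparr>)"

lemma arrow_icat_simps:
  "IOb (arrow_icat X) = coprod X X" "IAr (arrow_icat X) = coprod X (coprod X X)"
  "ISrc (arrow_icat X) = copair X (coprod X X) (inl X X) (Ide E (coprod X X))"
  "ITgt (arrow_icat X) = copair X (coprod X X) (inr X X) (Ide E (coprod X X))"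
  "IId (arrow_icat X) = inr X (coprod X X)"
  by (simp_all add: arrow_icat_def Let_def)

end

text \<open>With an arbitrary \<open>X\<close> in place of 1 the construction yields the copower of
  \<open>disc_icat X\<close>; it is specialised to the terminal object only in the proof of
  2-well-pointedness.\<close>

locale arrow_icat = extensive_category E for E :: "('o, 'a) cat" +
  fixes X :: 'o
  assumes X: "X \<in> Ob E"
begin

abbreviation "P \<equiv> arrow_icat X"
abbreviation "O2 \<equiv> coprod X X"
abbreviation "j0 \<equiv> inl X X"
abbreviation "j1 \<equiv> inr X X"
abbreviation "u \<equiv> inl X O2"
abbreviation "e \<equiv> inr X O2"
abbreviation "s \<equiv> ISrc P"
abbreviation "t \<equiv> ITgt P"

lemma O2: "O2 \<in> Ob E" using coprodD(9)[OF X X] .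

lemma j: "j0 \<in> Ar E" "Dom E j0 = X" "Cod E j0 = O2" "j1 \<in> Ar E" "Dom E j1 = X" "Cod E j1 = O2"
  using coprodD[OF X X] by simp_all

lemma ue: "u \<in> Ar E" "Dom E u = X" "Cod E u = IAr P" "e \<in> Ar E" "Dom E e = O2" "Cod E e = IAr P"
  using coprodD[OF X O2] by (simp_all add: arrow_icat_simps)

lemma IAr: "IAr P = coprod X O2" "IOb P = O2" "IId P = e" by (simp_all add: arrow_icat_simps)

lemma st: "s \<in> Ar E" "Dom E s = IAr P" "Cod E s = O2" "s \<bullet> u = j0" "s \<bullet> e = Ide E O2"
  "t \<in> Ar E" "Dom E t = IAr P" "Cod E t = O2" "t \<bullet> u = j1" "t \<bullet> e = Ide E O2"
  using copair[of j0 X "Ide E O2" O2] copair[of j1 X "Ide E O2" O2] j O2 by (simp_all add: arrow_icat_simps)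

lemma st_comp:
  "w \<in> Ar E \<Longrightarrow> Cod E w = X \<Longrightarrow> s \<bullet> (u \<bullet> w) = j0 \<bullet> w" "w \<in> Ar E \<Longrightarrow> Cod E w = X \<Longrightarrow> t \<bullet> (u \<bullet> w) = j1 \<bullet> w"
  "w \<in> Ar E \<Longrightarrow> Cod E w = O2 \<Longrightarrow> s \<bullet> (e \<bullet> w) = w" "w \<in> Ar E \<Longrightarrow> Cod E w = O2 \<Longrightarrow> t \<bullet> (e \<bullet> w) = w"
  using st ue by (simp_all add: E.comp_assoc[symmetric] E.id_l)

lemma arrow_cases:
  assumes "h \<in> Ar E" "Cod E h = IAr P" "f \<in> Ar E" "g \<in> Ar E" "Dom E f = Dom E h" "Dom E g = Dom E h" "Cod E f = Cod E g"
    "\<And>w a. w \<in> Ar E \<Longrightarrow> Cod E w = Dom E h \<Longrightarrow> a \<in> Ar E \<Longrightarrow> Dom E a = Dom E w \<Longrightarrow> Cod E a = X \<Longrightarrow>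
      h \<bullet> w = u \<bullet> a \<Longrightarrow> f \<bullet> w = g \<bullet> w"
    "\<And>w b. w \<in> Ar E \<Longrightarrow> Cod E w = Dom E h \<Longrightarrow> b \<in> Ar E \<Longrightarrow> Dom E b = Dom E w \<Longrightarrow> Cod E b = O2 \<Longrightarrow>
      h \<bullet> w = e \<bullet> b \<Longrightarrow> f \<bullet> w = g \<bullet> w"
  shows "f = g"
  by (rule coprod_cases[OF X O2 assms(1) _ assms(3-9)]) (use assms(2) IAr in simp)

text \<open>A non-identity arrow has its source in the first copy of \<open>X\<close>, which
  disjointness rules out when the source is given in the second copy. Hence an arrow that can follow
  the non-identity arrow is an identity.\<close>

lemma arrow_eq_ident:
  assumes g: "g \<in> Ar E" "Cod E g = IAr P" and v: "v \<in> Ar E" "Cod E v = X" "Dom E v = Dom E g" and sg: "s \<bullet> g = j1 \<bullet> v"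
  shows "g = e \<bullet> (j1 \<bullet> v)"
proof (rule arrow_cases[OF g])
  note [simp] = E.comp_assoc
  fix w assume w: "w \<in> Ar E" "Cod E w = Dom E g"
  have sgw: "s \<bullet> (g \<bullet> w) = j1 \<bullet> (v \<bullet> w)"
    using arg_cong[OF sg, of "\<lambda>z. z \<bullet> w"] w g v st j by simp
  {
    fix a assume a: "a \<in> Ar E" "Dom E a = Dom E w" "Cod E a = X" "g \<bullet> w = u \<bullet> a"
    then have "j0 \<bullet> a = j1 \<bullet> (v \<bullet> w)" using sgw st_comp by simp
    then show "g \<bullet> w = e \<bullet> (j1 \<bullet> v) \<bullet> w"
      by (rule inl_inr_disjoint[OF X X, rotated 5]) (use a w v g ue j in simp_all)
  next
    fix b assume b: "b \<in> Ar E" "Dom E b = Dom E w" "Cod E b = O2" "g \<bullet> w = e \<bullet> b"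
    then have "b = j1 \<bullet> (v \<bullet> w)" using sgw st_comp by simp
    then show "g \<bullet> w = e \<bullet> (j1 \<bullet> v) \<bullet> w" using b(4) w v ue j by simp
  }
qed (use g v ue j in simp_all)

text \<open>A composable pair is (p, q), with \<open>q\<close> applied first. If \<open>q\<close> is
  the non-identity arrow, then \<open>p\<close> is an identity and the composite is
  \<open>q\<close>; if \<open>q\<close> is an identity, the composite is \<open>p\<close>. The
  existence of the arrow selected by \<open>SOME\<close> is \<open>coprod_if\<close> applied to the
  second projection.\<close>

lemma IComp:
  defines "p \<equiv> pb_p1 E s t" and "q \<equiv> pb_p2 E s t"
  shows "IComp P \<in> Ar E" "Dom E (IComp P) = pb_ob E s t" "Cod E (IComp P) = IAr P"
    "\<And>w a. w \<in> Ar E \<Longrightarrow> Cod E w = pb_ob E s t \<Longrightarrow> a \<in> Ar E \<Longrightarrow> Dom E a = Dom E w \<Longrightarrow> Cod E a = X \<Longrightarrow>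
      q \<bullet> w = u \<bullet> a \<Longrightarrow> IComp P \<bullet> w = q \<bullet> w"
    "\<And>w b. w \<in> Ar E \<Longrightarrow> Cod E w = pb_ob E s t \<Longrightarrow> b \<in> Ar E \<Longrightarrow> Dom E b = Dom E w \<Longrightarrow> Cod E b = O2 \<Longrightarrow>
      q \<bullet> w = e \<bullet> b \<Longrightarrow> IComp P \<bullet> w = p \<bullet> w"
proof -
  have pq: "p \<in> Ar E" "Dom E p = pb_ob E s t" "Cod E p = coprod X O2" "q \<in> Ar E" "Dom E q = pb_ob E s t" "Cod E q = coprod X O2"
    using pr[of s t] st by (simp_all add: p_def q_def IAr)
  let ?Q = "\<lambda>c. c \<in> Ar E \<and> Dom E c = Dom E q \<and> Cod E c = coprod X O2 \<and>
           (\<forall>w a. w \<in> Ar E \<and> Cod E w = Dom E q \<and> a \<in> Ar E \<and> Dom E a = Dom E w \<and> Cod E a = X \<and>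
              q \<bullet> w = inl X O2 \<bullet> a \<longrightarrow> c \<bullet> w = q \<bullet> w) \<and>
           (\<forall>w a. w \<in> Ar E \<and> Cod E w = Dom E q \<and> a \<in> Ar E \<and> Dom E a = Dom E w \<and> Cod E a = O2 \<and>
              q \<bullet> w = inr X O2 \<bullet> a \<longrightarrow> c \<bullet> w = p \<bullet> w)"
  have "\<exists>c. ?Q c"
    by (rule coprod_if[OF X O2 pq(4,6) pq(4) refl pq(6) pq(1) _ pq(3)]) (use pq(2,5) in \<open>simp, blast\<close>)
  then have "?Q (SOME c. ?Q c)" by (rule someI_ex)
  moreover have "IComp P = (SOME c. ?Q c)"
    unfolding p_def q_def arrow_icat_simps(3,4) by (simp add: arrow_icat_def Let_def)
  ultimately have Q: "?Q (IComp P)" by simp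
  then show "IComp P \<in> Ar E" "Dom E (IComp P) = pb_ob E s t" "Cod E (IComp P) = IAr P" using pq IAr by simp_all
  show "\<And>w a. w \<in> Ar E \<Longrightarrow> Cod E w = pb_ob E s t \<Longrightarrow> a \<in> Ar E \<Longrightarrow> Dom E a = Dom E w \<Longrightarrow> Cod E a = X \<Longrightarrow>
      q \<bullet> w = u \<bullet> a \<Longrightarrow> IComp P \<bullet> w = q \<bullet> w" using Q unfolding pq(5) by blast
  show "\<And>w b. w \<in> Ar E \<Longrightarrow> Cod E w = pb_ob E s t \<Longrightarrow> b \<in> Ar E \<Longrightarrow> Dom E b = Dom E w \<Longrightarrow> Cod E b = O2 \<Longrightarrow>
      q \<bullet> w = e \<bullet> b \<Longrightarrow> IComp P \<bullet> w = p \<bullet> w" using Q unfolding pq(5) by blast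
qed

lemmas m_comp = icomp_comp[of P, OF st(1,2) st(3)[folded IAr(2)] st(6,7) st(8)[folded IAr(2)] IComp(1-3)]

lemma m_cases:
  assumes gf: "composable P g f"
  shows "a \<in> Ar E \<Longrightarrow> Cod E a = X \<Longrightarrow> f = u \<bullet> a \<Longrightarrow> icomp E P g f = f"
    "b \<in> Ar E \<Longrightarrow> Cod E b = O2 \<Longrightarrow> f = e \<bullet> b \<Longrightarrow> icomp E P g f = g"
proof -
  have "cmp s t g f" using gf st by (simp add: composable_def cmp_def IAr)
  note w = pair[OF this]
  have d: "Dom E g = Dom E f" using gf by (simp add: composable_def)
  show "a \<in> Ar E \<Longrightarrow> Cod E a = X \<Longrightarrow> f = u \<bullet> a \<Longrightarrow> icomp E P g f = f"
    using IComp(4)[OF w(1,3), of a] w(2,5) d ue by (simp add: icomp_def)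
  show "b \<in> Ar E \<Longrightarrow> Cod E b = O2 \<Longrightarrow> f = e \<bullet> b \<Longrightarrow> icomp E P g f = g"
    using IComp(5)[OF w(1,3), of b] w(2,4,5) d ue by (simp add: icomp_def)
qed

text \<open>Apart from the right unit law, where the arrow applied first is an identity outright,
  the composition laws are checked by cases on that arrow. In each case \<open>m_cases\<close>
  replaces a composite by one of its factors.\<close>

lemma is_icat_arrow: "is_icat E P"
proof -
  have src: "s \<bullet> icomp E P g f = s \<bullet> f" if gf: "composable P g f" for g f
  proof -
    note c = gf[unfolded composable_def]
    note m = m_comp[OF gf]
    show ?thesis
    proof (rule arrow_cases[of f])
      fix w a assume w: "w \<in> Ar E" "Cod E w = Dom E f" and a: "a \<in> Ar E" "Dom E a = Dom E w" "Cod E a = X" "f \<bullet> w = u \<bullet> a"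
      show "s \<bullet> icomp E P g f \<bullet> w = s \<bullet> f \<bullet> w"
        using m_cases(1)[OF m(5)[OF w] a(1,3,4)] m w a c st by (simp add: E.comp_assoc)
    next
      fix w b assume w: "w \<in> Ar E" "Cod E w = Dom E f" and b: "b \<in> Ar E" "Dom E b = Dom E w" "Cod E b = O2" "f \<bullet> w = e \<bullet> b"
      \<comment> \<open>Here \<open>f w\<close> is the identity of \<open>b\<close>, so its source
        and target are both \<open>b\<close>; the composite is \<open>g w\<close>, whose source is
        the target of \<open>f w\<close>.\<close>
      have "s \<bullet> (g \<bullet> w) = s \<bullet> (f \<bullet> w)" using m(5)[OF w] b st_comp unfolding composable_def by simp
      then show "s \<bullet> icomp E P g f \<bullet> w = s \<bullet> f \<bullet> w"
        using m_cases(2)[OF m(5)[OF w] b(1,3,4)] m w b c st by (simp add: E.comp_assoc)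
    qed (use m c st in simp_all)
  qed
  have tgt: "t \<bullet> icomp E P g f = t \<bullet> g" if gf: "composable P g f" for g f
  proof -
    note c = gf[unfolded composable_def]
    note m = m_comp[OF gf]
    show ?thesis
    proof (rule arrow_cases[of f])
      fix w a assume w: "w \<in> Ar E" "Cod E w = Dom E f" and a: "a \<in> Ar E" "Dom E a = Dom E w" "Cod E a = X" "f \<bullet> w = u \<bullet> a"
      have "s \<bullet> (g \<bullet> w) = j1 \<bullet> a" using m(5)[OF w] a st_comp unfolding composable_def by simp
      \<comment> \<open>The composite is \<open>f w\<close>, and \<open>g w\<close> is the identity
        of its target, so both have the same target.\<close>
      then have "g \<bullet> w = e \<bullet> (j1 \<bullet> a)" using arrow_eq_ident[of "g \<bullet> w" a] w c a by simp
      then have "t \<bullet> (g \<bullet> w) = t \<bullet> (f \<bullet> w)" using a j st_comp by simp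
      then show "t \<bullet> icomp E P g f \<bullet> w = t \<bullet> g \<bullet> w"
        using m_cases(1)[OF m(5)[OF w] a(1,3,4)] m w a c st by (simp add: E.comp_assoc)
    next
      fix w b assume w: "w \<in> Ar E" "Cod E w = Dom E f" and b: "b \<in> Ar E" "Dom E b = Dom E w" "Cod E b = O2" "f \<bullet> w = e \<bullet> b"
      show "t \<bullet> icomp E P g f \<bullet> w = t \<bullet> g \<bullet> w"
        using m_cases(2)[OF m(5)[OF w] b(1,3,4)] m w b c st by (simp add: E.comp_assoc)
    qed (use m c st in simp_all)
  qed
  show ?thesis
  proof (rule icatI)
    fix f assume f: "f \<in> Ar E" "Cod E f = IAr P"
    have c: "composable P f (IId P \<bullet> (s \<bullet> f))" "composable P (IId P \<bullet> (t \<bullet> f)) f"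
      using f st ue st_comp by (simp_all add: composable_def IAr(3))
    show "icomp E P f (IId P \<bullet> (s \<bullet> f)) = f"
      using m_cases(2)[OF c(1), of "s \<bullet> f"] f st ue by (simp add: IAr(3))
    note m = m_comp[OF c(2)]
    show "icomp E P (IId P \<bullet> (t \<bullet> f)) f = f"
    proof (rule arrow_cases[OF f])
      fix w a assume w: "w \<in> Ar E" "Cod E w = Dom E f" and a: "a \<in> Ar E" "Dom E a = Dom E w" "Cod E a = X" "f \<bullet> w = u \<bullet> a"
      show "icomp E P (IId P \<bullet> (t \<bullet> f)) f \<bullet> w = f \<bullet> w"
        using m_cases(1)[OF m(5)[OF w] a(1,3,4)] m(4)[OF w] w a f by simp
    next
      fix w b assume w: "w \<in> Ar E" "Cod E w = Dom E f" and b: "b \<in> Ar E" "Dom E b = Dom E w" "Cod E b = O2" "f \<bullet> w = e \<bullet> b"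
      have "e \<bullet> (t \<bullet> f) \<bullet> w = f \<bullet> w" using w b f st ue st_comp by (simp add: E.comp_assoc)
      then show "icomp E P (IId P \<bullet> (t \<bullet> f)) f \<bullet> w = f \<bullet> w"
        using m_cases(2)[OF m(5)[OF w] b(1,3,4)] m(4)[OF w] w b f by (simp add: IAr(3))
    qed (use m f in simp_all)
  next
    fix h g f assume hg: "composable P h g" and gf: "composable P g f"
    note hg' = m_comp[OF hg] and gf' = m_comp[OF gf] and c = hg[unfolded composable_def] gf[unfolded composable_def]
    have cd: "Dom E h = Dom E f" "Dom E g = Dom E f" using c by simp_all
    have l: "composable P (icomp E P h g) f" using hg' src[OF hg] c by (simp add: composable_def IAr)
    have r: "composable P h (icomp E P g f)" using gf' tgt[OF gf] c by (simp add: composable_def IAr)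
    note ml = m_comp[OF l] and mr = m_comp[OF r]
    show "icomp E P (icomp E P h g) f = icomp E P h (icomp E P g f)"
    \<comment> \<open>Both bracketings equal \<open>f\<close> where \<open>f\<close> is the
      non-identity arrow, and the composite of \<open>h\<close> and \<open>g\<close> where
      \<open>f\<close> is an identity.\<close>
    proof (rule arrow_cases[of f])
      fix w a assume w: "w \<in> Ar E" "Cod E w = Dom E f" and a: "a \<in> Ar E" "Dom E a = Dom E w" "Cod E a = X" "f \<bullet> w = u \<bullet> a"
      have w': "Cod E w = Dom E (icomp E P g f)" using w gf' by simp
      have "icomp E P g f \<bullet> w = f \<bullet> w" using m_cases(1)[OF gf'(5)[OF w] a(1,3,4)] gf'(4)[OF w] by simp
      moreover from this have "icomp E P h (icomp E P g f) \<bullet> w = icomp E P g f \<bullet> w"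
        using m_cases(1)[OF mr(5)[OF w(1) w'] a(1,3)] mr(4)[OF w(1) w'] a(4) by simp
      ultimately show "icomp E P (icomp E P h g) f \<bullet> w = icomp E P h (icomp E P g f) \<bullet> w"
        using m_cases(1)[OF ml(5)[OF w] a(1,3,4)] ml(4)[OF w] by simp
    next
      fix w b assume w: "w \<in> Ar E" "Cod E w = Dom E f" and b: "b \<in> Ar E" "Dom E b = Dom E w" "Cod E b = O2" "f \<bullet> w = e \<bullet> b"
      have w': "Cod E w = Dom E (icomp E P g f)" "Cod E w = Dom E g" using w gf' cd by simp_all
      have "icomp E P g f \<bullet> w = g \<bullet> w" using m_cases(2)[OF gf'(5)[OF w] b(1,3,4)] gf'(4)[OF w] by simp
      then have "icomp E P h (icomp E P g f) \<bullet> w = icomp E P h g \<bullet> w"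
        using mr(4)[OF w(1) w'(1)] hg'(4)[OF w(1) w'(2)] by simp
      then show "icomp E P (icomp E P h g) f \<bullet> w = icomp E P h (icomp E P g f) \<bullet> w"
        using m_cases(2)[OF ml(5)[OF w] b(1,3,4)] ml(4)[OF w] by simp
    qed (use ml mr gf' c in simp_all)
  qed (use st ue IComp src tgt in \<open>simp_all add: IAr\<close>)
qed

end

section \<open>Internal functors and transformations out of the walking arrow\<close>

context arrow_icat
begin

lemma ifunc_arrow_D:
  assumes B: "is_icat E B" and F: "is_ifunc E P B F"
  shows "IFO F \<bullet> j0 = ISrc B \<bullet> (IFA F \<bullet> u)" "IFO F \<bullet> j1 = ITgt B \<bullet> (IFA F \<bullet> u)" "IFA F \<bullet> e = IId B \<bullet> IFO F"
proof -
  interpret B: icat E B by (rule icat) fact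
  note F' = ifuncD[OF is_icat_arrow B F, unfolded IAr(3)]
  show "IFO F \<bullet> j0 = ISrc B \<bullet> (IFA F \<bullet> u)" "IFO F \<bullet> j1 = ITgt B \<bullet> (IFA F \<bullet> u)"
    using F'(1-8) st ue B.A' IAr(2) by (metis E.comp_assoc)+
  show "IFA F \<bullet> e = IId B \<bullet> IFO F" by (rule F'(9))
qed

text \<open>The image of the generic arrow \<open>u\<close> determines the object part through its
  source and target, and the object part determines the arrow part on the summand of
  identities.\<close>

lemma ifunc_arrow_eqI:
  assumes B: "is_icat E B" and F: "is_ifunc E P B F" and G: "is_ifunc E P B G" and eq: "IFA F \<bullet> u = IFA G \<bullet> u"
  shows "F = G"
proof -
  note F' = ifuncD(1-6)[OF is_icat_arrow B F] and G' = ifuncD(1-6)[OF is_icat_arrow B G]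
  note FD = ifunc_arrow_D[OF B F] and GD = ifunc_arrow_D[OF B G]
  have O: "IFO F = IFO G"
    by (rule copair_eqI[OF X X]) (use F' G' FD GD eq IAr in simp_all)
  have "IFA F = IFA G"
    by (rule copair_eqI[OF X O2]) (use F' G' FD GD eq IAr O in simp_all)
  with O show ?thesis by (cases F; cases G) simp
qed

text \<open>The functor that classifies \<open>a\<close>. All its values are forced: the two copies
  of \<open>X\<close> go to the source and target of \<open>a\<close>, the generic arrow goes to
  \<open>a\<close>, and identities go to identities.\<close>

definition arrow_ifunc :: "('o, 'a) icat \<Rightarrow> 'a \<Rightarrow> 'a ifunc" where
  "arrow_ifunc B a = (let f = copair X X (ISrc B \<bullet> a) (ITgt B \<bullet> a) in \<lparr>IFO = f, IFA = copair X O2 a (IId B \<bullet> f)\<rparr>)"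

lemma arrow_ifunc:
  assumes B: "is_icat E B" and a: "a \<in> Ar E" "Dom E a = X" "Cod E a = IAr B"
  shows "is_ifunc E P B (arrow_ifunc B a)" "IFA (arrow_ifunc B a) \<bullet> u = a" "IFO (arrow_ifunc B a) \<bullet> j0 = ISrc B \<bullet> a"
proof -
  interpret B: icat E B by (rule icat) fact
  define f where "f = copair X X (ISrc B \<bullet> a) (ITgt B \<bullet> a)"
  have f: "f \<in> Ar E" "Dom E f = O2" "Cod E f = IOb B" "f \<bullet> j0 = ISrc B \<bullet> a" "f \<bullet> j1 = ITgt B \<bullet> a"
    using copair[of "ISrc B \<bullet> a" X "ITgt B \<bullet> a" X] a B.A' by (simp_all add: f_def)
  define g where "g = copair X O2 a (IId B \<bullet> f)"
  have g: "g \<in> Ar E" "Dom E g = IAr P" "Cod E g = IAr B" "g \<bullet> u = a" "g \<bullet> e = IId B \<bullet> f"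
    using copair[of a X "IId B \<bullet> f" O2] a f B.A' by (simp_all add: g_def IAr)
  have eq: "arrow_ifunc B a = \<lparr>IFO = f, IFA = g\<rparr>" by (simp add: arrow_ifunc_def f_def g_def Let_def)
  have Id: "ISrc B \<bullet> (IId B \<bullet> y) = y" "ITgt B \<bullet> (IId B \<bullet> y) = y" if "y \<in> Ar E" "Cod E y = IOb B" for y
    using that B.A' by (simp_all add: E.comp_assoc[symmetric] E.id_l)
  have src: "ISrc B \<bullet> g = f \<bullet> s"
    by (rule copair_eqI[OF X O2]) (use f g st ue Id B.A' IAr in \<open>simp_all add: E.comp_assoc E.id_r\<close>)
  have tgt: "ITgt B \<bullet> g = f \<bullet> t"
    by (rule copair_eqI[OF X O2]) (use f g st ue Id B.A' IAr in \<open>simp_all add: E.comp_assoc E.id_r\<close>)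
  have gu: "g \<bullet> (u \<bullet> v) = a \<bullet> v" if "v \<in> Ar E" "Cod E v = X" for v
    using that g ue by (simp add: E.comp_assoc[symmetric])
  have ge: "g \<bullet> (e \<bullet> v) = IId B \<bullet> (f \<bullet> v)" if "v \<in> Ar E" "Cod E v = O2" for v
    using that g ue f B.A' by (simp add: E.comp_assoc[symmetric])
  have comp: "g \<bullet> icomp E P k h = B.m (g \<bullet> k) (g \<bullet> h)" if kh: "composable P k h" for k h
  proof -
    note c = kh[unfolded composable_def] and m = m_comp[OF kh]
    have "ISrc B \<bullet> (g \<bullet> k) = f \<bullet> (s \<bullet> k)" "ITgt B \<bullet> (g \<bullet> h) = f \<bullet> (t \<bullet> h)"
      using src tgt c g f st B.A' IAr by (metis E.comp_assoc)+
    then have cp: "B.cp (g \<bullet> k) (g \<bullet> h)" using c g by (simp add: B.cp_def)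
    note mB = B.m_ar[OF cp] B.m_comp[OF cp]
    \<comment> \<open>In either case one of \<open>k\<close> and \<open>h\<close> is an identity, so
      the composite of the images collapses by a unit law of \<open>B\<close>.\<close>
    show ?thesis
    proof (rule arrow_cases[of h])
      fix w v assume w: "w \<in> Ar E" "Cod E w = Dom E h" and v: "v \<in> Ar E" "Dom E v = Dom E w" "Cod E v = X" "h \<bullet> w = u \<bullet> v"
      have "s \<bullet> (k \<bullet> w) = j1 \<bullet> v" using m(5)[OF w] v st_comp unfolding composable_def by simp
      then have kw: "k \<bullet> w = e \<bullet> (j1 \<bullet> v)" using arrow_eq_ident[of "k \<bullet> w" v] w c v by simp
      have "f \<bullet> (j1 \<bullet> v) = ITgt B \<bullet> (a \<bullet> v)" using f v j a B.A' by (simp add: E.comp_assoc[symmetric])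
      then have "B.m (g \<bullet> (k \<bullet> w)) (g \<bullet> (h \<bullet> w)) = a \<bullet> v"
        using kw v gu[of v] ge[of "j1 \<bullet> v"] j a B.m_unit(1)[of "a \<bullet> v"] by simp
      moreover have "g \<bullet> icomp E P k h \<bullet> w = a \<bullet> v"
        using m_cases(1)[OF m(5)[OF w] v(1,3,4)] m g w v gu by (simp add: E.comp_assoc)
      ultimately show "g \<bullet> icomp E P k h \<bullet> w = B.m (g \<bullet> k) (g \<bullet> h) \<bullet> w"
        using mB(6)[of w] c g w by (simp add: E.comp_assoc)
    next
      fix w v assume w: "w \<in> Ar E" "Cod E w = Dom E h" and v: "v \<in> Ar E" "Dom E v = Dom E w" "Cod E v = O2" "h \<bullet> w = e \<bullet> v"
      have skw: "s \<bullet> (k \<bullet> w) = v" using m(5)[OF w] v st_comp unfolding composable_def by simp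
      have "ISrc B \<bullet> (g \<bullet> (k \<bullet> w)) = f \<bullet> v"
        unfolding skw[symmetric] using src c g f st B.A' IAr w by (metis E.comp_assoc E.comp_ar E.dom_comp E.cod_comp)
      then have "B.m (g \<bullet> (k \<bullet> w)) (g \<bullet> (h \<bullet> w)) = g \<bullet> (k \<bullet> w)"
        using v ge[of v] g c w B.m_unit(2)[of "g \<bullet> (k \<bullet> w)"] by simp
      moreover have "g \<bullet> icomp E P k h \<bullet> w = g \<bullet> (k \<bullet> w)"
        using m_cases(2)[OF m(5)[OF w] v(1,3,4)] m g w v by (simp add: E.comp_assoc)
      ultimately show "g \<bullet> icomp E P k h \<bullet> w = B.m (g \<bullet> k) (g \<bullet> h) \<bullet> w"
        using mB(6)[of w] c g w by (simp add: E.comp_assoc)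
    qed (use c m g mB in simp_all)
  qed
  show "is_ifunc E P B (arrow_ifunc B a)"
    unfolding eq by (rule ifuncI[OF is_icat_arrow B])
      (use f g src tgt comp cp_iff_composable[OF is_icat_arrow] IAr in simp_all)
  show "IFA (arrow_ifunc B a) \<bullet> u = a" "IFO (arrow_ifunc B a) \<bullet> j0 = ISrc B \<bullet> a" using f g eq by simp_all
qed

text \<open>Naturality is an equation between arrows out of \<open>X + O2\<close>. On the generic
  arrow \<open>u\<close> it is the given square; on identities both sides reduce by the unit laws to
  the component itself.\<close>

lemma is_intrans_copair:
  assumes B: "is_icat E B" and x: "is_ifunc E P B x" and y: "is_ifunc E P B y"
    and p: "p \<in> Ar E" "Dom E p = X" "Cod E p = IAr B" "ISrc B \<bullet> p = IFO x \<bullet> j0" "ITgt B \<bullet> p = IFO y \<bullet> j0"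
    and q: "q \<in> Ar E" "Dom E q = X" "Cod E q = IAr B" "ISrc B \<bullet> q = IFO x \<bullet> j1" "ITgt B \<bullet> q = IFO y \<bullet> j1"
    and sq: "icomp E B (IFA y \<bullet> u) p = icomp E B q (IFA x \<bullet> u)"
  shows "is_intrans E P B \<lparr>INSrc = x, INTgt = y, INMap = copair X X p q\<rparr>"
proof -
  interpret B: icat E B by (rule icat) fact
  note x' = ifuncD[OF is_icat_arrow B x] and y' = ifuncD[OF is_icat_arrow B y]
  note xD = ifunc_arrow_D[OF B x] and yD = ifunc_arrow_D[OF B y]
  define n where "n = copair X X p q"
  have n: "n \<in> Ar E" "Dom E n = O2" "Cod E n = IAr B" "n \<bullet> j0 = p" "n \<bullet> j1 = q"
    using copair[of p X q X] p q by (simp_all add: n_def)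
  have src: "ISrc B \<bullet> n = IFO x"
    by (rule copair_eqI[OF X X]) (use n x' p q j B.A' IAr in \<open>simp_all add: E.comp_assoc\<close>)
  have tgt: "ITgt B \<bullet> n = IFO y"
    by (rule copair_eqI[OF X X]) (use n y' p q j B.A' IAr in \<open>simp_all add: E.comp_assoc\<close>)
  have cp: "B.cp (IFA y) (n \<bullet> s)" "B.cp (n \<bullet> t) (IFA x)"
    using x'(1-8) y'(1-8) n st B.A' IAr src tgt by (simp_all add: B.cp_def E.comp_assoc[symmetric])
  note m = B.m_ar[OF cp(1)] B.m_comp[OF cp(1)] B.m_ar[OF cp(2)] B.m_comp[OF cp(2)]
  have "B.m (IFA y) (n \<bullet> s) = B.m (n \<bullet> t) (IFA x)"
  proof (rule copair_eqI[OF X O2])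
    show "B.m (IFA y) (n \<bullet> s) \<bullet> u = B.m (n \<bullet> t) (IFA x) \<bullet> u"
      using m x' y' n st ue sq IAr by (simp add: E.comp_assoc)
    show "B.m (IFA y) (n \<bullet> s) \<bullet> e = B.m (n \<bullet> t) (IFA x) \<bullet> e"
      using m x'(1-6) y'(1-6) n st ue IAr xD(3) yD(3) B.m_unit[of n] src tgt by (simp add: E.comp_assoc E.id_r)
  qed (use m x' y' n st IAr in simp_all)
  then show ?thesis unfolding n_def[symmetric]
    by (intro intransI[OF is_icat_arrow B]) (use x y n src tgt IAr in simp_all)
qed

text \<open>The universal 2-cell \<theta> has the generic arrow \<open>u\<close> as its component.
  Whiskering a functor \<open>x\<close> with \<theta> gives \<open>IFA x\<close> at
  \<open>u\<close>, which \<open>arrow_ifunc\<close> inverts; restricting a transformation along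
  \<open>d0\<close> and \<open>d1\<close> gives its components at \<open>j0\<close> and
  \<open>j1\<close>, which \<open>copair\<close> reassembles.\<close>

lemma is_copower_arrow_icat: "is_copower (Cat_internal E) walking_arrow (disc_icat X) P"
proof -
  let ?d0 = "point_ifunc P j0" and ?d1 = "point_ifunc P j1"
  define \<theta> where "\<theta> = \<lparr>INSrc = ?d0, INTgt = ?d1, INMap = u\<rparr>"
  note T = is_icat_disc[OF X] and P = is_icat_arrow
  have \<theta>: "is_intrans E (disc_icat X) P \<theta>"
    using is_intrans_point[OF P, of u X] ue st by (simp add: \<theta>_def)
  have d: "is_ifunc E (disc_icat X) P ?d0" "is_ifunc E (disc_icat X) P ?d1"
    using is_ifunc_point[OF P] j by (simp_all add: IAr)
  have \<theta>_simps [simp]: "INSrc \<theta> = ?d0" "INTgt \<theta> = ?d1" "INMap \<theta> = u" by (simp_all add: \<theta>_def)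
  have whisker: "FA (Hcomp (Cat_internal E) (disc_icat X) P B) (Ide (ifunc_cat E P B) x, \<theta>) =
      \<lparr>INSrc = ifunc_comp E x ?d0, INTgt = ifunc_comp E x ?d1, INMap = IFA x \<bullet> u\<rparr>"
    if "is_icat E B" "is_ifunc E P B x" for B x
    using hcomp_Ide_left[OF T P that \<theta>] by simp
  have leg: "FA (Hcomp (Cat_internal E) (disc_icat X) P B) (\<xi>, Ide (ifunc_cat E (disc_icat X) P) (point_ifunc P k)) =
      \<lparr>INSrc = ifunc_comp E (INSrc \<xi>) (point_ifunc P k), INTgt = ifunc_comp E (INTgt \<xi>) (point_ifunc P k), INMap = INMap \<xi> \<bullet> k\<rparr>"
    if "is_icat E B" "is_intrans E P B \<xi>" "k = j0 \<or> k = j1" for B \<xi> k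
    using hcomp_Ide_right[OF T P that(1) _ that(2), of "point_ifunc P k"] d that(3) by auto
  have hc1: "FO (Hcomp (Cat_internal E) (disc_icat X) P B) (x, point_ifunc P k) = ifunc_comp E x (point_ifunc P k)"
    if "is_ifunc E P B x" "k = j0 \<or> k = j1" for B x k
    using Hcomp_Cat_internal(1)[OF that(1)] d that(2) by auto
  \<comment> \<open>Functors out of a discrete category may be compared on their object parts
    alone.\<close>
  have ifunc_pt: "F = point_ifunc B f" if "is_icat E B" "is_ifunc E (disc_icat X) B F" "IFO F = f" for B F f
    using ifunc_disc_eq_point[OF that(1) X that(2)] that(3) by simp
  have comp_pt: "ifunc_comp E x (point_ifunc P k) = point_ifunc B (IFO x \<bullet> k)"
    if "is_icat E B" "is_ifunc E P B x" "k = j0 \<or> k = j1" for B x k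
    by (rule ifunc_pt[OF that(1)])
      (use ifunc_comp[OF T P that(1) _ that(2), of "point_ifunc P k"] d that(3) in \<open>auto simp: ifunc_comp_def\<close>)
  show ?thesis
  proof (rule two_category.copower_walking_arrowI[OF two_category_Cat_internal, where \<theta> = \<theta>], goal_cases)
    case 1 then show ?case using T by simp
  next
    case 2 then show ?case using P by simp
  next
    case 3 then show ?case using \<theta> by simp
  next
    case (4 B \<gamma>)
    then have B: "is_icat E B" and \<gamma>: "is_intrans E (disc_icat X) B \<gamma>" by simp_all
    note g = intransD[OF T B \<gamma>, unfolded disc_icat_simps]
    note a = arrow_ifunc[OF B g(3-5)]
    let ?x = "arrow_ifunc B (INMap \<gamma>)"
    have "ifunc_comp E ?x ?d0 = INSrc \<gamma>" "ifunc_comp E ?x ?d1 = INTgt \<gamma>"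
      using comp_pt[OF B a(1)] ifunc_arrow_D[OF B a(1)] a(2) ifunc_pt[OF B g(1) g(6)[symmetric]] ifunc_pt[OF B g(2) g(7)[symmetric]]
      by simp_all
    then have "FA (Hcomp (Cat_internal E) (disc_icat X) P B) (Ide (ifunc_cat E P B) ?x, \<theta>) = \<gamma>"
      unfolding whisker[OF B a(1)] using a(2) by simp
    moreover have "x = ?x" if "is_ifunc E P B x" "FA (Hcomp (Cat_internal E) (disc_icat X) P B) (Ide (ifunc_cat E P B) x, \<theta>) = \<gamma>" for x
      using ifunc_arrow_eqI[OF B that(1) a(1)] a(2) that(2) unfolding whisker[OF B that(1)] by auto
    ultimately show ?case using a(1) unfolding Cat_internal_simps(2) ifunc_cat_simps(1) by blast
  next
    case (5 B x y p q)
    then have B: "is_icat E B" and x: "is_ifunc E P B x" and y: "is_ifunc E P B y" by simp_all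
    have p: "is_intrans E (disc_icat X) B p" "INSrc p = point_ifunc B (IFO x \<bullet> j0)" "INTgt p = point_ifunc B (IFO y \<bullet> j0)"
      using 5(4) hc1[OF x] hc1[OF y] comp_pt[OF B x] comp_pt[OF B y] by (simp_all add: hom_iff)
    have q: "is_intrans E (disc_icat X) B q" "INSrc q = point_ifunc B (IFO x \<bullet> j1)" "INTgt q = point_ifunc B (IFO y \<bullet> j1)"
      using 5(5) hc1[OF x] hc1[OF y] comp_pt[OF B x] comp_pt[OF B y] by (simp_all add: hom_iff)
    note p' = intransD(3-7)[OF T B p(1), unfolded p(2,3) disc_icat_simps point_ifunc_simps]
      and q' = intransD(3-7)[OF T B q(1), unfolded q(2,3) disc_icat_simps point_ifunc_simps]
    have sq: "icomp E B (IFA y \<bullet> u) (INMap p) = icomp E B (INMap q) (IFA x \<bullet> u)"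
      using 5(6) whisker[OF B x] whisker[OF B y] by simp
    let ?n = "copair X X (INMap p) (INMap q)"
    have n: "?n \<in> Ar E" "Dom E ?n = O2" "?n \<bullet> j0 = INMap p" "?n \<bullet> j1 = INMap q" "Cod E ?n = IAr B"
      using copair[of "INMap p" X "INMap q" X] p' q' by simp_all
    let ?\<xi> = "\<lparr>INSrc = x, INTgt = y, INMap = ?n\<rparr>"
    have \<xi>: "is_intrans E P B ?\<xi>" by (rule is_intrans_copair[OF B x y p' q' sq])
    have "FA (Hcomp (Cat_internal E) (disc_icat X) P B) (?\<xi>, Ide (ifunc_cat E (disc_icat X) P) ?d0) = p"
      "FA (Hcomp (Cat_internal E) (disc_icat X) P B) (?\<xi>, Ide (ifunc_cat E (disc_icat X) P) ?d1) = q"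
      using leg[OF B \<xi>] comp_pt[OF B x] comp_pt[OF B y] n p q by simp_all
    moreover have "\<zeta> = ?\<xi>"
      if "is_intrans E P B \<zeta>" "INSrc \<zeta> = x" "INTgt \<zeta> = y"
        "FA (Hcomp (Cat_internal E) (disc_icat X) P B) (\<zeta>, Ide (ifunc_cat E (disc_icat X) P) ?d0) = p"
        "FA (Hcomp (Cat_internal E) (disc_icat X) P B) (\<zeta>, Ide (ifunc_cat E (disc_icat X) P) ?d1) = q" for \<zeta>
    proof -
      note z = intransD(3-5)[OF P B that(1)]
      have "INMap \<zeta> = ?n"
        by (rule copair_eqI[OF X X])
          (use z n IAr arg_cong[OF that(4), of INMap] arg_cong[OF that(5), of INMap] leg[OF B that(1)] in simp_all)
      then show ?thesis using that(2,3) by simp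
    qed
    moreover have "INSrc ?\<xi> = x" "INTgt ?\<xi> = y" by simp_all
    ultimately show ?case using \<xi>
      unfolding Cat_internal_simps(2) \<theta>_simps ifunc_cat_simps(3,4) hom_iff ifunc_cat_simps(2) mem_Collect_eq
      by (intro ex1I[of _ ?\<xi>]) blast+
  qed
qed

end

section \<open>Well-pointedness\<close>

lemma well_pointed_eqI:
  assumes "is_terminal C t" "faithful C (hom_functor C t)" "category C"
    and fg: "f \<in> Ar C" "g \<in> Ar C" "Dom C f = Dom C g" "Cod C f = Cod C g"
    and eq: "\<And>p. p \<in> Ar C \<Longrightarrow> Dom C p = t \<Longrightarrow> Cod C p = Dom C f \<Longrightarrow> f \<cdot>\<^bsub>C\<^esub> p = g \<cdot>\<^bsub>C\<^esub> p"
  shows "f = g"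
proof -
  interpret category C by fact
  have "FA (hom_functor C t) f = FA (hom_functor C t) g"
    using fg eq by (auto simp: hom_functor_def hom_iff intro!: restrict_ext)
  moreover have "inj_on (FA (hom_functor C t)) (hom C (Dom C f) (Cod C f))"
    using assms(2) fg by (simp add: faithful_def)
  ultimately show ?thesis using fg by (auto simp: hom_iff inj_on_def)
qed

context extensive_category
begin

text \<open>Object parts, arrow parts and components are all arrows into \<open>t\<close>. They
  exist and are unique by terminality, and every law, including preservation of composition, is an
  equation between arrows into \<open>t\<close>.\<close>

lemma two_terminal_disc:
  assumes t: "is_terminal E t"
  shows "is_two_terminal (Cat_internal E) (disc_icat t)"
proof -
  have tob: "t \<in> Ob E" using t by (simp add: is_terminal_def)
  note T = is_icat_disc[OF tob]
  have uniq: "f = g" if "f \<in> Ar E" "g \<in> Ar E" "Dom E f = Dom E g" "Cod E f = t" "Cod E g = t" for f g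
    using t that unfolding is_terminal_def by (metis E.dom_ob hom_iff)
  have ex: "\<exists>f. f \<in> Ar E \<and> Dom E f = Y \<and> Cod E f = t" if "Y \<in> Ob E" for Y
    using t that unfolding is_terminal_def by (metis hom_iff)
  have "(\<exists>!F. is_ifunc E A (disc_icat t) F) \<and> (\<exists>!\<alpha>. is_intrans E A (disc_icat t) \<alpha>)" if A: "is_icat E A" for A
  proof -
    interpret A: icat E A by (rule icat) fact
    interpret T: icat E "disc_icat t" by (rule icat) fact
    obtain f where f: "f \<in> Ar E" "Dom E f = IOb A" "Cod E f = t" using ex A.A' by blast
    obtain g where g: "g \<in> Ar E" "Dom E g = IAr A" "Cod E g = t" using ex A.A' by blast
    let ?F = "\<lparr>IFO = f, IFA = g\<rparr>"
    have F: "is_ifunc E A (disc_icat t) ?F"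
    proof (rule ifuncI[OF A T])
      fix h k assume hk: "A.cp h k"
      note m = A.m_ar[OF hk]
      have c: "h \<in> Ar E" "k \<in> Ar E" "Cod E h = IAr A" "Cod E k = IAr A" "Dom E h = Dom E k" using hk by (simp_all add: A.cp_def)
      have "g \<bullet> h = g \<bullet> k" by (rule uniq) (use c g in simp_all)
      then have "T.cp (g \<bullet> h) (g \<bullet> k)" unfolding T.cp_def using c g by simp
      note n = T.m_ar[OF this]
      show "IFA ?F \<bullet> A.m h k = T.m (IFA ?F \<bullet> h) (IFA ?F \<bullet> k)"
        by (rule uniq) (use m n c g in simp_all)
    qed (use f g A.A' tob in \<open>simp_all add: E.id_l, (intro uniq; simp)+\<close>)
    have Fu: "G = ?F" if "is_ifunc E A (disc_icat t) G" for G
      using ifuncD(1-6)[OF A T that] f g uniq[of "IFO G" f] uniq[of "IFA G" g] by (cases G) simp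
    let ?a = "\<lparr>INSrc = ?F, INTgt = ?F, INMap = f\<rparr>"
    have "is_intrans E A (disc_icat t) ?a" using iid[OF A T F] f by (simp add: E.id_l)
    moreover have "\<alpha> = ?a" if "is_intrans E A (disc_icat t) \<alpha>" for \<alpha>
      using intransD(3-5)[OF A T that] Fu[OF intransD(1)[OF A T that]] Fu[OF intransD(2)[OF A T that]] f uniq[of "INMap \<alpha>" f]
      by (cases \<alpha>) simp
    ultimately show ?thesis using F Fu by blast
  qed
  then show ?thesis using T by (simp add: is_two_terminal_def)
qed

lemma postcomp_Cat_internal:
  assumes "is_icat E P" "is_icat E A" "is_icat E B"
  shows "is_ifunc E A B F \<Longrightarrow> is_ifunc E P A x \<Longrightarrow> FO (postcomp1 (Cat_internal E) P A B F) x = ifunc_comp E F x"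
    "is_ifunc E A B F \<Longrightarrow> is_intrans E P A \<xi> \<Longrightarrow> FA (postcomp1 (Cat_internal E) P A B F) \<xi> =
      \<lparr>INSrc = ifunc_comp E F (INSrc \<xi>), INTgt = ifunc_comp E F (INTgt \<xi>), INMap = IFA F \<bullet> INMap \<xi>\<rparr>"
    "is_intrans E A B \<beta> \<Longrightarrow> is_ifunc E P A x \<Longrightarrow> NMap (postcomp2 (Cat_internal E) P A B \<beta>) x =
      \<lparr>INSrc = ifunc_comp E (INSrc \<beta>) x, INTgt = ifunc_comp E (INTgt \<beta>) x, INMap = INMap \<beta> \<bullet> IFO x\<rparr>"
  using hcomp_Ide_left[OF assms] hcomp_Ide_right[OF assms]
  by (simp_all add: postcomp1_def postcomp2_def Hcomp_Cat_internal)

lemma two_well_pointed_if_well_pointed: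
  assumes "well_pointed E"
  shows "two_well_pointed (Cat_internal E)"
proof -
  obtain t where t: "is_terminal E t" and ff: "faithful E (hom_functor E t)"
    using assms by (auto simp: well_pointed_def)
  have tob: "t \<in> Ob E" using t by (simp add: is_terminal_def)
  interpret arrow_icat E t by unfold_locales (rule tob)
  note eqI = well_pointed_eqI[OF t ff E.category_axioms]
  interpret K: two_category "Cat_internal E" by (rule two_category_Cat_internal)
  note P = is_icat_arrow
  have "faithful_on_1_cells (Cat_internal E) (hom_two_functor (Cat_internal E) P)"
    unfolding faithful_on_1_cells_def
  proof (intro ballI inj_onI)
    fix A B F G assume "A \<in> Obj (Cat_internal E)" "B \<in> Obj (Cat_internal E)"
      "F \<in> Ob (Hom (Cat_internal E) A B)" "G \<in> Ob (Hom (Cat_internal E) A B)"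
      and eq: "FO (THom (hom_two_functor (Cat_internal E) P) A B) F = FO (THom (hom_two_functor (Cat_internal E) P) A B) G"
    then have A: "is_icat E A" and B: "is_icat E B" and F: "is_ifunc E A B F" and G: "is_ifunc E A B G" by simp_all
    interpret A: icat E A by (rule icat) fact
    interpret B: icat E B by (rule icat) fact
    note F' = ifuncD[OF A B F] and G' = ifuncD[OF A B G]
    have pc: "postcomp1 (Cat_internal E) P A B F = postcomp1 (Cat_internal E) P A B G"
      using eq F G by (simp add: K.hom_two_functor_simps)
    have IFA: "IFA F = IFA G"
    proof (rule eqI)
      fix p assume p: "p \<in> Ar E" "Dom E p = t" "Cod E p = Dom E (IFA F)"
      have p': "Cod E p = IAr A" using p F' by simp
      note x = arrow_ifunc[OF A p(1,2) p']
      note x' = ifuncD(4-6)[OF P A x(1)]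
      have "ifunc_comp E F (arrow_ifunc A p) = ifunc_comp E G (arrow_ifunc A p)"
        using pc postcomp_Cat_internal(1)[OF P A B F x(1)] postcomp_Cat_internal(1)[OF P A B G x(1)] by simp
      then have "IFA F \<bullet> IFA (arrow_ifunc A p) \<bullet> u = IFA G \<bullet> IFA (arrow_ifunc A p) \<bullet> u" by (simp add: ifunc_comp_def)
      then show "IFA F \<bullet> p = IFA G \<bullet> p" using x' F' G' ue x(2) by (simp add: E.comp_assoc)
    qed (use F' G' in simp_all)
    \<comment> \<open>The object part is recovered from the arrow part as the source of the image of
      an identity, so agreement on arrows is enough.\<close>
    have IFO: "IFO H = ISrc B \<bullet> (IFA H \<bullet> IId A)" if "is_ifunc E A B H" for H
      using ifuncD[OF A B that] B.A' by (simp add: E.comp_assoc[symmetric] E.id_l)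
    show "F = G" using IFA IFO[OF F] IFO[OF G] by (cases F; cases G) simp
  qed
  moreover have "faithful_on_2_cells (Cat_internal E) (hom_two_functor (Cat_internal E) P)"
    unfolding faithful_on_2_cells_def faithful_def
  proof (intro ballI inj_onI)
    fix A B F G \<alpha> \<beta> assume "A \<in> Obj (Cat_internal E)" "B \<in> Obj (Cat_internal E)"
      "\<alpha> \<in> hom (Hom (Cat_internal E) A B) F G" "\<beta> \<in> hom (Hom (Cat_internal E) A B) F G"
      and eq: "FA (THom (hom_two_functor (Cat_internal E) P) A B) \<alpha> = FA (THom (hom_two_functor (Cat_internal E) P) A B) \<beta>"
    then have A: "is_icat E A" and B: "is_icat E B" and \<alpha>: "is_intrans E A B \<alpha>" and \<beta>: "is_intrans E A B \<beta>"
      and st: "INSrc \<alpha> = INSrc \<beta>" "INTgt \<alpha> = INTgt \<beta>" by (simp_all add: hom_iff)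
    interpret A: icat E A by (rule icat) fact
    note a = intransD(3-5)[OF A B \<alpha>] and b = intransD(3-5)[OF A B \<beta>]
    have pc: "postcomp2 (Cat_internal E) P A B \<alpha> = postcomp2 (Cat_internal E) P A B \<beta>"
      using eq \<alpha> \<beta> by (simp add: K.hom_two_functor_simps)
    have "INMap \<alpha> = INMap \<beta>"
    proof (rule eqI)
      fix p assume p: "p \<in> Ar E" "Dom E p = t" "Cod E p = Dom E (INMap \<alpha>)"
      \<comment> \<open>A point \<open>p\<close> of the object of objects is reached through its
        identity arrow: the functor out of \<open>P\<close> that classifies \<open>IId A p\<close>
        sends \<open>j0\<close> to \<open>p\<close>.\<close>
      let ?p = "IId A \<bullet> p"
      have p': "?p \<in> Ar E" "Dom E ?p = t" "Cod E ?p = IAr A" using p a A.A' by simp_all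
      note x = arrow_ifunc[OF A p']
      note x' = ifuncD(1-3)[OF P A x(1)]
      have "INMap \<alpha> \<bullet> IFO (arrow_ifunc A ?p) = INMap \<beta> \<bullet> IFO (arrow_ifunc A ?p)"
        using pc postcomp_Cat_internal(3)[OF P A B \<alpha> x(1)] postcomp_Cat_internal(3)[OF P A B \<beta> x(1)] by simp
      then have "INMap \<alpha> \<bullet> (IFO (arrow_ifunc A ?p) \<bullet> j0) = INMap \<beta> \<bullet> (IFO (arrow_ifunc A ?p) \<bullet> j0)"
        using x' a b j IAr by (simp add: E.comp_assoc[symmetric])
      moreover have "ISrc A \<bullet> ?p = p" using p a A.A' by (simp add: E.comp_assoc[symmetric] E.id_l)
      ultimately show "INMap \<alpha> \<bullet> p = INMap \<beta> \<bullet> p" using x(3) by simp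
    qed (use a b in simp_all)
    then show "\<alpha> = \<beta>" using st by (cases \<alpha>; cases \<beta>) simp
  qed
  ultimately show ?thesis
    using two_category_Cat_internal two_terminal_disc[OF t] is_copower_arrow_icat by (auto simp: two_well_pointed_def)
qed

lemma well_pointed_if_two_well_pointed:
  assumes "two_well_pointed (Cat_internal E)"
  shows "well_pointed E"
proof -
  interpret K: two_category "Cat_internal E" by (rule two_category_Cat_internal)
  obtain T P where T2: "is_two_terminal (Cat_internal E) T" and cop: "is_copower (Cat_internal E) walking_arrow T P"
    and ff: "faithful_on_1_cells (Cat_internal E) (hom_two_functor (Cat_internal E) P)"
    using assms by (auto simp: two_well_pointed_def)
  have T: "is_icat E T" and uniq: "\<And>A. is_icat E A \<Longrightarrow> \<exists>!F. is_ifunc E A T F"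
    using T2 by (simp_all add: is_two_terminal_def)
  have terminal: "is_terminal E (IOb T)"
    unfolding is_terminal_def
  proof (intro conjI ballI)
    show "IOb T \<in> Ob E" using T by (simp add: is_icat_def Let_def)
    fix X assume X: "X \<in> Ob E"
    note D = is_icat_disc[OF X]
    obtain F where F: "is_ifunc E (disc_icat X) T F" "\<And>G. is_ifunc E (disc_icat X) T G \<Longrightarrow> G = F"
      using uniq[OF D] by blast
    show "\<exists>!f. f \<in> hom E X (IOb T)"
    proof (rule ex1I)
      show "IFO F \<in> hom E X (IOb T)" using ifuncD(1-3)[OF D T F(1)] by (simp add: hom_iff)
      fix f assume "f \<in> hom E X (IOb T)"
      then have "point_ifunc T f = F" using is_ifunc_point[OF T] F(2) by (simp add: hom_iff)
      then show "f = IFO F" by (metis point_ifunc_simps(1))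
    qed
  qed
  moreover have "faithful E (hom_functor E (IOb T))"
    unfolding faithful_def
  proof (intro ballI inj_onI)
    fix X Y f g assume X: "X \<in> Ob E" and Y: "Y \<in> Ob E" and "f \<in> hom E X Y" "g \<in> hom E X Y"
      and eq: "FA (hom_functor E (IOb T)) f = FA (hom_functor E (IOb T)) g"
    then have f: "f \<in> Ar E" "Dom E f = X" "Cod E f = Y" and g: "g \<in> Ar E" "Dom E g = X" "Cod E g = Y"
      by (simp_all add: hom_iff)
    have "(\<lambda>p \<in> hom E (IOb T) X. f \<bullet> p) = (\<lambda>p \<in> hom E (IOb T) X. g \<bullet> p)"
      using eq f g by (simp add: hom_functor_def)
    then have fg: "f \<bullet> p = g \<bullet> p" if "p \<in> Ar E" "Dom E p = IOb T" "Cod E p = X" for p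
      using that fun_cong[of _ _ p] by (metis (no_types, lifting) hom_iff restrict_apply')
    interpret T: icat E T by (rule icat) fact
    note DX = is_icat_disc[OF X] and DY = is_icat_disc[OF Y]
    let ?F = "\<lparr>IFO = f, IFA = f\<rparr>" and ?G = "\<lparr>IFO = g, IFA = g\<rparr>"
    note F = is_ifunc_disc[OF f] and G = is_ifunc_disc[OF g]
    \<comment> \<open>Source and target of \<open>disc_icat X\<close> are identities, so the arrow
      part of \<open>x\<close> is its object part after \<open>ISrc T\<close>. The object part is a
      point of \<open>X\<close>, and there \<open>f\<close> and \<open>g\<close> agree.\<close>
    have on_T: "ifunc_comp E ?F x = ifunc_comp E ?G x" if x: "is_ifunc E T (disc_icat X) x" for x
    proof -
      note x' = ifuncD[OF T DX x]
      have "IFA x = IFO x \<bullet> ISrc T" using x'(3-7) by (simp add: E.id_l)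
      moreover have "f \<bullet> IFO x = g \<bullet> IFO x" using x' by (intro fg) simp_all
      ultimately show ?thesis using x' f g T.A' by (simp add: ifunc_comp_def E.comp_assoc[symmetric])
    qed
    have "postcomp1 (Cat_internal E) T (disc_icat X) (disc_icat Y) ?F = postcomp1 (Cat_internal E) T (disc_icat X) (disc_icat Y) ?G"
    proof (rule func_eqI[of _ "Ob (ifunc_cat E T (disc_icat X))" _ "Ar (ifunc_cat E T (disc_icat X))"])
      fix x assume x: "x \<in> Ob (ifunc_cat E T (disc_icat X))"
      then show "FO (postcomp1 (Cat_internal E) T (disc_icat X) (disc_icat Y) ?F) x =
          FO (postcomp1 (Cat_internal E) T (disc_icat X) (disc_icat Y) ?G) x"
        using postcomp_Cat_internal(1)[OF T DX DY] F G on_T by simp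
    next
      fix \<xi> assume "\<xi> \<in> Ar (ifunc_cat E T (disc_icat X))"
      then have \<xi>: "is_intrans E T (disc_icat X) \<xi>" by simp
      note x = intransD[OF T DX \<xi>]
      \<comment> \<open>The component of a transformation into \<open>disc_icat X\<close> is again
        an arrow from \<open>IOb T\<close> to \<open>X\<close>, that is, a point.\<close>
      have "f \<bullet> INMap \<xi> = g \<bullet> INMap \<xi>" using x by (intro fg) simp_all
      then show "FA (postcomp1 (Cat_internal E) T (disc_icat X) (disc_icat Y) ?F) \<xi> =
          FA (postcomp1 (Cat_internal E) T (disc_icat X) (disc_icat Y) ?G) \<xi>"
        using postcomp_Cat_internal(2)[OF T DX DY F \<xi>] postcomp_Cat_internal(2)[OF T DX DY G \<xi>] on_T x(1,2) by simp
    qed (simp_all add: postcomp1_def)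
    then have "postcomp1 (Cat_internal E) P (disc_icat X) (disc_icat Y) ?F = postcomp1 (Cat_internal E) P (disc_icat X) (disc_icat Y) ?G"
      by (intro K.copower_postcomp1_eq[OF _ cop]) (use T DX DY F G in simp_all)
    then have "FO (THom (hom_two_functor (Cat_internal E) P) (disc_icat X) (disc_icat Y)) ?F =
        FO (THom (hom_two_functor (Cat_internal E) P) (disc_icat X) (disc_icat Y)) ?G"
      using F G by (simp add: K.hom_two_functor_simps)
    then have "?F = ?G"
      using ff DX DY F G unfolding faithful_on_1_cells_def inj_on_def Cat_internal_simps ifunc_cat_simps mem_Collect_eq by blast
    then show "f = g" by simp
  qed
  ultimately show ?thesis using E.category_axioms by (auto simp: well_pointed_def)
qed

end

theorem theorem5p14:
  fixes E :: "('o, 'a) cat"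
  assumes "lextensive E" and "cartesian_closed E"
  shows "well_pointed E \<longleftrightarrow> two_well_pointed (Cat_internal E)"
proof -
  have ext: "extensive E" using assms(1) by (simp add: lextensive_def)
  then interpret category E by (simp add: extensive_def)
  interpret extensive_category E
    by unfold_locales (use ext in \<open>simp_all add: extensive_def\<close>)
  show ?thesis
    using two_well_pointed_if_well_pointed well_pointed_if_two_well_pointed by blast
qed

end
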